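(* Let $0\le q\in L_1^{loc}(\mathbb{R})$ and assume there is $a\in(0,\infty)$ with $\inf_{x\in\mathbb{R}}\int_{x-a}^{x+a}q(t)\,dt>0$ (so that the equation $-y'+qy=f$ is correctly solvable in $L_p(\mathbb{R})$ for every $p\in[1,\infty]$). Suppose $q=q_1+q_2$ on $\mathbb{R}$, where $q_1>0$ is absolutely continuous and $q_2\in L_1^{loc}(\mathbb{R})$. Suppose there is a continuous function $s>0$ on $\mathbb{R}$ such that: (a) $s(x)\to\infty$ as $|x|\to\infty$; (b) $\frac{1}{s(x)}\ge\frac{|q_1'(x)|}{q_1(x)^2}$ for all $|x|$ sufficiently large; (c) $\lim_{|x|\to\infty}\frac{s(x)}{x\,q_1(x)}=0$; (d) for some $\nu\in[1,\infty)$, $\frac1\nu\le\frac{s(t)}{s(x)}\le\nu$ for all $t\in\Delta(x)$ and all $|x|$ sufficiently large, where $\Delta(x)=\big[x-\frac{s(x)}{q_1(x)},\,x+\frac{s(x)}{q_1(x)}\big]$; (e) $\tilde\varkappa(x)\to0$ as $|x|\to\infty$, where $\tilde\varkappa(x)=\sup_{t\in\Delta(x)}|\varkappa_x(t)|$ and $\varkappa_x(t)=q_1(t)\int_x^t\frac{q_2(\xi)}{q_1(\xi)}d\xi$ for $t\in\Delta(x)$. Then for each $p\in[1,\infty]$ an asymptotic majorant $\varkappa_p$ of the set $D_p$ is given by $$\varkappa_p(x)=\begin{cases}1,& p=1,\ x\in\mathbb{R},\\ \dfrac{1}{(p')^{1/p'}}\,\dfrac{1}{q_1(x)^{1/p'}},&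 p\in(1,\infty),\ p'=\frac{p}{p-1},\ |x|\gg1,\\ \dfrac{1}{q_1(x)},& p=\infty,\ |x|\gg1.\end{cases}$$
   Context: $L_\infty(\mathbb{R})$ denotes $C(\mathbb{R})$, bounded continuous functions with the sup norm. For $p\in[1,\infty]$, $D_p$ is the set of all solutions $y\in L_p(\mathbb{R})$ (absolutely continuous, satisfying the equation a.e.) of $-y'(x)+q(x)y(x)=f(x)$, $x\in\mathbb{R}$, with $f\in L_p(\mathbb{R})$, $\|f\|_p=1$. A continuous positive function $\varkappa_p$ is called an asymptotic majorant for $D_p$ if $\lim_{|x|\to\infty}\frac{\sup_{y\in D_p}|y(x)|}{\varkappa_p(x)}=1$. *)

theory Defs
  imports "HOL-Analysis.Analysis"
begin

definition abs_cont_on :: "real \<Rightarrow> real \<Rightarrow> (real \<Rightarrow> real) \<Rightarrow> bool" where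
  "abs_cont_on a b f \<longleftrightarrow>
     (\<forall>\<epsilon>>0. \<exists>\<delta>>0. \<forall>(n::nat) (u::nat \<Rightarrow> real) (v::nat \<Rightarrow> real).
        (\<forall>i<n. a \<le> u i \<and> u i \<le> v i \<and> v i \<le> b) \<and>
        (\<forall>i<n. \<forall>j<n. i \<noteq> j \<longrightarrow> v i \<le> u j \<or> v j \<le> u i) \<and>
        (\<Sum>i<n. v i - u i) < \<delta>
        \<longrightarrow> (\<Sum>i<n. \<bar>f (v i) - f (u i)\<bar>) < \<epsilon>)"

definition abs_cont :: "(real \<Rightarrow> real) \<Rightarrow> bool" where
  "abs_cont f \<longleftrightarrow> (\<forall>a b. abs_cont_on a b f)"

definition loc_integrable :: "(real \<Rightarrow> real) \<Rightarrow> bool" where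
  "loc_integrable f \<longleftrightarrow> (\<forall>a b. set_integrable lborel {a..b} f)"

text \<open>The space L_p(R), p in [1,infinity] (as an extended real); for p = infinity it is,
 by the paper's convention, C(R): bounded continuous functions with the sup norm.\<close>
definition in_Lp :: "ereal \<Rightarrow> (real \<Rightarrow> real) \<Rightarrow> bool" where
  "in_Lp p f \<longleftrightarrow>
     (if p = \<infinity> then continuous_on UNIV f \<and> bounded (range f)
      else f \<in> borel_measurable lborel \<and>
           integrable lborel (\<lambda>x. \<bar>f x\<bar> powr real_of_ereal p))"

definition Lp_norm :: "ereal \<Rightarrow> (real \<Rightarrow> real) \<Rightarrow> real" where
  "Lp_norm p f =
     (if p = \<infinity> then (SUP x. \<bar>f x\<bar>)
      else (LINT x|lborel. \<bar>f x\<bar> powr real_of_ereal p) powr (1 / real_of_ereal p))"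

definition D :: "ereal \<Rightarrow> (real \<Rightarrow> real) \<Rightarrow> (real \<Rightarrow> real) set" where
  "D p q = {y. in_Lp p y \<and> abs_cont y \<and>
              (\<exists>f. in_Lp p f \<and> Lp_norm p f = 1 \<and>
                   (AE x in lborel. (y has_real_derivative (q x * y x - f x)) (at x)))}"

definition asymptotic_majorant :: "ereal \<Rightarrow> (real \<Rightarrow> real) \<Rightarrow> (real \<Rightarrow> real) \<Rightarrow> bool" where
  "asymptotic_majorant p q \<kappa> \<longleftrightarrow>
     continuous_on UNIV \<kappa> \<and> (\<forall>x. \<kappa> x > 0) \<and>
     (\<forall>\<^sub>F x in at_infinity. bdd_above ((\<lambda>y. \<bar>y x\<bar>) ` D p q)) \<and>
     ((\<lambda>x. (SUP y\<in>D p q. \<bar>y x\<bar>) / \<kappa> x) \<longlongrightarrow> 1) at_infinity"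

definition Delta :: "(real \<Rightarrow> real) \<Rightarrow> (real \<Rightarrow> real) \<Rightarrow> real \<Rightarrow> real set" where
  "Delta s q1 x = {x - s x / q1 x .. x + s x / q1 x}"

definition kappa_x :: "(real \<Rightarrow> real) \<Rightarrow> (real \<Rightarrow> real) \<Rightarrow> real \<Rightarrow> real \<Rightarrow> real" where
  "kappa_x q1 q2 x t = q1 t * (LBINT \<xi>=ereal x..ereal t. q2 \<xi> / q1 \<xi>)"

definition kappa_tilde :: "(real \<Rightarrow> real) \<Rightarrow> (real \<Rightarrow> real) \<Rightarrow> (real \<Rightarrow> real) \<Rightarrow> real \<Rightarrow> real" where
  "kappa_tilde s q1 q2 x = (SUP t\<in>Delta s q1 x. \<bar>kappa_x q1 q2 x t\<bar>)"

definition kappa_p :: "ereal \<Rightarrow> (real \<Rightarrow> real) \<Rightarrow> real \<Rightarrow> real" where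
  "kappa_p p q1 x =
     (if p = 1 then 1
      else if p = \<infinity> then 1 / q1 x
      else (let p' = real_of_ereal p / (real_of_ereal p - 1) in
            1 / (p' powr (1 / p')) * (1 / (q1 x powr (1 / p')))))"

end

theory Submission
  imports Defs "HOL-Real_Asymp.Real_Asymp"
begin

text \<open>With \<open>Q\<close> a primitive of \<open>q\<close>, a solution in \<open>L_p\<close> satisfies
  \<open>y(x) = \<integral>\<^bsub>x\<^esub>\<^bsup>\<infinity>\<^esup> exp (- (Q t - Q x)) f(t) dt\<close>, because the growing homogeneous solution is
  excluded by the lower bound on the mean of \<open>q\<close>. For \<open>p > 1\<close> duality then gives
  \<open>sup |y(x)| = J r x powr (1 / r)\<close> with \<open>r = p'\<close> and
  \<open>J r x = \<integral>\<^bsub>x\<^esub>\<^bsup>\<infinity>\<^esup> exp (- r (Q t - Q x)) dt\<close>; the test functions may have compact support,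
  so no boundedness of the solution operator on \<open>L_p\<close> is needed.
  On windows \<open>t = x + \<tau> / q1(x)\<close>, \<open>0 \<le> \<tau> \<le> K\<close>, the hypotheses force \<open>q1(t) / q1(x) \<longrightarrow> 1\<close> and
  \<open>Q t - Q x - \<tau> \<longrightarrow> 0\<close>, whence \<open>J r x * q1(x) \<longrightarrow> 1 / r\<close> once \<open>J r \<le> A / q1\<close> is known.

  Since \<open>q1\<close> is controlled only where it has a derivative, the argument rests on Lebesgue's theorem that an
  absolutely continuous function is differentiable almost everywhere.\<close>

subsection \<open>Absolutely continuous functions\<close>

text \<open>The mean condition on \<open>q\<close> alone makes \<open>Q\<close> grow at a linear
  rate and so yields only a constant bound for \<open>J r\<close>, which may be far above
  \<open>1 / q1\<close>. The comparison has to be made on the scale \<open>w = 1 / q1\<close>: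
  hypotheses (a) and (b) make \<open>w\<close> nearly constant on a window of length
  \<open>K * w x\<close>, (d) replaces \<open>s t\<close> by \<open>s x\<close> there, (c) keeps the
  window far from the origin, and (e) makes the contribution of \<open>q2\<close> to the increment
  of \<open>Q\<close> small although \<open>q2\<close> itself may be large. Such a window damps the
  kernel by about \<open>exp (- r * K)\<close> while \<open>w\<close> changes by a factor near 1,
  and this turns the constant bound into \<open>A * w\<close>. The order of limits matters:
  \<open>K\<close> is fixed while \<open>x\<close> tends to infinity, and only its choice depends on
  the final accuracy. Absolute continuity is given by its interval definition, with no derivative
  attached. Hence the sets of bad slopes are shown to be null by Vitali coverings, and almost
  everywhere derivatives are integrated by a gauge argument in which absolute continuity pays for
  the exceptional null set.\<close>

lemma abs_cont_onE:
  assumes "abs_cont_on a b f" and "\<epsilon> > 0"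
  obtains \<delta> where "\<delta> > 0" "\<And>(n::nat) u v.
        (\<forall>i<n. a \<le> u i \<and> u i \<le> v i \<and> v i \<le> b) \<and>
        (\<forall>i<n. \<forall>j<n. i \<noteq> j \<longrightarrow> v i \<le> u j \<or> v j \<le> u i) \<and>
        (\<Sum>i<n. v i - u i) < \<delta>
        \<Longrightarrow> (\<Sum>i<n. \<bar>f (v i) - f (u i)\<bar>) < \<epsilon>"
proof -
  note * = mp[OF spec[OF assms(1)[unfolded abs_cont_on_def]] assms(2)]
  obtain \<delta> where \<delta>: "\<delta> > 0" and d: "\<forall>(n::nat) u v.
        (\<forall>i<n. a \<le> u i \<and> u i \<le> v i \<and> v i \<le> b) \<and>
        (\<forall>i<n. \<forall>j<n. i \<noteq> j \<longrightarrow> v i \<le> u j \<or> v j \<le> u i) \<and>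
        (\<Sum>i<n. v i - u i) < \<delta>
        \<longrightarrow> (\<Sum>i<n. \<bar>f (v i) - f (u i)\<bar>) < \<epsilon>"
    using * by (elim exE conjE)
  show thesis
    by (rule that[OF \<delta>], rule mp[OF d[THEN spec, THEN spec, THEN spec]])
qed

text \<open>Coverings and tagged divisions produce finite families indexed by intervals, for which
  disjointness of the open interiors is the natural condition.\<close>

lemma abs_cont_on_family:
  assumes f: "abs_cont_on a b f" and "\<epsilon> > 0"
  obtains \<delta> where "\<delta> > 0"
    "\<forall>I (u::'i \<Rightarrow> real) v. finite I \<longrightarrow> (\<forall>i\<in>I. a \<le> u i \<and> u i \<le> v i \<and> v i \<le> b) \<longrightarrow>
       disjoint_family_on (\<lambda>i. {u i<..<v i}) I \<longrightarrow>
       (\<Sum>i\<in>I. v i - u i) < \<delta> \<longrightarrow> (\<Sum>i\<in>I. \<bar>f (v i) - f (u i)\<bar>) < \<epsilon>"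
proof -
  obtain \<delta> where \<delta>: "\<delta> > 0" and D: "\<And>(n::nat) u v.
        (\<forall>i<n. a \<le> u i \<and> u i \<le> v i \<and> v i \<le> b) \<and>
        (\<forall>i<n. \<forall>j<n. i \<noteq> j \<longrightarrow> v i \<le> u j \<or> v j \<le> u i) \<and>
        (\<Sum>i<n. v i - u i) < \<delta>
        \<Longrightarrow> (\<Sum>i<n. \<bar>f (v i) - f (u i)\<bar>) < \<epsilon>"
    by (rule abs_cont_onE[OF f \<open>\<epsilon> > 0\<close>]) blast
  show thesis
  proof (rule that[OF \<delta>], intro allI impI)
    fix I and u v :: "'i \<Rightarrow> real"
    assume fin: "finite I" and uv: "\<forall>i\<in>I. a \<le> u i \<and> u i \<le> v i \<and> v i \<le> b"
      and dis: "disjoint_family_on (\<lambda>i. {u i<..<v i}) I"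
      and len: "(\<Sum>i\<in>I. v i - u i) < \<delta>"
    \<comment> \<open>Degenerate intervals must go first: a point inside another interval has an
      empty interior, yet it violates the ordering of endpoints demanded by the definition. Such
      intervals contribute nothing to either sum.\<close>
    define J where "J = {i\<in>I. u i < v i}"
    have finJ: "finite J" using fin by (simp add: J_def)
    obtain h where h: "bij_betw h {..<card J} J"
      using ex_bij_betw_nat_finite[OF finJ] by (auto simp: atLeast0LessThan)
    have hJ: "h i \<in> J" if "i < card J" for i
      using h that by (auto simp: bij_betw_def)
    have ends: "v (h i) \<le> u (h j) \<or> v (h j) \<le> u (h i)"
      if "i < card J" "j < card J" "i \<noteq> j" for i j
    proof (rule ccontr)
      assume n: "\<not> ?thesis"
      have ne: "h i \<noteq> h j" using h that by (auto simp: bij_betw_def inj_on_def)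
      have lt: "u (h i) < v (h i)" "u (h j) < v (h j)" using hJ that by (auto simp: J_def)
      have "max (u (h i)) (u (h j)) < min (v (h i)) (v (h j))" using n lt by auto
      then obtain z where "max (u (h i)) (u (h j)) < z" "z < min (v (h i)) (v (h j))"
        using dense by blast
      then have "z \<in> {u (h i)<..<v (h i)} \<inter> {u (h j)<..<v (h j)}" by auto
      moreover have "h i \<in> I" "h j \<in> I" using hJ that by (auto simp: J_def)
      ultimately show False using disjoint_family_onD[OF dis _ _ ne] by blast
    qed
    have sumJ: "(\<Sum>i<card J. g (h i)) = (\<Sum>i\<in>I. g i)"
      if "\<And>i. i \<in> I \<Longrightarrow> u i = v i \<Longrightarrow> g i = 0" for g :: "'i \<Rightarrow> real"
    proof -
      have "(\<Sum>i<card J. g (h i)) = (\<Sum>i\<in>J. g i)"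
        by (rule sum.reindex_bij_betw[OF h])
      also have "\<dots> = (\<Sum>i\<in>I. g i)"
        using fin that uv by (intro sum.mono_neutral_left) (force simp: J_def)+
      finally show ?thesis .
    qed
    have "(\<Sum>i<card J. \<bar>f (v (h i)) - f (u (h i))\<bar>) < \<epsilon>"
    proof (rule D, intro conjI allI impI)
      show "(\<Sum>i<card J. v (h i) - u (h i)) < \<delta>"
        using len sumJ[of "\<lambda>i. v i - u i"] by simp
    qed (use uv hJ ends in \<open>auto simp: J_def\<close>)
    then show "(\<Sum>i\<in>I. \<bar>f (v i) - f (u i)\<bar>) < \<epsilon>"
      using sumJ[of "\<lambda>i. \<bar>f (v i) - f (u i)\<bar>"] by simp
  qed
qed

lemma sum_lengths_le_measure:
  fixes u v :: "'i \<Rightarrow> real"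
  assumes fin: "finite I" and uv: "\<And>i. i \<in> I \<Longrightarrow> u i \<le> v i"
    and dis: "disjoint_family_on (\<lambda>i. {u i<..<v i}) I"
    and sub: "\<And>i. i \<in> I \<Longrightarrow> {u i<..<v i} \<subseteq> U" and U: "U \<in> lmeasurable"
  shows "(\<Sum>i\<in>I. v i - u i) \<le> measure lebesgue U"
proof -
  have "(\<Sum>i\<in>I. v i - u i) = (\<Sum>i\<in>I. measure lebesgue {u i<..<v i})"
    by (intro sum.cong) (auto simp: uv)
  also have "\<dots> = measure lebesgue (\<Union>i\<in>I. {u i<..<v i})"
    using dis fin uv
    by (intro measure_finite_Union[symmetric]) (auto simp: disjoint_family_on_def emeasure_lborel_Ioo)
  also have "\<dots> \<le> measure lebesgue U"
    using sub by (intro measure_mono_fmeasurable) (auto simp: U fin intro!: sets.finite_UN)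
  finally show ?thesis .
qed

section \<open>Continuity and closure properties\<close>

lemma abs_cont_on_imp_uniformly:
  assumes f: "abs_cont_on a b f" and "\<epsilon> > 0"
  obtains \<delta> where "\<delta> > 0" "\<And>x y. x \<in> {a..b} \<Longrightarrow> y \<in> {a..b} \<Longrightarrow> \<bar>y - x\<bar> < \<delta> \<Longrightarrow> \<bar>f y - f x\<bar> < \<epsilon>"
proof -
  obtain \<delta> where \<delta>: "\<delta> > 0" and D: "\<forall>I (u::unit \<Rightarrow> real) v. finite I \<longrightarrow> (\<forall>i\<in>I. a \<le> u i \<and> u i \<le> v i \<and> v i \<le> b) \<longrightarrow>
       disjoint_family_on (\<lambda>i. {u i<..<v i}) I \<longrightarrow>
       (\<Sum>i\<in>I. v i - u i) < \<delta> \<longrightarrow> (\<Sum>i\<in>I. \<bar>f (v i) - f (u i)\<bar>) < \<epsilon>"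
    by (rule abs_cont_on_family[OF assms, where 'i=unit])
  show thesis
  proof (rule that[OF \<delta>])
    fix x y assume "x \<in> {a..b}" "y \<in> {a..b}" "\<bar>y - x\<bar> < \<delta>"
    then have "(\<Sum>i\<in>(UNIV::unit set). \<bar>f (max x y) - f (min x y)\<bar>) < \<epsilon>"
      by (intro D[rule_format]) (auto simp: disjoint_family_on_def)
    then show "\<bar>f y - f x\<bar> < \<epsilon>"
      by (auto simp: min_def max_def abs_minus_commute split: if_splits)
  qed
qed

lemma abs_cont_on_imp_continuous_on: "abs_cont_on a b f \<Longrightarrow> continuous_on {a..b} f"
  unfolding continuous_on_iff dist_real_def by (metis abs_cont_on_imp_uniformly)

lemma abs_cont_imp_continuous: "abs_cont f \<Longrightarrow> continuous_on UNIV f"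
proof (rule continuous_at_imp_continuous_on, clarsimp)
  fix x assume "abs_cont f"
  then have "continuous_on {x-1..x+1} f"
    by (simp add: abs_cont_def abs_cont_on_imp_continuous_on)
  then show "isCont f x"
    by (rule continuous_on_interior) auto
qed

text \<open>Only increments on \<open>{a..b}\<close> are compared, so a constant depending on the
  interval suffices: negation, reciprocals and \<open>exp (\<sigma> * Q x)\<close> are all handled
  through it.\<close>

lemma abs_cont_on_lipschitz_comp:
  assumes f: "abs_cont_on a b f"
    and L: "\<And>x y. x \<in> {a..b} \<Longrightarrow> y \<in> {a..b} \<Longrightarrow> \<bar>g y - g x\<bar> \<le> L * \<bar>f y - f x\<bar>"
  shows "abs_cont_on a b g"
  unfolding abs_cont_on_def
proof (intro allI impI)
  fix \<epsilon> :: real assume "\<epsilon> > 0"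
  \<comment> \<open>\<open>L\<close> may be zero or negative, whereas \<open>\<epsilon>\<close> is
    to be divided by the constant.\<close>
  define L' where "L' = max L 1"
  have L': "L' > 0" "\<And>x y. x \<in> {a..b} \<Longrightarrow> y \<in> {a..b} \<Longrightarrow> \<bar>g y - g x\<bar> \<le> L' * \<bar>f y - f x\<bar>"
    by (simp add: L'_def, rule order_trans[OF L]) (auto intro: mult_right_mono simp: L'_def)
  obtain \<delta> where "\<delta> > 0" and D: "\<And>(n::nat) u v.
        (\<forall>i<n. a \<le> u i \<and> u i \<le> v i \<and> v i \<le> b) \<and>
        (\<forall>i<n. \<forall>j<n. i \<noteq> j \<longrightarrow> v i \<le> u j \<or> v j \<le> u i) \<and>
        (\<Sum>i<n. v i - u i) < \<delta>
        \<Longrightarrow> (\<Sum>i<n. \<bar>f (v i) - f (u i)\<bar>) < \<epsilon> / L'"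
    by (rule abs_cont_onE[OF f divide_pos_pos[OF \<open>\<epsilon> > 0\<close> L'(1)]]) blast
  show "\<exists>\<delta>>0. \<forall>(n::nat) (u::nat \<Rightarrow> real) (v::nat \<Rightarrow> real).
        (\<forall>i<n. a \<le> u i \<and> u i \<le> v i \<and> v i \<le> b) \<and>
        (\<forall>i<n. \<forall>j<n. i \<noteq> j \<longrightarrow> v i \<le> u j \<or> v j \<le> u i) \<and>
        (\<Sum>i<n. v i - u i) < \<delta>
        \<longrightarrow> (\<Sum>i<n. \<bar>g (v i) - g (u i)\<bar>) < \<epsilon>"
  proof (intro exI conjI allI impI)
    fix n :: nat and u v :: "nat \<Rightarrow> real"
    assume *: "(\<forall>i<n. a \<le> u i \<and> u i \<le> v i \<and> v i \<le> b) \<and>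
        (\<forall>i<n. \<forall>j<n. i \<noteq> j \<longrightarrow> v i \<le> u j \<or> v j \<le> u i) \<and>
        (\<Sum>i<n. v i - u i) < \<delta>"
    have "(\<Sum>i<n. \<bar>g (v i) - g (u i)\<bar>) \<le> (\<Sum>i<n. L' * \<bar>f (v i) - f (u i)\<bar>)"
      using * by (intro sum_mono L'(2)) force+
    also have "\<dots> = L' * (\<Sum>i<n. \<bar>f (v i) - f (u i)\<bar>)"
      by (simp add: sum_distrib_left)
    also have "\<dots> < L' * (\<epsilon> / L')"
      using D[OF *] L'(1) by (intro mult_strict_left_mono) auto
    finally show "(\<Sum>i<n. \<bar>g (v i) - g (u i)\<bar>) < \<epsilon>" using L'(1) by simp
  qed fact
qed

lemma abs_cont_on_mult:
  assumes f: "abs_cont_on a b f" and g: "abs_cont_on a b g"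
  shows "abs_cont_on a b (\<lambda>x. f x * g x)"
  unfolding abs_cont_on_def
proof (intro allI impI)
  fix \<epsilon> :: real assume "\<epsilon> > 0"
  have "bounded (f ` {a..b})"
    by (intro compact_imp_bounded compact_continuous_image abs_cont_on_imp_continuous_on f compact_Icc)
  then obtain A where A: "\<And>x. x \<in> {a..b} \<Longrightarrow> \<bar>f x\<bar> \<le> A"
    unfolding bounded_iff by (metis imageI real_norm_def)
  have "bounded (g ` {a..b})"
    by (intro compact_imp_bounded compact_continuous_image abs_cont_on_imp_continuous_on g compact_Icc)
  then obtain B where B: "\<And>x. x \<in> {a..b} \<Longrightarrow> \<bar>g x\<bar> \<le> B"
    unfolding bounded_iff by (metis imageI real_norm_def)
  define M where "M = max 1 (max A B)"
  have M: "M > 0" "\<And>x. x \<in> {a..b} \<Longrightarrow> \<bar>f x\<bar> \<le> M" "\<And>x. x \<in> {a..b} \<Longrightarrow> \<bar>g x\<bar> \<le> M"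
    using A B by (auto simp: M_def le_max_iff_disj)
  then have e: "\<epsilon> / (2 * M) > 0" using \<open>\<epsilon> > 0\<close> by auto
  obtain \<delta>1 where "\<delta>1 > 0" and D1: "\<And>(n::nat) u v.
        (\<forall>i<n. a \<le> u i \<and> u i \<le> v i \<and> v i \<le> b) \<and>
        (\<forall>i<n. \<forall>j<n. i \<noteq> j \<longrightarrow> v i \<le> u j \<or> v j \<le> u i) \<and>
        (\<Sum>i<n. v i - u i) < \<delta>1
        \<Longrightarrow> (\<Sum>i<n. \<bar>f (v i) - f (u i)\<bar>) < \<epsilon> / (2 * M)"
    by (rule abs_cont_onE[OF f e]) blast
  obtain \<delta>2 where "\<delta>2 > 0" and D2: "\<And>(n::nat) u v.
        (\<forall>i<n. a \<le> u i \<and> u i \<le> v i \<and> v i \<le> b) \<and>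
        (\<forall>i<n. \<forall>j<n. i \<noteq> j \<longrightarrow> v i \<le> u j \<or> v j \<le> u i) \<and>
        (\<Sum>i<n. v i - u i) < \<delta>2
        \<Longrightarrow> (\<Sum>i<n. \<bar>g (v i) - g (u i)\<bar>) < \<epsilon> / (2 * M)"
    by (rule abs_cont_onE[OF g e]) blast
  show "\<exists>\<delta>>0. \<forall>(n::nat) (u::nat \<Rightarrow> real) (v::nat \<Rightarrow> real).
        (\<forall>i<n. a \<le> u i \<and> u i \<le> v i \<and> v i \<le> b) \<and>
        (\<forall>i<n. \<forall>j<n. i \<noteq> j \<longrightarrow> v i \<le> u j \<or> v j \<le> u i) \<and>
        (\<Sum>i<n. v i - u i) < \<delta>
        \<longrightarrow> (\<Sum>i<n. \<bar>f (v i) * g (v i) - f (u i) * g (u i)\<bar>) < \<epsilon>"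
  proof (intro exI[of _ "min \<delta>1 \<delta>2"] conjI allI impI)
    fix n :: nat and u v :: "nat \<Rightarrow> real"
    assume *: "(\<forall>i<n. a \<le> u i \<and> u i \<le> v i \<and> v i \<le> b) \<and>
        (\<forall>i<n. \<forall>j<n. i \<noteq> j \<longrightarrow> v i \<le> u j \<or> v j \<le> u i) \<and>
        (\<Sum>i<n. v i - u i) < min \<delta>1 \<delta>2"
    have "\<bar>f (v i) * g (v i) - f (u i) * g (u i)\<bar> \<le> M * \<bar>f (v i) - f (u i)\<bar> + M * \<bar>g (v i) - g (u i)\<bar>"
      if "i < n" for i
    proof -
      have "u i \<in> {a..b}" "v i \<in> {a..b}" using * that by force+
      have "\<bar>f (v i) * g (v i) - f (u i) * g (u i)\<bar> = \<bar>g (v i) * (f (v i) - f (u i)) + f (u i) * (g (v i) - g (u i))\<bar>"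
        by (simp add: algebra_simps)
      also have "\<dots> \<le> \<bar>g (v i)\<bar> * \<bar>f (v i) - f (u i)\<bar> + \<bar>f (u i)\<bar> * \<bar>g (v i) - g (u i)\<bar>"
        by (metis abs_mult abs_triangle_ineq)
      also have "\<dots> \<le> M * \<bar>f (v i) - f (u i)\<bar> + M * \<bar>g (v i) - g (u i)\<bar>"
        using M \<open>u i \<in> {a..b}\<close> \<open>v i \<in> {a..b}\<close> by (intro add_mono mult_right_mono) auto
      finally show ?thesis .
    qed
    then have "(\<Sum>i<n. \<bar>f (v i) * g (v i) - f (u i) * g (u i)\<bar>)
        \<le> (\<Sum>i<n. M * \<bar>f (v i) - f (u i)\<bar> + M * \<bar>g (v i) - g (u i)\<bar>)"
      by (intro sum_mono) auto
    also have "\<dots> = M * (\<Sum>i<n. \<bar>f (v i) - f (u i)\<bar>) + M * (\<Sum>i<n. \<bar>g (v i) - g (u i)\<bar>)"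
      by (simp add: sum_distrib_left sum.distrib)
    also have "\<dots> < M * (\<epsilon> / (2 * M)) + M * (\<epsilon> / (2 * M))"
      using D1[of n u v] D2[of n u v] * M(1) by (intro add_strict_mono mult_strict_left_mono) auto
    finally show "(\<Sum>i<n. \<bar>f (v i) * g (v i) - f (u i) * g (u i)\<bar>) < \<epsilon>" using M(1) by (simp add: field_simps)
  qed (use \<open>\<delta>1 > 0\<close> \<open>\<delta>2 > 0\<close> in simp)
qed

lemma abs_cont_mult: "abs_cont f \<Longrightarrow> abs_cont g \<Longrightarrow> abs_cont (\<lambda>x. f x * g x)"
  by (simp add: abs_cont_def abs_cont_on_mult)

lemma abs_cont_diff:
  assumes f: "abs_cont f" and g: "abs_cont g"
  shows "abs_cont (\<lambda>x. f x - g x)"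
  unfolding abs_cont_def abs_cont_on_def
proof (intro allI impI)
  fix a b \<epsilon> :: real assume \<epsilon>: "\<epsilon> > 0"
  then have e: "\<epsilon> / 2 > 0" by simp
  have fa: "abs_cont_on a b f" and ga: "abs_cont_on a b g" using f g by (simp_all add: abs_cont_def)
  obtain \<delta>1 where "\<delta>1 > 0" and D1: "\<And>(n::nat) u v.
        (\<forall>i<n. a \<le> u i \<and> u i \<le> v i \<and> v i \<le> b) \<and>
        (\<forall>i<n. \<forall>j<n. i \<noteq> j \<longrightarrow> v i \<le> u j \<or> v j \<le> u i) \<and>
        (\<Sum>i<n. v i - u i) < \<delta>1
        \<Longrightarrow> (\<Sum>i<n. \<bar>f (v i) - f (u i)\<bar>) < \<epsilon> / 2"
    by (rule abs_cont_onE[OF fa e]) blast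
  obtain \<delta>2 where "\<delta>2 > 0" and D2: "\<And>(n::nat) u v.
        (\<forall>i<n. a \<le> u i \<and> u i \<le> v i \<and> v i \<le> b) \<and>
        (\<forall>i<n. \<forall>j<n. i \<noteq> j \<longrightarrow> v i \<le> u j \<or> v j \<le> u i) \<and>
        (\<Sum>i<n. v i - u i) < \<delta>2
        \<Longrightarrow> (\<Sum>i<n. \<bar>g (v i) - g (u i)\<bar>) < \<epsilon> / 2"
    by (rule abs_cont_onE[OF ga e]) blast
  show "\<exists>\<delta>>0. \<forall>(n::nat) (u::nat \<Rightarrow> real) (v::nat \<Rightarrow> real).
        (\<forall>i<n. a \<le> u i \<and> u i \<le> v i \<and> v i \<le> b) \<and>
        (\<forall>i<n. \<forall>j<n. i \<noteq> j \<longrightarrow> v i \<le> u j \<or> v j \<le> u i) \<and>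
        (\<Sum>i<n. v i - u i) < \<delta>
        \<longrightarrow> (\<Sum>i<n. \<bar>(f (v i) - g (v i)) - (f (u i) - g (u i))\<bar>) < \<epsilon>"
  proof (intro exI[of _ "min \<delta>1 \<delta>2"] conjI allI impI)
    fix n :: nat and u v :: "nat \<Rightarrow> real"
    assume *: "(\<forall>i<n. a \<le> u i \<and> u i \<le> v i \<and> v i \<le> b) \<and>
        (\<forall>i<n. \<forall>j<n. i \<noteq> j \<longrightarrow> v i \<le> u j \<or> v j \<le> u i) \<and>
        (\<Sum>i<n. v i - u i) < min \<delta>1 \<delta>2"
    have "(\<Sum>i<n. \<bar>(f (v i) - g (v i)) - (f (u i) - g (u i))\<bar>)
        \<le> (\<Sum>i<n. \<bar>f (v i) - f (u i)\<bar> + \<bar>g (v i) - g (u i)\<bar>)"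
      by (intro sum_mono) linarith
    also have "\<dots> < \<epsilon> / 2 + \<epsilon> / 2"
      unfolding sum.distrib using D1[of n u v] D2[of n u v] * by (intro add_strict_mono) auto
    finally show "(\<Sum>i<n. \<bar>(f (v i) - g (v i)) - (f (u i) - g (u i))\<bar>) < \<epsilon>" by simp
  qed (use \<open>\<delta>1 > 0\<close> \<open>\<delta>2 > 0\<close> in simp)
qed

lemma abs_cont_uminus:
  assumes "abs_cont f"
  shows "abs_cont (\<lambda>x. - f x)"
  unfolding abs_cont_def
proof (intro allI)
  fix a b
  show "abs_cont_on a b (\<lambda>x. - f x)"
    by (rule abs_cont_on_lipschitz_comp[where f=f and L=1])
      (use assms in \<open>simp_all add: abs_cont_def abs_minus_commute\<close>)
qed

lemma abs_cont_inverse: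
  assumes f: "abs_cont f" and pos: "\<And>x. 0 < f x"
  shows "abs_cont (\<lambda>x. 1 / f x)"
  unfolding abs_cont_def
proof (intro allI)
  fix a b
  have fa: "abs_cont_on a b f" using f by (simp add: abs_cont_def)
  have "continuous_on {a..b} (\<lambda>x. 1 / f x)"
    using continuous_on_subset[OF abs_cont_imp_continuous[OF f]] pos
    by (intro continuous_intros) (auto simp: less_imp_neq[symmetric])
  then have "bounded ((\<lambda>x. 1 / f x) ` {a..b})"
    by (intro compact_imp_bounded compact_continuous_image) auto
  then obtain M where M: "\<And>x. x \<in> {a..b} \<Longrightarrow> \<bar>1 / f x\<bar> \<le> M"
    unfolding bounded_iff by (metis (mono_tags, lifting) imageI real_norm_def)
  show "abs_cont_on a b (\<lambda>x. 1 / f x)"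
  proof (rule abs_cont_on_lipschitz_comp[OF fa])
    fix x y assume xy: "x \<in> {a..b}" "y \<in> {a..b}"
    have "1 / f y - 1 / f x = (1 / f y) * (1 / f x) * (f x - f y)"
      using pos[of x] pos[of y] by (simp add: field_simps)
    then have "\<bar>1 / f y - 1 / f x\<bar> = (\<bar>1 / f y\<bar> * \<bar>1 / f x\<bar>) * \<bar>f y - f x\<bar>"
      by (simp add: abs_mult abs_minus_commute)
    also have "\<dots> \<le> (M * M) * \<bar>f y - f x\<bar>"
      by (intro mult_right_mono mult_mono M xy) (use M[OF xy(1)] in linarith)+
    finally show "\<bar>1 / f y - 1 / f x\<bar> \<le> M * M * \<bar>f y - f x\<bar>" .
  qed
qed

text \<open>The gauge integral asks for no prior integrability of \<open>g\<close>. Tags outside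
  \<open>N\<close> are handled by the straddle estimate that differentiability provides; pieces
  tagged in \<open>N\<close> lie in an open set of small measure, where absolute continuity makes
  the total increment of \<open>F\<close> small.\<close>

lemma abs_cont_on_FTC:
  assumes F: "abs_cont_on a b F" and ab: "a \<le> b" and N: "negligible N"
    and deriv: "\<And>x. x \<in> {a..b} - N \<Longrightarrow> (F has_real_derivative g x) (at x)"
  shows "(g has_integral (F b - F a)) {a..b}"
proof -
  \<comment> \<open>With the value 0 on \<open>N\<close>, the pieces tagged there contribute only
    increments of \<open>F\<close>, whatever \<open>g\<close> is; since \<open>N\<close> is null,
    \<open>g\<close> is restored at the end.\<close>
  define g0 where "g0 x = (if x \<in> N then 0 else g x)" for x
  have "(g0 has_integral (F b - F a)) {a..b}"
    unfolding has_integral_real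
  proof (intro allI impI)
    fix \<epsilon> :: real assume "\<epsilon> > 0"
    define e where "e = \<epsilon> / (2 * (b - a + 1))"
    have e: "e > 0" using \<open>\<epsilon> > 0\<close> ab by (simp add: e_def)
    have ee: "e * (b - a) < \<epsilon> / 2" using \<open>\<epsilon> > 0\<close> ab by (simp add: e_def field_simps)
    have "\<epsilon> / 2 > 0" using \<open>\<epsilon> > 0\<close> by simp
    then obtain \<delta> where \<delta>: "\<delta> > 0" and D: "\<forall>I (u::real \<times> real set \<Rightarrow> real) v. finite I \<longrightarrow>
       (\<forall>i\<in>I. a \<le> u i \<and> u i \<le> v i \<and> v i \<le> b) \<longrightarrow>
       disjoint_family_on (\<lambda>i. {u i<..<v i}) I \<longrightarrow>
       (\<Sum>i\<in>I. v i - u i) < \<delta> \<longrightarrow> (\<Sum>i\<in>I. \<bar>F (v i) - F (u i)\<bar>) < \<epsilon> / 2"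
      by (rule abs_cont_on_family[OF F, where 'i="real \<times> real set"])
    obtain U where U: "open U" "N \<subseteq> U" "U - N \<in> lmeasurable" "emeasure lebesgue (U - N) < ennreal \<delta>"
      using sets_lebesgue_outer_open[of N \<delta>] N \<delta> negligible_imp_sets by blast
    have UN: "(U - N) \<union> N = U" using U(2) by auto
    have Nm: "N \<in> lmeasurable" using N by (simp add: negligible_imp_measurable)
    have Um: "U \<in> lmeasurable" using fmeasurable.Un[OF U(3) Nm] UN by simp
    have "measure lebesgue U \<le> measure lebesgue (U - N) + measure lebesgue N"
      using measure_Un_le[of "U - N" lebesgue N] U(3) Nm UN by (simp add: fmeasurableD)
    also have "measure lebesgue N = 0" using N by (simp add: negligible_imp_measure0)
    also have "measure lebesgue (U - N) < \<delta>"
      using U(3,4) \<delta> by (simp add: emeasure_eq_measure2 ennreal_less_iff)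
    finally have mU: "measure lebesgue U < \<delta>" by simp
    have "\<exists>d>0. ball x d \<subseteq> U" if "x \<in> N" for x
      using U(1,2) that open_contains_ball by blast
    then obtain d1 where d1: "\<And>x. x \<in> N \<Longrightarrow> d1 x > 0 \<and> ball x (d1 x) \<subseteq> U" by metis
    have "\<exists>d>0. \<forall>y. \<bar>y - x\<bar> < d \<longrightarrow> \<bar>F y - F x - (y - x) * g x\<bar> \<le> e * \<bar>y - x\<bar>"
      if "x \<in> {a..b} - N" for x
      using deriv[OF that] e
      unfolding has_field_derivative_def has_derivative_within_alt
      by (simp add: mult.commute) 
    then obtain d2 where d2: "\<And>x. x \<in> {a..b} - N \<Longrightarrow> d2 x > 0 \<and> (\<forall>y. \<bar>y - x\<bar> < d2 x \<longrightarrow> \<bar>F y - F x - (y - x) * g x\<bar> \<le> e * \<bar>y - x\<bar>)"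
      by metis
    define d where "d x = (if x \<in> N then d1 x else if x \<in> {a..b} then d2 x else 1)" for x
    have dpos: "d x > 0" for x using d1 d2 by (auto simp: d_def)
    show "\<exists>\<gamma>. gauge \<gamma> \<and> (\<forall>\<D>. \<D> tagged_division_of {a..b} \<and> \<gamma> fine \<D> \<longrightarrow>
        norm ((\<Sum>(x, k)\<in>\<D>. measure lborel k *\<^sub>R g0 x) - (F b - F a)) < \<epsilon>)"
    proof (intro exI conjI allI impI)
      show "gauge (\<lambda>x. ball x (d x))" by (rule gauge_ball_dependent) (use dpos in auto)
      fix p assume "p tagged_division_of {a..b} \<and> (\<lambda>x. ball x (d x)) fine p"
      then have p: "p tagged_division_of {a..b}" and fine: "(\<lambda>x. ball x (d x)) fine p" by auto
      note pD = tagged_division_ofD[OF p]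
      have K: "\<exists>u v. K = {u..v} \<and> a \<le> u \<and> u \<le> x \<and> x \<le> v \<and> v \<le> b \<and> Inf K = u \<and> Sup K = v \<and> measure lborel K = v - u \<and> interior K = {u<..<v}"
        if inp: "(x, K) \<in> p" for x K
      proof -
        obtain u v where k: "K = {u..v}" using pD(4)[OF inp] by auto
        moreover have "x \<in> K" "K \<subseteq> {a..b}" using pD inp by auto
        ultimately show ?thesis by (intro exI[of _ u] exI[of _ v]) auto
      qed
      define pN where "pN = {i \<in> p. fst i \<in> N}"
      have finp: "finite p" by (rule pD)
      then have finN: "finite pN" by (simp add: pN_def)
      have ba: "b - a = (\<Sum>i\<in>p. Sup (snd i) - Inf (snd i))" "F b - F a = (\<Sum>i\<in>p. F (Sup (snd i)) - F (Inf (snd i)))"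
        using additive_tagged_division_1[OF ab p, of "\<lambda>x. x"] additive_tagged_division_1[OF ab p, of F]
        by (auto simp: case_prod_unfold)
      have dis': "{Inf (snd i)<..<Sup (snd i)} \<inter> {Inf (snd j)<..<Sup (snd j)} = {}"
        if "i \<in> pN" "j \<in> pN" "i \<noteq> j" for i j
      proof -
        obtain x K y K' where ij: "i = (x, K)" "j = (y, K')" by (metis prod.exhaust)
        have "interior K \<inter> interior K' = {}" using pD(5)[of x K y K'] that ij by (auto simp: pN_def)
        then show ?thesis using K[of x K] K[of y K'] that ij by (auto simp: pN_def)
      qed
      have dis: "disjoint_family_on (\<lambda>i. {Inf (snd i)<..<Sup (snd i)}) pN"
        unfolding disjoint_family_on_def using dis' by blast
      have small: "(\<Sum>i\<in>pN. \<bar>F (Sup (snd i)) - F (Inf (snd i))\<bar>) < \<epsilon> / 2"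
      proof (rule D[rule_format, OF finN _ dis])
        show "a \<le> Inf (snd i) \<and> Inf (snd i) \<le> Sup (snd i) \<and> Sup (snd i) \<le> b" if "i \<in> pN" for i
          using K[of "fst i" "snd i"] that by (auto simp: pN_def)
        have "(\<Sum>i\<in>pN. Sup (snd i) - Inf (snd i)) \<le> measure lebesgue U"
        proof (rule sum_lengths_le_measure[OF finN _ dis _ Um])
          fix i assume i: "i \<in> pN"
          then have "snd i \<subseteq> ball (fst i) (d (fst i))" using fine by (auto simp: pN_def fine_def case_prod_unfold)
          also have "\<dots> \<subseteq> U" using d1 i by (auto simp: pN_def d_def)
          finally show "{Inf (snd i)<..<Sup (snd i)} \<subseteq> U"
            using K[of "fst i" "snd i"] i by (auto simp: pN_def)
          show "Inf (snd i) \<le> Sup (snd i)" using K[of "fst i" "snd i"] i by (auto simp: pN_def)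
        qed
        then show "(\<Sum>i\<in>pN. Sup (snd i) - Inf (snd i)) < \<delta>" using mU by simp
      qed
      have term_le: "\<bar>measure lborel (snd i) * g0 (fst i) - (F (Sup (snd i)) - F (Inf (snd i)))\<bar>
          \<le> e * (Sup (snd i) - Inf (snd i)) + (if fst i \<in> N then \<bar>F (Sup (snd i)) - F (Inf (snd i))\<bar> else 0)"
        if i: "i \<in> p" for i
      proof -
        obtain x L where ix: "i = (x, L)" by force
        obtain u v where L: "L = {u..v}" "a \<le> u" "u \<le> x" "x \<le> v" "v \<le> b" "Inf L = u" "Sup L = v" "measure lborel L = v - u"
          using K[of x L] i ix by auto
        show ?thesis
        proof (cases "x \<in> N")
          case True
          moreover have "0 \<le> e * (v - u)" using L e by simp
          ultimately show ?thesis using L by (simp add: ix g0_def abs_minus_commute)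
        next
          case False
          have "L \<subseteq> ball x (d x)" using fine i ix unfolding fine_def by auto
          moreover have "u \<in> L" "v \<in> L" using L by auto
          ultimately have "u \<in> ball x (d x)" "v \<in> ball x (d x)" by auto
          moreover have "d x = d2 x" "x \<in> {a..b} - N" using False L by (auto simp: d_def)
          ultimately have "\<bar>F u - F x - (u - x) * g x\<bar> \<le> e * \<bar>u - x\<bar>" "\<bar>F v - F x - (v - x) * g x\<bar> \<le> e * \<bar>v - x\<bar>"
            using d2[of x] by (auto simp: dist_real_def abs_minus_commute)
          \<comment> \<open>The tag lies in its piece, so \<open>u \<le> x \<le> v\<close> and the
            two one-sided errors add up to \<open>e * (v - u)\<close>.\<close>
          then have "\<bar>(v - u) * g x - (F v - F u)\<bar> \<le> e * \<bar>u - x\<bar> + e * \<bar>v - x\<bar>"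
            by (simp add: algebra_simps abs_le_iff)
          also have "\<dots> = e * (v - u)" using L by (simp add: algebra_simps)
          finally show ?thesis using False L by (simp add: ix g0_def)
        qed
      qed
      have "norm ((\<Sum>(x, k)\<in>p. measure lborel k *\<^sub>R g0 x) - (F b - F a))
          = \<bar>\<Sum>i\<in>p. measure lborel (snd i) * g0 (fst i) - (F (Sup (snd i)) - F (Inf (snd i)))\<bar>"
        by (simp add: ba sum_subtractf case_prod_unfold)
      also have "\<dots> \<le> (\<Sum>i\<in>p. e * (Sup (snd i) - Inf (snd i)) + (if fst i \<in> N then \<bar>F (Sup (snd i)) - F (Inf (snd i))\<bar> else 0))"
        by (intro order_trans[OF sum_abs] sum_mono term_le)
      also have "\<dots> = e * (b - a) + (\<Sum>i\<in>pN. \<bar>F (Sup (snd i)) - F (Inf (snd i))\<bar>)"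
        by (simp add: ba sum.distrib sum_distrib_left pN_def sum.inter_filter[OF finp])
      also have "\<dots> < \<epsilon>" using ee small by simp
      finally show "norm ((\<Sum>(x, k)\<in>p. measure lborel k *\<^sub>R g0 x) - (F b - F a)) < \<epsilon>" .
    qed
  qed
  then show ?thesis
    by (rule has_integral_spike[OF N, rotated]) (auto simp: g0_def)
qed

text \<open>Absolute continuity lets the mean value inequality tolerate an exceptional null set. It
  is applied to \<open>w\<close> and to the remainder of an integration by parts, whose derivatives
  are known only almost everywhere.\<close>

lemma abs_cont_lipschitz:
  assumes f: "abs_cont f" and ab: "a \<le> b" and N: "negligible N" and M: "0 \<le> M"
    and deriv: "\<And>x. x \<in> {a..b} - N \<Longrightarrow> \<exists>d. (f has_real_derivative d) (at x) \<and> \<bar>d\<bar> \<le> M"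
  shows "\<bar>f b - f a\<bar> \<le> M * (b - a)"
proof -
  obtain d where d: "\<And>x. x \<in> {a..b} - N \<Longrightarrow> (f has_real_derivative d x) (at x) \<and> \<bar>d x\<bar> \<le> M"
    using deriv by metis
  define g where "g x = (if x \<in> {a..b} - N then d x else 0)" for x
  have "(g has_integral (f b - f a)) {a..b}"
    using f by (intro abs_cont_on_FTC[OF _ ab N]) (auto simp: abs_cont_def g_def d)
  then have "norm (f b - f a) \<le> M * measure lborel (cbox a b)"
    using d M by (intro has_integral_bound[of M g]) (auto simp: g_def)
  then show ?thesis using ab by simp
qed

subsection \<open>Differentiability almost everywhere\<close>

text \<open>Strict straddling makes this a countable intersection of open sets, hence Borel, and
  makes the admissible intervals a Vitali cover. Slopes over straddling intervals take the place of
  the four Dini derivatives.\<close>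

definition slope_cover :: "(real \<Rightarrow> real \<Rightarrow> bool) \<Rightarrow> real set" where
  "slope_cover P = {x. \<forall>e>0. \<exists>u v. u < x \<and> x < v \<and> v - u < e \<and> P u v}"

lemma slope_cover_borel: "slope_cover P \<in> sets borel"
proof -
  have "slope_cover P = (\<Inter>n. \<Union>i\<in>{i. snd i - fst i < 1 / real (Suc n) \<and> P (fst i) (snd i)}. {fst i<..<snd i})"
  proof (intro equalityI subsetI)
    fix x assume "x \<in> (\<Inter>n. \<Union>i\<in>{i. snd i - fst i < 1 / real (Suc n) \<and> P (fst i) (snd i)}. {fst i<..<snd i})"
    then have *: "\<exists>u v. v - u < 1 / real (Suc n) \<and> P u v \<and> u < x \<and> x < v" for n by force
    show "x \<in> slope_cover P"
      unfolding slope_cover_def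
    proof safe
      fix e :: real assume "e > 0"
      then obtain n where "1 / real (Suc n) < e"
        using nat_approx_posE by blast
      then show "\<exists>u v. u < x \<and> x < v \<and> v - u < e \<and> P u v" using *[of n] by force
    qed
  next
    fix x assume x: "x \<in> slope_cover P"
    have "\<exists>u v. u < x \<and> x < v \<and> v - u < 1 / real (Suc n) \<and> P u v" for n
      using x by (simp add: slope_cover_def)
    then show "x \<in> (\<Inter>n. \<Union>i\<in>{i. snd i - fst i < 1 / real (Suc n) \<and> P (fst i) (snd i)}. {fst i<..<snd i})"
      by simp (metis diff_gt_0_iff_gt)
  qed
  also have "\<dots> \<in> sets borel"
    by (intro sets.countable_INT') (auto intro!: borel_open open_UN)
  finally show ?thesis .
qed

text \<open>Open intervals are the balls of the line, so the covering theorem for balls gives a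
  countable disjoint subfamily that misses only a null part of \<open>S\<close>; a finite part of it
  has almost the full measure. The open set \<open>G\<close> confines the intervals and keeps the
  measures finite.\<close>

lemma slope_cover_Vitali:
  assumes S: "S \<subseteq> slope_cover P" "S \<subseteq> G" "S \<in> lmeasurable" and G: "open G" "G \<in> lmeasurable" and "\<eta> > 0"
  obtains C where "finite C" "\<forall>i\<in>C. fst i < snd i \<and> P (fst i) (snd i) \<and> {fst i<..<snd i} \<subseteq> G"
    "disjoint_family_on (\<lambda>i. {fst i<..<snd i}) C" "(\<Sum>i\<in>C. snd i - fst i) > measure lebesgue S - \<eta>"
proof -
  define K where "K = {i. fst i < snd i \<and> P (fst i) (snd i) \<and> {fst i<..<snd i} \<subseteq> G}"
  define a r where "a = (\<lambda>i::real\<times>real. (fst i + snd i) / 2)" and "r = (\<lambda>i::real\<times>real. (snd i - fst i) / 2)"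
  have ball: "ball (a i) (r i) = {fst i<..<snd i}" for i
  proof -
    have "a i - r i = fst i" "a i + r i = snd i" by (simp_all add: a_def r_def field_simps)
    then show ?thesis by (simp add: ball_eq_greaterThanLessThan)
  qed
  have cov: "\<exists>i. i \<in> K \<and> x \<in> ball (a i) (r i) \<and> r i < d" if x: "x \<in> S" and d: "0 < d" for x d
  proof -
    obtain e where e: "e > 0" "ball x e \<subseteq> G" using x S(2) G(1) by (meson openE subsetD)
    obtain u v where uv: "u < x" "x < v" "v - u < min d e" "P u v"
    proof -
      have "min d e > 0" using d e by simp
      moreover have "x \<in> slope_cover P" using x S(1) by blast
      ultimately show ?thesis using that unfolding slope_cover_def by blast
    qed
    have "{u<..<v} \<subseteq> ball x e" using uv by (auto simp: dist_real_def)
    then show ?thesis using e uv unfolding ball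
      by (intro exI[of _ "(u, v)"]) (auto simp: K_def r_def)
  qed
  obtain C where C: "countable C" "C \<subseteq> K"
     "pairwise (\<lambda>i j. disjnt (ball (a i) (r i)) (ball (a j) (r j))) C"
     "negligible(S - (\<Union>i \<in> C. ball (a i) (r i)))"
    using Vitali_covering_theorem_balls[OF cov] by blast
  define D where "D = (\<lambda>i. {fst i<..<snd i}) ` C"
  have "countable D" using C by (simp add: D_def)
  obtain D' where D': "D' \<subseteq> D" "finite D'" "measure lebesgue (\<Union>D) - \<eta> < measure lebesgue (\<Union>D')"
  proof (rule measure_countable_Union_approachable[OF \<open>countable D\<close> \<open>\<eta> > 0\<close>])
    show "d \<in> lmeasurable" if "d \<in> D" for d using that by (auto simp: D_def)
    show "measure lebesgue (\<Union>E) \<le> measure lebesgue G" if "E \<subseteq> D" "finite E" for E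
      using that C G by (intro measure_mono_fmeasurable) (auto simp: D_def K_def intro!: sets.finite_Union)
  qed blast
  obtain C' where C': "C' \<subseteq> C" "finite C'" "D' = (\<lambda>i. {fst i<..<snd i}) ` C'"
    using D' finite_subset_image[of D' "\<lambda>i. {fst i<..<snd i}" C] by (auto simp: D_def)
  have dis: "disjoint_family_on (\<lambda>i. {fst i<..<snd i}) C'"
    using C(3) C'(1) unfolding disjoint_family_on_def pairwise_def ball disjnt_def by blast
  have UD: "\<Union>D \<in> lmeasurable"
  proof (rule fmeasurableI2[OF G(2)])
    show "\<Union>D \<subseteq> G" using C by (auto simp: D_def K_def)
    show "\<Union>D \<in> sets lebesgue" using \<open>countable D\<close>
      by (intro sets.countable_Union) (auto simp: D_def)
  qed
  have neg: "negligible (S - \<Union>D)" using C(4) by (simp add: D_def ball)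
  have "measure lebesgue S \<le> measure lebesgue (\<Union>D \<union> (S - \<Union>D))"
    using S(3) UD by (intro measure_mono_fmeasurable fmeasurable.Un fmeasurable.Diff fmeasurableD) auto
  also have "\<dots> \<le> measure lebesgue (\<Union>D) + measure lebesgue (S - \<Union>D)"
    by (intro measure_Un_le fmeasurableD fmeasurable.Diff S(3) UD)
  also have "measure lebesgue (S - \<Union>D) = 0" using neg by (rule negligible_imp_measure0)
  finally have "measure lebesgue S - \<eta> < measure lebesgue (\<Union>D')" using D'(3) by simp
  also have "\<dots> = (\<Sum>i\<in>C'. snd i - fst i)"
  proof -
    have "measure lebesgue (\<Union>D') = (\<Sum>i\<in>C'. measure lebesgue {fst i<..<snd i})"
      unfolding C'(3)
    proof (rule measure_finite_Union[OF C'(2) _ dis])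
      show "emeasure lebesgue {fst i<..<snd i} \<noteq> \<infinity>" if "i \<in> C'" for i
      proof -
        have "i \<in> K" using that C'(1) C(2) by blast
        then show ?thesis by (simp add: K_def emeasure_lborel_Ioo)
      qed
    qed auto
    also have "\<dots> = (\<Sum>i\<in>C'. snd i - fst i)"
      using C'(1) C(2) by (intro sum.cong) (auto simp: K_def)
    finally show ?thesis .
  qed
  finally have "(\<Sum>i\<in>C'. snd i - fst i) > measure lebesgue S - \<eta>" .
  moreover have "\<forall>i\<in>C'. fst i < snd i \<and> P (fst i) (snd i) \<and> {fst i<..<snd i} \<subseteq> G"
    using C'(1) C(2) unfolding K_def by blast
  ultimately show thesis using C'(2) dis by (intro that)
qed

text \<open>Expressing that \<open>C\<close> and \<open>R\<close> tile \<open>{a..b}\<close> by a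
  telescoping identity for all functions avoids listing endpoints in order: the identity function
  yields the total length of the gaps, any other \<open>f\<close> its increments.\<close>

definition gap_family :: "real \<Rightarrow> real \<Rightarrow> (real \<times> real) set \<Rightarrow> (real \<times> real) set \<Rightarrow> bool" where
  "gap_family a b C R \<longleftrightarrow> finite R \<and> (\<forall>i\<in>R. a \<le> fst i \<and> fst i \<le> snd i \<and> snd i \<le> b) \<and>
     disjoint_family_on (\<lambda>i. {fst i<..<snd i}) R \<and>
     (\<forall>f::real \<Rightarrow> real. f b - f a = (\<Sum>i\<in>C. f (snd i) - f (fst i)) + (\<Sum>i\<in>R. f (snd i) - f (fst i)))"

text \<open>Intervals are added by increasing left endpoint, so the newest one lies to the right of
  all others and splits off one last gap. The right end \<open>b\<close> is generalised because the
  earlier intervals are then treated on \<open>{a..u}\<close>.\<close>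

lemma gap_family_exists:
  assumes "finite C" "a \<le> b" "\<forall>i\<in>C. a \<le> fst i \<and> fst i < snd i \<and> snd i \<le> b"
    and "disjoint_family_on (\<lambda>i. {fst i<..<snd i}) C"
  shows "\<exists>R. gap_family a b C R"
proof -
  have "\<forall>b\<ge>a. (\<forall>i\<in>C. a \<le> fst i \<and> fst i < snd i \<and> snd i \<le> b) \<longrightarrow> disjoint_family_on (\<lambda>i. {fst i<..<snd i}) C \<longrightarrow>
    (\<exists>R. gap_family a b C R)"
    using \<open>finite C\<close>
  proof (induction C rule: finite_ranking_induct[where f=fst])
    case empty
    have "gap_family a b {} {(a, b)}" if "a \<le> b" for b
      using that by (simp add: gap_family_def disjoint_family_on_def)
    then show ?case by blast
  next
    case (insert x C)
    show ?case
    proof (cases "x \<in> C")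
      case True
      then show ?thesis using insert by (simp add: insert_absorb)
    next
      case False
      obtain u v where x: "x = (u, v)" by force
      show ?thesis
      proof (intro allI impI)
        fix b assume "a \<le> b" and C: "\<forall>i\<in>insert x C. a \<le> fst i \<and> fst i < snd i \<and> snd i \<le> b"
          and dis: "disjoint_family_on (\<lambda>i. {fst i<..<snd i}) (insert x C)"
        have uv: "a \<le> u" "u < v" "v \<le> b" using C x by auto
        have le: "snd i \<le> u" if i: "i \<in> C" for i
        proof (rule ccontr)
          assume n: "\<not> ?thesis"
          have "fst i \<le> u" using insert(2)[OF i] x by simp
          obtain z where "u < z" "z < min (snd i) v" using n uv dense[of u "min (snd i) v"] by auto
          then have "z \<in> {fst i<..<snd i}" "z \<in> {fst x<..<snd x}" using \<open>fst i \<le> u\<close> x by auto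
          then show False using disjoint_family_onD[OF dis, of i x] i False by blast
        qed
        have "disjoint_family_on (\<lambda>i. {fst i<..<snd i}) C"
          using dis by (rule disjoint_family_on_mono[rotated]) auto
        moreover have "\<forall>i\<in>C. a \<le> fst i \<and> fst i < snd i \<and> snd i \<le> u" using C le by auto
        ultimately have "\<exists>R. gap_family a u C R"
          using insert(3) uv(1) by blast
        then obtain R where "gap_family a u C R" ..
        then have R: "finite R" "\<And>i. i \<in> R \<Longrightarrow> a \<le> fst i \<and> fst i \<le> snd i \<and> snd i \<le> u"
          "disjoint_family_on (\<lambda>i. {fst i<..<snd i}) R"
          "\<And>f::real \<Rightarrow> real. f u - f a = (\<Sum>i\<in>C. f (snd i) - f (fst i)) + (\<Sum>i\<in>R. f (snd i) - f (fst i))"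
          by (simp_all add: gap_family_def)
        have vbR: "(v, b) \<notin> R" using R(2)[of "(v, b)"] uv by auto
        have "gap_family a b (insert x C) (insert (v, b) R)"
          unfolding gap_family_def
        proof (intro conjI allI ballI)
          show "disjoint_family_on (\<lambda>i. {fst i<..<snd i}) (insert (v, b) R)"
            unfolding disjoint_family_on_insert[OF vbR] using R(2,3) uv by fastforce
          show "f b - f a = (\<Sum>i\<in>insert x C. f (snd i) - f (fst i)) + (\<Sum>i\<in>insert (v, b) R. f (snd i) - f (fst i))" for f :: "real \<Rightarrow> real"
            using R(1) R(4)[of f] insert(1) False vbR by (simp add: x)
          show "a \<le> fst i" if "i \<in> insert (v, b) R" for i using that R(2)[of i] uv by auto
          show "fst i \<le> snd i" if "i \<in> insert (v, b) R" for i using that R(2)[of i] uv by auto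
          show "snd i \<le> b" if "i \<in> insert (v, b) R" for i using that R(2)[of i] uv by auto
        qed (use R in simp)
        then show "\<exists>R. gap_family a b (insert x C) R" ..
      qed
    qed
  qed
  from this[THEN spec, THEN mp, OF assms(2), THEN mp, OF assms(3), THEN mp, OF assms(4)]
  show ?thesis .
qed

section \<open>Null sets of exceptional slopes\<close>

lemma negligible_bounded_pieces:
  fixes S :: "real set"
  assumes S: "S \<in> sets borel" and "\<And>a b. a < b \<Longrightarrow> measure lebesgue (S \<inter> {a<..<b}) = 0"
  shows "negligible S"
proof (subst negligible_on_intervals, intro allI)
  fix a b :: real
  define a' b' where "a' = min a b - 1" and "b' = max a b + 1"
  have "S \<inter> {a'<..<b'} \<in> lmeasurable"
    by (rule fmeasurableI2[of "{a'<..<b'}"]) (use S in auto)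
  moreover have "measure lebesgue (S \<inter> {a'<..<b'}) = 0" by (rule assms) (simp add: a'_def b'_def)
  ultimately have "negligible (S \<inter> {a'<..<b'})" by (simp add: negligible_iff_measure)
  then show "negligible (S \<inter> cbox a b)"
    by (rule negligible_subset) (auto simp: a'_def b'_def)
qed

lemma open_hull_within_interval:
  fixes S :: "real set"
  assumes S: "S \<in> sets borel" "S \<subseteq> {a<..<b}" and "\<eta> > 0"
  obtains G where "open G" "S \<subseteq> G" "G \<subseteq> {a<..<b}" "G \<in> lmeasurable" "measure lebesgue (G - S) < \<eta>"
proof -
  have "S \<in> sets lebesgue" using S by simp
  then obtain U where U: "open U" "S \<subseteq> U" "U - S \<in> lmeasurable" "emeasure lebesgue (U - S) < ennreal \<eta>"
    using sets_lebesgue_outer_open \<open>\<eta> > 0\<close> by blast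
  have mU: "measure lebesgue (U - S) < \<eta>"
    using U(3,4) \<open>\<eta> > 0\<close> by (simp add: emeasure_eq_measure2 ennreal_less_iff)
  show thesis
  proof (rule that[of "U \<inter> {a<..<b}"])
    show "U \<inter> {a<..<b} \<in> lmeasurable"
      by (rule fmeasurableI2[of "{a<..<b}"]) (use U in auto)
    have "measure lebesgue (U \<inter> {a<..<b} - S) \<le> measure lebesgue (U - S)"
      using S U(3) by (intro measure_mono_fmeasurable) (auto simp: borel_open U(1))
    then show "measure lebesgue (U \<inter> {a<..<b} - S) < \<eta>" using mU by simp
  qed (use U S in auto)
qed

text \<open>Cover the exceptional set by short intervals of slope below \<open>p\<close>, then cover it again inside
  these by intervals of slope above \<open>q\<close>. The gaps between the two families have small total length,
  so absolute continuity makes the two increments comparable.\<close>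

lemma abs_cont_slope_gap_negligible:
  assumes f: "abs_cont f" and pq: "p < q"
  shows "negligible (slope_cover (\<lambda>u v. f v - f u < p * (v - u)) \<inter> slope_cover (\<lambda>u v. f v - f u > q * (v - u)))"
    (is "negligible (slope_cover ?P \<inter> slope_cover ?Q)")
proof (rule negligible_bounded_pieces)
  show "slope_cover ?P \<inter> slope_cover ?Q \<in> sets borel"
    by (intro sets.Int slope_cover_borel)
  fix a b :: real assume ab: "a < b"
  define S where "S = slope_cover ?P \<inter> slope_cover ?Q \<inter> {a<..<b}"
  have Sb: "S \<in> sets borel" unfolding S_def by (intro sets.Int slope_cover_borel) auto
  have Sm: "S \<in> lmeasurable" by (rule fmeasurableI2[of "{a<..<b}"]) (use Sb in \<open>auto simp: S_def\<close>)
  have SI: "S \<subseteq> {a<..<b}" by (auto simp: S_def)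
  define e where "e = measure lebesgue S"
  show "measure lebesgue (S) = 0"
  proof (rule ccontr)
    assume "measure lebesgue S \<noteq> 0"
    then have e: "e > 0" unfolding e_def by (simp add: zero_less_measure_iff)
    \<comment> \<open>The comparison of increments will give
      \<open>q * e - p * e \<le> 2 * \<epsilon>\<close>, whereas this choice makes the left side
      equal to \<open>4 * \<epsilon>\<close>.\<close>
    define \<epsilon> where "\<epsilon> = (q - p) * e / 4"
    have \<epsilon>: "\<epsilon> > 0" using e pq by (simp add: \<epsilon>_def)
    have "abs_cont_on a b f" using f by (simp add: abs_cont_def)
    then obtain \<delta> where \<delta>: "\<delta> > 0" and D: "\<forall>I (u::(real \<times> real) \<times> (real \<times> real) \<Rightarrow> real) v. finite I \<longrightarrow>
       (\<forall>i\<in>I. a \<le> u i \<and> u i \<le> v i \<and> v i \<le> b) \<longrightarrow>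
       disjoint_family_on (\<lambda>i. {u i<..<v i}) I \<longrightarrow>
       (\<Sum>i\<in>I. v i - u i) < \<delta> \<longrightarrow> (\<Sum>i\<in>I. \<bar>f (v i) - f (u i)\<bar>) < \<epsilon>"
      by (rule abs_cont_on_family[OF _ \<epsilon>, where 'i="(real \<times> real) \<times> (real \<times> real)"])
    \<comment> \<open>The first bound makes the gaps shorter than \<open>\<delta>\<close> in total;
      the second absorbs the errors of at most \<open>3 * \<eta>\<close> in the lengths of the two
      families, weighted by the slopes \<open>p\<close> and \<open>q\<close>.\<close>
    define \<eta> where "\<eta> = min (\<delta> / 4) (\<epsilon> / (3 * (\<bar>p\<bar> + \<bar>q\<bar>) + 1))"
    have \<eta>: "\<eta> > 0" using \<delta> \<epsilon> by (simp add: \<eta>_def add_nonneg_pos)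
    have \<eta>1: "4 * \<eta> \<le> \<delta>" using min.cobounded1[of "\<delta> / 4"] unfolding \<eta>_def by simp
    have "\<eta> * (3 * (\<bar>p\<bar> + \<bar>q\<bar>) + 1) \<le> \<epsilon>"
    proof -
      have "\<eta> \<le> \<epsilon> / (3 * (\<bar>p\<bar> + \<bar>q\<bar>) + 1)" by (simp add: \<eta>_def)
      moreover have "3 * (\<bar>p\<bar> + \<bar>q\<bar>) + 1 > 0" by (simp add: add_nonneg_pos)
      ultimately show ?thesis by (simp add: pos_le_divide_eq)
    qed
    then have \<eta>2: "3 * \<bar>p\<bar> * \<eta> + 3 * \<bar>q\<bar> * \<eta> \<le> \<epsilon>" using \<eta> by (simp add: algebra_simps)
    obtain G where G: "open G" "S \<subseteq> G" "G \<subseteq> {a<..<b}" "G \<in> lmeasurable" "measure lebesgue (G - S) < \<eta>"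
      by (rule open_hull_within_interval[OF Sb SI \<eta>])
    have mG: "measure lebesgue G < e + \<eta>"
    proof -
      have "measure lebesgue G = measure lebesgue (S \<union> (G - S))" using G(2) by (simp add: Un_absorb1)
      also have "\<dots> \<le> e + measure lebesgue (G - S)"
        unfolding e_def by (intro measure_Un_le fmeasurableD fmeasurable.Diff Sm G(4))
      finally show ?thesis using G(5) by simp
    qed
    have "S \<subseteq> slope_cover ?P" by (auto simp: S_def)
    then obtain C1 where
      C1: "finite C1" "\<forall>i\<in>C1. fst i < snd i \<and> ?P (fst i) (snd i) \<and> {fst i<..<snd i} \<subseteq> G"
      "disjoint_family_on (\<lambda>i. {fst i<..<snd i}) C1" "(\<Sum>i\<in>C1. snd i - fst i) > e - \<eta>"
      unfolding e_def by (rule slope_cover_Vitali[OF _ G(2) Sm G(1,4) \<eta>])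
    have C1': "fst i < snd i" "f (snd i) - f (fst i) < p * (snd i - fst i)" "{fst i<..<snd i} \<subseteq> G"
      "a \<le> fst i" "snd i \<le> b" if "i \<in> C1" for i
    proof -
      show *: "fst i < snd i" "f (snd i) - f (fst i) < p * (snd i - fst i)" "{fst i<..<snd i} \<subseteq> G"
        using C1(2) that by auto
      have "{fst i<..<snd i} \<subseteq> {a..b}" using * G(3) by force
      then show "a \<le> fst i" "snd i \<le> b" using * by (simp_all add: greaterThanLessThan_subseteq_atLeastAtMost_iff)
    qed
    define W where "W = (\<Union>i\<in>C1. {fst i<..<snd i})"
    have W: "open W" "W \<subseteq> G" using C1'(3) by (auto simp: W_def simp del: greaterThanLessThan_iff)
    have Wm: "W \<in> lmeasurable" by (rule fmeasurableI2[OF G(4) W(2)]) (use W in auto)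
    have len1: "(\<Sum>i\<in>C1. snd i - fst i) \<le> measure lebesgue W"
      by (rule sum_lengths_le_measure[OF C1(1) _ C1(3) _ Wm]) (use C1' in \<open>auto simp: W_def less_imp_le\<close>)
    have mW: "measure lebesgue W \<le> measure lebesgue G"
      by (intro measure_mono_fmeasurable fmeasurableD W(2) G(4) Wm)
    have SWm: "S \<inter> W \<in> lmeasurable" using Sm Wm by auto
    have "measure lebesgue W \<le> measure lebesgue (S \<inter> W \<union> (G - S))"
      using W(2) by (intro measure_mono_fmeasurable fmeasurable.Un fmeasurable.Diff fmeasurableD fmeasurable.Int Sm Wm G(4)) auto
    also have "\<dots> \<le> measure lebesgue (S \<inter> W) + measure lebesgue (G - S)"
      by (intro measure_Un_le fmeasurableD fmeasurable.Diff fmeasurable.Int Sm Wm G(4))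
    finally have mSW: "measure lebesgue (S \<inter> W) > e - 2 * \<eta>" using G(5) len1 C1(4) by simp
    \<comment> \<open>Each steep interval must lie within a single interval of the first family, so
      that the complement can be formed parent by parent.\<close>
    let ?Q' = "\<lambda>u v. ?Q u v \<and> (\<exists>i\<in>C1. fst i \<le> u \<and> v \<le> snd i)"
    have "S \<inter> W \<subseteq> slope_cover ?Q'"
    proof
      fix x assume x: "x \<in> S \<inter> W"
      then obtain i where i: "i \<in> C1" "fst i < x" "x < snd i" by (auto simp: W_def)
      have xQ: "x \<in> slope_cover ?Q" using x by (auto simp: S_def)
      show "x \<in> slope_cover ?Q'"
        unfolding slope_cover_def
      proof safe
        fix d :: real assume "d > 0"
        then have "min d (min (x - fst i) (snd i - x)) > 0" using i by simp
        then obtain u v where "u < x" "x < v" "v - u < min d (min (x - fst i) (snd i - x))" "?Q u v"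
          using xQ unfolding slope_cover_def by blast
        then show "\<exists>u v. u < x \<and> x < v \<and> v - u < d \<and> f v - f u > q * (v - u) \<and> (\<exists>i\<in>C1. fst i \<le> u \<and> v \<le> snd i)"
          using i(1) by (intro exI[of _ u] exI[of _ v] conjI bexI[of _ i]) auto
      qed
    qed
    then obtain C2 where
      C2: "finite C2" "\<forall>i\<in>C2. fst i < snd i \<and> ?Q' (fst i) (snd i) \<and> {fst i<..<snd i} \<subseteq> W"
      "disjoint_family_on (\<lambda>i. {fst i<..<snd i}) C2" "(\<Sum>i\<in>C2. snd i - fst i) > measure lebesgue (S \<inter> W) - \<eta>"
      by (rule slope_cover_Vitali[OF _ Int_lower2 SWm W(1) Wm \<eta>])
    have C2': "fst j < snd j" "f (snd j) - f (fst j) > q * (snd j - fst j)"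
      "\<exists>i\<in>C1. fst i \<le> fst j \<and> snd j \<le> snd i" "{fst j<..<snd j} \<subseteq> W" if "j \<in> C2" for j
      using C2(2) that by auto
    have len2: "(\<Sum>i\<in>C2. snd i - fst i) \<le> measure lebesgue W"
      by (rule sum_lengths_le_measure[OF C2(1) _ C2(3) _ Wm]) (use C2' in \<open>auto simp: less_imp_le\<close>)
    obtain \<pi> where \<pi>: "\<And>j. j \<in> C2 \<Longrightarrow> \<pi> j \<in> C1 \<and> fst (\<pi> j) \<le> fst j \<and> snd j \<le> snd (\<pi> j)"
      using C2'(3) by metis
    define B where "B i = {j\<in>C2. \<pi> j = i}" for i
    have "\<exists>R. gap_family (fst i) (snd i) (B i) R" if i: "i \<in> C1" for i
    proof (rule gap_family_exists)
      show "disjoint_family_on (\<lambda>i. {fst i<..<snd i}) (B i)"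
        using C2(3) by (rule disjoint_family_on_mono[rotated]) (auto simp: B_def)
    qed (use C2' \<pi> C1'(1)[OF i] C2(1) in \<open>auto simp: B_def\<close>)
    then obtain R where R: "\<And>i. i \<in> C1 \<Longrightarrow> gap_family (fst i) (snd i) (B i) (R i)" by metis
    have Rfin: "finite (R i)"
      and Rin: "\<And>r. r \<in> R i \<Longrightarrow> fst i \<le> fst r \<and> fst r \<le> snd r \<and> snd r \<le> snd i"
      and Rdis: "disjoint_family_on (\<lambda>i. {fst i<..<snd i}) (R i)"
      and Rsum: "\<And>f::real \<Rightarrow> real. f (snd i) - f (fst i) = (\<Sum>i\<in>B i. f (snd i) - f (fst i)) + (\<Sum>i\<in>R i. f (snd i) - f (fst i))"
      if "i \<in> C1" for i
      using R[OF that] by (auto simp: gap_family_def)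
    have sumB: "(\<Sum>i\<in>C1. \<Sum>j\<in>B i. h j) = (\<Sum>j\<in>C2. h j)" for h :: "real \<times> real \<Rightarrow> real"
      unfolding B_def by (rule sum.group[OF C2(1) C1(1)]) (use \<pi> in auto)
    \<comment> \<open>Each gap carries its parent as a tag: gaps of one parent are disjoint among
      themselves, gaps of different parents because the parents are.\<close>
    define I where "I = Sigma C1 R"
    have total: "(\<Sum>i\<in>C1. g (snd i) - g (fst i))
       = (\<Sum>j\<in>C2. g (snd j) - g (fst j)) + (\<Sum>k\<in>I. g (snd (snd k)) - g (fst (snd k)))" for g :: "real \<Rightarrow> real"
    proof -
      have "(\<Sum>i\<in>C1. g (snd i) - g (fst i)) =
         (\<Sum>i\<in>C1. (\<Sum>j\<in>B i. g (snd j) - g (fst j)) + (\<Sum>j\<in>R i. g (snd j) - g (fst j)))"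
        by (intro sum.cong refl Rsum)
      also have "\<dots> = (\<Sum>j\<in>C2. g (snd j) - g (fst j)) + (\<Sum>i\<in>C1. \<Sum>j\<in>R i. g (snd j) - g (fst j))"
        by (simp only: sum.distrib sumB)
      also have "(\<Sum>i\<in>C1. \<Sum>j\<in>R i. g (snd j) - g (fst j)) = (\<Sum>k\<in>I. g (snd (snd k)) - g (fst (snd k)))"
        unfolding I_def using C1(1) Rfin by (subst sum.Sigma) (auto simp: case_prod_unfold)
      finally show ?thesis .
    qed
    have "(\<Sum>k\<in>I. \<bar>f (snd (snd k)) - f (fst (snd k))\<bar>) < \<epsilon>"
    proof (rule D[rule_format])
      show "finite I" using C1(1) Rfin by (auto simp: I_def)
      show "a \<le> fst (snd k) \<and> fst (snd k) \<le> snd (snd k) \<and> snd (snd k) \<le> b" if "k \<in> I" for k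
      proof -
        have "fst k \<in> C1" "snd k \<in> R (fst k)" using that by (auto simp: I_def)
        then show ?thesis using Rin[of "fst k" "snd k"] C1'[of "fst k"] by auto
      qed
      show "disjoint_family_on (\<lambda>k. {fst (snd k)<..<snd (snd k)}) I"
        unfolding disjoint_family_on_def
      proof (intro ballI impI)
        fix k l assume kl: "k \<in> I" "l \<in> I" "k \<noteq> l"
        then have k: "fst k \<in> C1" "snd k \<in> R (fst k)" and l: "fst l \<in> C1" "snd l \<in> R (fst l)" by (auto simp: I_def)
        show "{fst (snd k)<..<snd (snd k)} \<inter> {fst (snd l)<..<snd (snd l)} = {}"
        proof (cases "fst k = fst l")
          case True
          then have "snd k \<noteq> snd l" using kl(3) by (simp add: prod_eq_iff)
          then show ?thesis using disjoint_family_onD[OF Rdis[OF k(1)], of "snd k" "snd l"] k l True by simp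
        next
          case False
          have "{fst (snd k)<..<snd (snd k)} \<subseteq> {fst (fst k)<..<snd (fst k)}" using Rin[OF k] by auto
          moreover have "{fst (snd l)<..<snd (snd l)} \<subseteq> {fst (fst l)<..<snd (fst l)}" using Rin[OF l] by auto
          ultimately show ?thesis using disjoint_family_onD[OF C1(3) k(1) l(1) False] by blast
        qed
      qed
      have "(\<Sum>k\<in>I. snd (snd k) - fst (snd k)) = (\<Sum>i\<in>C1. snd i - fst i) - (\<Sum>j\<in>C2. snd j - fst j)"
        using total[of "\<lambda>x. x"] by simp
      also have "\<dots> < (e + \<eta>) - (e - 3 * \<eta>)" using C2(4) mSW len1 mW mG by simp
      also have "\<dots> \<le> \<delta>" using \<eta>1 by simp
      finally show "(\<Sum>k\<in>I. snd (snd k) - fst (snd k)) < \<delta>" .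
    qed
    then have "\<bar>\<Sum>k\<in>I. f (snd (snd k)) - f (fst (snd k))\<bar> < \<epsilon>"
      using sum_abs[of "\<lambda>k. f (snd (snd k)) - f (fst (snd k))" I] by linarith
    moreover have "(\<Sum>i\<in>C1. f (snd i) - f (fst i)) \<le> p * (\<Sum>i\<in>C1. snd i - fst i)"
      unfolding sum_distrib_left by (intro sum_mono less_imp_le C1'(2))
    moreover have "(\<Sum>i\<in>C2. f (snd i) - f (fst i)) \<ge> q * (\<Sum>i\<in>C2. snd i - fst i)"
      unfolding sum_distrib_left by (intro sum_mono less_imp_le C2'(2))
    ultimately have main: "q * (\<Sum>i\<in>C2. snd i - fst i) - \<epsilon> \<le> p * (\<Sum>i\<in>C1. snd i - fst i)"
      using total[of f] by linarith
    have "\<bar>(\<Sum>i\<in>C2. snd i - fst i) - e\<bar> \<le> 3 * \<eta>" using C2(4) mSW len2 mW mG \<eta> by linarith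
    then have "\<bar>q * ((\<Sum>i\<in>C2. snd i - fst i) - e)\<bar> \<le> \<bar>q\<bar> * (3 * \<eta>)"
      unfolding abs_mult by (rule mult_left_mono) simp
    moreover have "\<bar>(\<Sum>i\<in>C1. snd i - fst i) - e\<bar> \<le> 3 * \<eta>" using C1(4) len1 mW mG \<eta> by linarith
    then have "\<bar>p * ((\<Sum>i\<in>C1. snd i - fst i) - e)\<bar> \<le> \<bar>p\<bar> * (3 * \<eta>)"
      unfolding abs_mult by (rule mult_left_mono) simp
    ultimately have "q * e - p * e \<le> 2 * \<epsilon>" using main \<eta>2 by (simp add: algebra_simps abs_le_iff)
    moreover have "q * e - p * e = 4 * \<epsilon>" by (simp add: \<epsilon>_def algebra_simps)
    ultimately show False using \<epsilon> by simp
  qed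
qed

text \<open>Short intervals of slope above \<open>M\<close> filling half of a set of measure
  \<open>e > 0\<close> have a total increment of at least \<open>M * e / 2\<close>, although their
  total length stays below the \<open>\<delta>\<close> that belongs to increment 1. The choice
  \<open>M > 2 / e\<close> makes this a contradiction.\<close>

lemma abs_cont_infinite_slope_negligible:
  assumes f: "abs_cont f"
  shows "negligible (\<Inter>n::nat. slope_cover (\<lambda>u v. f v - f u > real n * (v - u)))" (is "negligible ?E")
  unfolding locally_negligible_alt[of ?E]
proof
  fix x assume x: "x \<in> ?E"
  have "abs_cont_on (x - 1) (x + 1) f" using f by (simp add: abs_cont_def)
  then obtain \<delta> where \<delta>: "\<delta> > 0" and D: "\<forall>I (u::real \<times> real \<Rightarrow> real) v. finite I \<longrightarrow>
       (\<forall>i\<in>I. x - 1 \<le> u i \<and> u i \<le> v i \<and> v i \<le> x + 1) \<longrightarrow>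
       disjoint_family_on (\<lambda>i. {u i<..<v i}) I \<longrightarrow>
       (\<Sum>i\<in>I. v i - u i) < \<delta> \<longrightarrow> (\<Sum>i\<in>I. \<bar>f (v i) - f (u i)\<bar>) < 1"
    by (rule abs_cont_on_family[OF _ zero_less_one, where 'i="real \<times> real"])
  define d where "d = min 1 (\<delta> / 3)"
  have d: "d > 0" "d \<le> 1" "2 * d < \<delta>" using \<delta> by (auto simp: d_def)
  define T where "T = {x - d<..<x + d}"
  define S where "S = ?E \<inter> T"
  have Tm: "T \<in> lmeasurable" and mT: "measure lebesgue T = 2 * d" using d by (auto simp: T_def)
  have Sb: "S \<in> sets borel" unfolding S_def T_def
    by (intro sets.Int sets.countable_INT'[OF _ UNIV_not_empty] image_subsetI slope_cover_borel) auto
  have Sm: "S \<in> lmeasurable" by (rule fmeasurableI2[OF Tm]) (use Sb in \<open>auto simp: S_def\<close>)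
  have "measure lebesgue S = 0"
  proof (rule ccontr)
    assume "measure lebesgue S \<noteq> 0"
    then have e: "measure lebesgue S > 0" by (simp add: zero_less_measure_iff)
    define e where "e = measure lebesgue S"
    obtain M :: nat where M: "real M > 2 / e" using reals_Archimedean2 by blast
    have SM: "S \<subseteq> slope_cover (\<lambda>u v. f v - f u > real M * (v - u))" and ST: "S \<subseteq> T" by (auto simp: S_def)
    have oT: "open T" by (simp add: T_def)
    have e2: "e / 2 > 0" using e by (simp add: e_def)
    obtain C where
      C: "finite C" "\<forall>i\<in>C. fst i < snd i \<and> f (snd i) - f (fst i) > real M * (snd i - fst i) \<and> {fst i<..<snd i} \<subseteq> T"
      "disjoint_family_on (\<lambda>i. {fst i<..<snd i}) C" "(\<Sum>i\<in>C. snd i - fst i) > e - e / 2"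
      unfolding e_def by (rule slope_cover_Vitali[OF SM ST Sm oT Tm e2[unfolded e_def]])
    have C': "fst i < snd i" "real M * (snd i - fst i) < f (snd i) - f (fst i)" "{fst i<..<snd i} \<subseteq> T"
      "x - 1 \<le> fst i" "snd i \<le> x + 1" if "i \<in> C" for i
    proof -
      show *: "fst i < snd i" "f (snd i) - f (fst i) > real M * (snd i - fst i)" "{fst i<..<snd i} \<subseteq> T"
        using C(2) that by auto
      have "{fst i<..<snd i} \<subseteq> {x - 1..x + 1}" using * d by (force simp: T_def)
      then show "x - 1 \<le> fst i" "snd i \<le> x + 1" using * by (simp_all add: greaterThanLessThan_subseteq_atLeastAtMost_iff)
    qed
    have len: "(\<Sum>i\<in>C. snd i - fst i) \<le> measure lebesgue T"
      by (rule sum_lengths_le_measure[OF C(1) _ C(3) _ Tm]) (use C' in \<open>auto simp: less_imp_le\<close>)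
    have "(\<Sum>i\<in>C. \<bar>f (snd i) - f (fst i)\<bar>) < 1"
      using C(1,3) C' len d mT by (intro D[rule_format]) (auto simp: less_imp_le)
    then have "(\<Sum>i\<in>C. f (snd i) - f (fst i)) < 1"
      using sum_abs[of "\<lambda>i. f (snd i) - f (fst i)" C] by linarith
    moreover have "(\<Sum>i\<in>C. f (snd i) - f (fst i)) \<ge> real M * (\<Sum>i\<in>C. snd i - fst i)"
      unfolding sum_distrib_left by (intro sum_mono less_imp_le C'(2))
    moreover have "real M * (\<Sum>i\<in>C. snd i - fst i) \<ge> (2 / e) * (e / 2)"
      using M C(4) e2 by (intro mult_mono) auto
    moreover have "(2 / e) * (e / 2) = 1" using e2 by simp
    ultimately show False by simp
  qed
  then have "negligible S" using Sm by (simp add: negligible_iff_measure)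
  moreover have "openin (top_of_set ?E) S" unfolding S_def T_def by (auto intro: openin_open_Int)
  moreover have "x \<in> S" using x d by (simp add: S_def T_def)
  ultimately show "\<exists>U. openin (top_of_set ?E) U \<and> x \<in> U \<and> negligible U" by blast
qed

text \<open>Letting one endpoint of a straddling interval tend to \<open>x\<close> turns its slope
  into a one-sided difference quotient; by continuity at \<open>x\<close> the non-strict inequality
  passes to the limit with the same \<open>\<epsilon>\<close>.\<close>

lemma has_real_derivative_from_straddling_slopes:
  fixes f :: "real \<Rightarrow> real"
  assumes cont: "isCont f x"
    and sl: "\<And>\<epsilon>. \<epsilon> > 0 \<Longrightarrow> \<exists>d>0. \<forall>u v. u < x \<longrightarrow> x < v \<longrightarrow> v - u < d \<longrightarrow> \<bar>f v - f u - L * (v - u)\<bar> \<le> \<epsilon> * (v - u)"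
  shows "(f has_real_derivative L) (at x)"
  unfolding has_field_derivative_def has_derivative_within_alt
proof (intro conjI allI impI bounded_linear_mult_right)
  fix \<epsilon> :: real assume "\<epsilon> > 0"
  then obtain d where d: "d > 0" "\<And>u v. u < x \<Longrightarrow> x < v \<Longrightarrow> v - u < d \<Longrightarrow> \<bar>f v - f u - L * (v - u)\<bar> \<le> \<epsilon> * (v - u)"
    using sl by blast
  have right: "\<bar>f y - f x - L * (y - x)\<bar> \<le> \<epsilon> * (y - x)" if y: "x < y" "y - x < d" for y
  proof (rule tendsto_le[of "at_left x"])
    have fx: "(f \<longlongrightarrow> f x) (at_left x)" using cont by (simp add: isCont_def filterlim_at_split)
    show "((\<lambda>u. \<bar>f y - f u - L * (y - u)\<bar>) \<longlongrightarrow> \<bar>f y - f x - L * (y - x)\<bar>) (at_left x)"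
      by (intro tendsto_intros fx)
    show "((\<lambda>u. \<epsilon> * (y - u)) \<longlongrightarrow> \<epsilon> * (y - x)) (at_left x)"
      by (intro tendsto_intros)
    have "y - d < x" using y by simp
    then show "\<forall>\<^sub>F u in at_left x. \<bar>f y - f u - L * (y - u)\<bar> \<le> \<epsilon> * (y - u)"
      unfolding eventually_at_left_field using y d(2) by (intro exI[of _ "y - d"]) auto
  qed simp
  have left: "\<bar>f x - f y - L * (x - y)\<bar> \<le> \<epsilon> * (x - y)" if y: "y < x" "x - y < d" for y
  proof (rule tendsto_le[of "at_right x"])
    have fx: "(f \<longlongrightarrow> f x) (at_right x)" using cont by (simp add: isCont_def filterlim_at_split)
    show "((\<lambda>v. \<bar>f v - f y - L * (v - y)\<bar>) \<longlongrightarrow> \<bar>f x - f y - L * (x - y)\<bar>) (at_right x)"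
      by (intro tendsto_intros fx)
    show "((\<lambda>v. \<epsilon> * (v - y)) \<longlongrightarrow> \<epsilon> * (x - y)) (at_right x)"
      by (intro tendsto_intros)
    have "x < y + d" using y by simp
    then show "\<forall>\<^sub>F v in at_right x. \<bar>f v - f y - L * (v - y)\<bar> \<le> \<epsilon> * (v - y)"
      unfolding eventually_at_right_field using y d(2) by (intro exI[of _ "y + d"]) auto
  qed simp
  show "\<exists>d>0. \<forall>y\<in>UNIV. norm (y - x) < d \<longrightarrow> norm (f y - f x - L * (y - x)) \<le> \<epsilon> * norm (y - x)"
  proof (intro exI[of _ d] conjI ballI impI d(1))
    fix y assume y: "norm (y - x) < d"
    consider "y = x" | "x < y" | "y < x" by linarith
    then show "norm (f y - f x - L * (y - x)) \<le> \<epsilon> * norm (y - x)"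
    proof cases
      case 2 then show ?thesis using right[of y] y by simp
    next
      case 3
      have "\<bar>f y - f x - L * (y - x)\<bar> = \<bar>f x - f y - L * (x - y)\<bar>"
        by (simp add: algebra_simps abs_if)
      then show ?thesis using left[of y] y 3 by simp
    qed simp
  qed
qed

lemma not_in_slope_cover_iff:
  "x \<notin> slope_cover P \<longleftrightarrow> (\<exists>d>0. \<forall>u v. u < x \<longrightarrow> x < v \<longrightarrow> v - u < d \<longrightarrow> \<not> P u v)"
  unfolding slope_cover_def by blast

text \<open>Outside \<open>N2\<close> and \<open>N3\<close> the straddling slopes stay bounded as
  the intervals shrink; outside \<open>N1\<close> no pair of rationals separates their lower limit
  from their upper limit. Hence they converge.\<close>

lemma abs_cont_differentiable_ae:
  assumes f: "abs_cont f"
  obtains N where "negligible N" "\<And>x. x \<notin> N \<Longrightarrow> \<exists>L. (f has_real_derivative L) (at x)"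
proof -
  define E where "E p q = slope_cover (\<lambda>u v. f v - f u < p * (v - u)) \<inter> slope_cover (\<lambda>u v. f v - f u > q * (v - u))" for p q
  define N1 where "N1 = (\<Union>i\<in>{i\<in>\<rat>\<times>\<rat>. fst i < snd i}. E (fst i) (snd i))"
  define N2 where "N2 = (\<Inter>n::nat. slope_cover (\<lambda>u v. f v - f u > real n * (v - u)))"
  define N3 where "N3 = (\<Inter>n::nat. slope_cover (\<lambda>u v. - f v - - f u > real n * (v - u)))"
  have "negligible N1" unfolding N1_def
  proof (rule negligible_countable_Union)
    have "countable (\<rat> \<times> \<rat> :: (real \<times> real) set)" by (intro countable_SIGMA countable_rat)
    then have "countable {i \<in> \<rat> \<times> \<rat>. fst i < (snd i :: real)}" by (rule countable_subset[rotated]) blast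
    then show "countable ((\<lambda>i. E (fst i) (snd i)) ` {i \<in> \<rat> \<times> \<rat>. fst i < snd i})" by simp
    show "negligible S" if S: "S \<in> (\<lambda>i. E (fst i) (snd i)) ` {i \<in> \<rat> \<times> \<rat>. fst i < snd i}" for S
    proof -
      obtain i where "fst i < snd i" "S = E (fst i) (snd i)" using S by blast
      then show ?thesis unfolding E_def by (simp only: abs_cont_slope_gap_negligible[OF f])
    qed
  qed
  moreover have "negligible N2" unfolding N2_def by (rule abs_cont_infinite_slope_negligible[OF f])
  moreover have "negligible N3" unfolding N3_def by (rule abs_cont_infinite_slope_negligible[OF abs_cont_uminus[OF f]])
  ultimately have neg: "negligible (N1 \<union> N2 \<union> N3)" by (intro negligible_Un)
  have "\<exists>L. (f has_real_derivative L) (at x)" if x: "x \<notin> N1 \<union> N2 \<union> N3" for x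
  proof -
    \<comment> \<open>The infimum of \<open>A\<close> is the upper limit of the straddling slopes at
      \<open>x\<close>.\<close>
    define A where "A = {c. x \<notin> slope_cover (\<lambda>u v. f v - f u > c * (v - u))}"
    have Ad: "\<exists>d>0. \<forall>u v. u < x \<longrightarrow> x < v \<longrightarrow> v - u < d \<longrightarrow> f v - f u \<le> c * (v - u)" if "c \<in> A" for c
      using that unfolding A_def not_in_slope_cover_iff by (simp add: not_less)
    obtain n2 :: nat where n2: "real n2 \<in> A" using x by (auto simp: N2_def A_def)
    obtain n3 :: nat where "x \<notin> slope_cover (\<lambda>u v. - f v - - f u > real n3 * (v - u))"
      using x by (auto simp: N3_def)
    then obtain d3 where d3: "d3 > 0" "\<And>u v. u < x \<Longrightarrow> x < v \<Longrightarrow> v - u < d3 \<Longrightarrow> - f v - - f u \<le> real n3 * (v - u)"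
      unfolding not_in_slope_cover_iff by (auto simp: not_less)
    have lower: "- real n3 \<le> c" if c: "c \<in> A" for c
    proof -
      obtain d where d: "d > 0" "\<And>u v. u < x \<Longrightarrow> x < v \<Longrightarrow> v - u < d \<Longrightarrow> f v - f u \<le> c * (v - u)"
        using Ad[OF c] by blast
      define t where "t = min d d3 / 4"
      have t: "t > 0" "2 * t < d" "2 * t < d3" using d d3 by (auto simp: t_def)
      have "f (x + t) - f (x - t) \<le> c * (2 * t)" using d(2)[of "x - t" "x + t"] t by simp
      moreover have "- f (x + t) - - f (x - t) \<le> real n3 * (2 * t)" using d3(2)[of "x - t" "x + t"] t by simp
      ultimately have "0 \<le> (c + real n3) * (2 * t)" by (simp add: algebra_simps)
      then show ?thesis using t(1) by (simp add: zero_le_mult_iff)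
    qed
    have bdd: "bdd_below A" using lower by (intro bdd_belowI[of _ "- real n3"]) auto
    define L where "L = Inf A"
    have "(f has_real_derivative L) (at x)"
    proof (rule has_real_derivative_from_straddling_slopes)
      show "isCont f x" using abs_cont_imp_continuous[OF f] by (simp add: continuous_on_eq_continuous_at)
      fix \<epsilon> :: real assume \<epsilon>: "\<epsilon> > 0"
      obtain c where c: "c \<in> A" "c < L + \<epsilon>"
        using cInf_lessD[of A "L + \<epsilon>"] n2 \<epsilon> by (auto simp: L_def)
      obtain d1 where d1: "d1 > 0" "\<And>u v. u < x \<Longrightarrow> x < v \<Longrightarrow> v - u < d1 \<Longrightarrow> f v - f u \<le> c * (v - u)"
        using Ad[OF c(1)] by blast
      \<comment> \<open>As \<open>q < L\<close>, slopes above \<open>q\<close> occur at all small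
        scales. Since \<open>x\<close> avoids \<open>E p q\<close>, slopes below \<open>p\<close>
        disappear at small scales, which is the lower estimate up to
        \<open>\<epsilon>\<close>.\<close>
      obtain q where q: "q \<in> \<rat>" "L - \<epsilon> / 2 < q" "q < L" using Rats_dense_in_real[of "L - \<epsilon> / 2" L] \<epsilon> by auto
      obtain p where p: "p \<in> \<rat>" "L - \<epsilon> < p" "p < L - \<epsilon> / 2" using Rats_dense_in_real[of "L - \<epsilon>" "L - \<epsilon> / 2"] \<epsilon> by auto
      have "q \<notin> A" using cInf_lower[OF _ bdd, of q] q(3) by (auto simp: L_def)
      moreover have "x \<notin> E p q"
      proof
        assume xE: "x \<in> E p q"
        have "(p, q) \<in> {i\<in>\<rat>\<times>\<rat>. fst i < snd i}" using p q by simp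
        then have "x \<in> N1" unfolding N1_def using xE by (intro UN_I[of "(p, q)"]) auto
        then show False using x by blast
      qed
      ultimately have "x \<notin> slope_cover (\<lambda>u v. f v - f u < p * (v - u))" by (auto simp: A_def E_def)
      then obtain d2 where d2: "d2 > 0" "\<And>u v. u < x \<Longrightarrow> x < v \<Longrightarrow> v - u < d2 \<Longrightarrow> f v - f u \<ge> p * (v - u)"
        unfolding not_in_slope_cover_iff by (auto simp: not_less)
      show "\<exists>d>0. \<forall>u v. u < x \<longrightarrow> x < v \<longrightarrow> v - u < d \<longrightarrow> \<bar>f v - f u - L * (v - u)\<bar> \<le> \<epsilon> * (v - u)"
      proof (intro exI[of _ "min d1 d2"] conjI allI impI)
        fix u v assume uv: "u < x" "x < v" "v - u < min d1 d2"
        have "f v - f u \<le> (L + \<epsilon>) * (v - u)"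
        proof -
          have "f v - f u \<le> c * (v - u)" using d1(2)[of u v] uv by simp
          also have "\<dots> \<le> (L + \<epsilon>) * (v - u)" using c(2) uv by (intro mult_right_mono) auto
          finally show ?thesis .
        qed
        moreover have "f v - f u \<ge> (L - \<epsilon>) * (v - u)"
        proof -
          have "(L - \<epsilon>) * (v - u) \<le> p * (v - u)" using p(2) uv by (intro mult_right_mono) auto
          also have "\<dots> \<le> f v - f u" using d2(2)[of u v] uv by simp
          finally show ?thesis .
        qed
        ultimately show "\<bar>f v - f u - L * (v - u)\<bar> \<le> \<epsilon> * (v - u)" by (simp add: algebra_simps abs_le_iff)
      qed (use d1 d2 in simp)
    qed
    then show ?thesis ..
  qed
  with neg show thesis using that by blast
qed

subsection \<open>Primitives of locally integrable functions\<close>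

lemma loc_integrable_absolutely_integrable: "loc_integrable g \<Longrightarrow> g absolutely_integrable_on {a..b}"
proof -
  assume "loc_integrable g"
  then have "set_integrable lborel {a..b} g" by (simp add: loc_integrable_def)
  then have i: "integrable lborel (\<lambda>x. indicator {a..b} x *\<^sub>R g x)" by (simp add: set_integrable_def)
  then show ?thesis
    unfolding set_integrable_def using integrable_completion[OF borel_measurable_integrable[OF i]] by simp
qed

lemma loc_integrable_integrable_on: "loc_integrable g \<Longrightarrow> g integrable_on {a..b}"
  using loc_integrable_absolutely_integrable absolutely_integrable_on_def by blast

definition primitive :: "(real \<Rightarrow> real) \<Rightarrow> real \<Rightarrow> real" where
  "primitive g x = (if 0 \<le> x then integral {0..x} g else - integral {x..0} g)"

lemma primitive_diff:
  assumes "loc_integrable g" "a \<le> b"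
  shows "primitive g b - primitive g a = integral {a..b} g"
proof -
  note I = loc_integrable_integrable_on[OF assms(1)]
  consider "0 \<le> a" | "b < 0" | "a < 0" "0 \<le> b" by linarith
  then show ?thesis
  proof cases
    case 1
    then show ?thesis using Henstock_Kurzweil_Integration.integral_combine[OF 1 assms(2) I] assms by (simp add: primitive_def)
  next
    case 2
    then show ?thesis using Henstock_Kurzweil_Integration.integral_combine[OF assms(2), of 0, OF _ I] assms by (simp add: primitive_def)
  next
    case 3
    then show ?thesis using Henstock_Kurzweil_Integration.integral_combine[of a 0 b, OF _ _ I] by (simp add: primitive_def)
  qed
qed

text \<open>Averages over intervals starting at \<open>x\<close> give the right derivative. The left
  derivative comes from the same fact for \<open>\<lambda>x. g (- x)\<close>, whose exceptional set
  has to be reflected back.\<close>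

lemma primitive_ae_derivative:
  assumes g: "loc_integrable g"
  obtains N where "negligible N" "\<And>x. x \<notin> N \<Longrightarrow> (primitive g has_real_derivative g x) (at x)"
proof -
  note I = loc_integrable_integrable_on[OF g]
  obtain N1 where N1: "negligible N1" "\<And>x e. x \<notin> N1 \<Longrightarrow> 0 < e \<Longrightarrow>
      \<exists>d>0. \<forall>h. 0 < h \<and> h < d \<longrightarrow> norm (integral (cbox x (x + h *\<^sub>R One)) g /\<^sub>R h ^ DIM(real) - g x) < e"
    by (rule integrable_ccontinuous_explicit[where f=g]) (use I in simp_all)
  have I': "(\<lambda>x. g (- x)) integrable_on cbox a b" for a b :: real
    using I[of "-b" "-a"] Henstock_Kurzweil_Integration.integrable_reflect_real[where f=g and a="-b" and b="-a"] by simp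
  obtain N2 where N2: "negligible N2" "\<And>x e. x \<notin> N2 \<Longrightarrow> 0 < e \<Longrightarrow>
      \<exists>d>0. \<forall>h. 0 < h \<and> h < d \<longrightarrow> norm (integral (cbox x (x + h *\<^sub>R One)) (\<lambda>x. g (- x)) /\<^sub>R h ^ DIM(real) - g (- x)) < e"
    using integrable_ccontinuous_explicit[OF I'] by metis
  have "negligible (uminus ` N2)"
    by (rule negligible_differentiable_image_negligible[OF _ N2(1)]) (auto intro!: derivative_intros differentiable_on_minus)
  then have neg: "negligible (N1 \<union> uminus ` N2)" using N1(1) by (intro negligible_Un)
  have "(primitive g has_real_derivative g x) (at x)" if x: "x \<notin> N1 \<union> uminus ` N2" for x
    unfolding has_field_derivative_def has_derivative_within_alt
  proof (intro conjI allI impI bounded_linear_mult_right)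
    fix e :: real assume e: "e > 0"
    have x2: "- x \<notin> N2" using x by (metis UnCI image_eqI minus_minus)
    obtain d1 where d1: "d1 > 0" "\<And>h. 0 < h \<Longrightarrow> h < d1 \<Longrightarrow> \<bar>integral {x..x+h} g / h - g x\<bar> < e"
      using N1(2)[of x e] x e by (auto simp: divide_inverse_commute)
    obtain d2 where d2: "d2 > 0" "\<And>h. 0 < h \<Longrightarrow> h < d2 \<Longrightarrow> \<bar>integral {-x..-x+h} (\<lambda>x. g (- x)) / h - g x\<bar> < e"
      using N2(2)[OF x2 e] by (auto simp: divide_inverse_commute)
    show "\<exists>d>0. \<forall>y\<in>UNIV. norm (y - x) < d \<longrightarrow> norm (primitive g y - primitive g x - g x * (y - x)) \<le> e * norm (y - x)"
    proof (intro exI[of _ "min d1 d2"] conjI ballI impI)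
      fix y assume y: "norm (y - x) < min d1 d2"
      consider "y = x" | "x < y" | "y < x" by linarith
      then show "norm (primitive g y - primitive g x - g x * (y - x)) \<le> e * norm (y - x)"
      proof cases
        case 2
        then have "\<bar>integral {x..y} g / (y - x) - g x\<bar> < e" using d1(2)[of "y - x"] y by simp
        then have "\<bar>integral {x..y} g / (y - x) - g x\<bar> * (y - x) \<le> e * (y - x)"
          using 2 by (intro mult_right_mono) auto
        also have "\<bar>integral {x..y} g / (y - x) - g x\<bar> * (y - x) = \<bar>(integral {x..y} g / (y - x) - g x) * (y - x)\<bar>"
          using 2 by (simp add: abs_mult)
        also have "(integral {x..y} g / (y - x) - g x) * (y - x) = integral {x..y} g - g x * (y - x)"
          using 2 by (simp add: field_simps)
        finally show ?thesis using primitive_diff[OF g, of x y] 2 by simp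
      next
        case 3
        have r: "integral {-x..-y} (\<lambda>x. g (- x)) = integral {y..x} g"
          using Henstock_Kurzweil_Integration.integral_reflect[where f=g and a=y and b=x] by simp
        then have "\<bar>integral {y..x} g / (x - y) - g x\<bar> < e" using d2(2)[of "x - y"] y 3 by simp
        then have "\<bar>integral {y..x} g / (x - y) - g x\<bar> * (x - y) \<le> e * (x - y)"
          using 3 by (intro mult_right_mono) auto
        also have "\<bar>integral {y..x} g / (x - y) - g x\<bar> * (x - y) = \<bar>(integral {y..x} g / (x - y) - g x) * (x - y)\<bar>"
          using 3 by (simp add: abs_mult)
        also have "(integral {y..x} g / (x - y) - g x) * (x - y) = integral {y..x} g - g x * (x - y)"
          using 3 by (simp add: field_simps)
        also have "\<bar>\<dots>\<bar> = \<bar>primitive g y - primitive g x - g x * (y - x)\<bar>"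
          using primitive_diff[OF g, of y x] 3 by (simp add: algebra_simps abs_if)
        finally show ?thesis using 3 by simp
      qed simp
    qed (use d1 d2 in simp)
  qed
  with neg show thesis using that by blast
qed

lemma sum_integral_nonoverlapping_le:
  fixes k :: "real \<Rightarrow> real" and u v :: "nat \<Rightarrow> real"
  assumes uv: "\<forall>i<n. a \<le> u i \<and> u i \<le> v i \<and> v i \<le> b"
    and ends: "\<forall>i<n. \<forall>j<n. i \<noteq> j \<longrightarrow> v i \<le> u j \<or> v j \<le> u i"
    and k: "k integrable_on {a..b}" "\<And>x. 0 \<le> k x"
  shows "(\<Sum>i<n. integral {u i..v i} k) \<le> integral {a..b} k"
proof -
  have sub: "k integrable_on {u i..v i}" if "i < n" for i
    using uv that by (intro integrable_on_subinterval[OF k(1)]) auto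
  have H: "(k has_integral (\<Sum>i<n. integral {u i..v i} k)) (\<Union>i<n. {u i..v i})"
  proof (rule has_integral_UN)
    show "pairwise (\<lambda>i j. negligible ({u i..v i} \<inter> {u j..v j})) {..<n}"
      unfolding pairwise_def
    proof (intro ballI impI)
      fix i j assume ij: "i \<in> {..<n}" "j \<in> {..<n}" "i \<noteq> j"
      then have "{u i..v i} \<inter> {u j..v j} \<subseteq> {v i, v j}" using ends by force
      then show "negligible ({u i..v i} \<inter> {u j..v j})"
        by (rule negligible_subset[rotated]) simp
    qed
  qed (use sub in auto)
  have "{u i..v i} \<subseteq> {a..b}" if "i < n" for i
    using uv that by (simp add: atLeastatMost_subset_iff)
  then have "(\<Union>i<n. {u i..v i}) \<subseteq> {a..b}" by blast
  then show ?thesis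
    by (rule has_integral_subset_le[OF _ H integrable_integral[OF k(1)]]) (simp add: k(2))
qed

text \<open>Truncation: \<open>\<bar>g x\<bar>\<close> is at most \<open>n\<close> plus its excess
  over \<open>n\<close>. The bounded part is Lipschitz; the integral of the excess over
  \<open>{a..b}\<close> tends to 0 by dominated convergence, and it dominates the sum over any
  non-overlapping family of subintervals.\<close>

lemma abs_cont_primitive:
  assumes g: "loc_integrable g"
  shows "abs_cont (primitive g)"
  unfolding abs_cont_def abs_cont_on_def
proof (intro allI impI)
  fix a b \<epsilon> :: real assume "\<epsilon> > 0"
  have ai: "(\<lambda>x. \<bar>g x\<bar>) absolutely_integrable_on {a..b}" for a b
    using absolutely_integrable_norm[OF loc_integrable_absolutely_integrable[OF g]] by (simp add: o_def)
  define k where "k n x = max (\<bar>g x\<bar> - real n) 0" for n x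
  have kint: "k n integrable_on {a..b}" for n a b
  proof -
    have "(\<lambda>x. \<bar>g x\<bar> - real n) absolutely_integrable_on {a..b}"
      by (intro set_integral_diff ai) (auto intro: absolutely_integrable_continuous_real)
    then have "(\<lambda>x. max (\<bar>g x\<bar> - real n) 0) absolutely_integrable_on {a..b}"
      by (intro absolutely_integrable_max_1) (auto intro: absolutely_integrable_continuous_real)
    then show ?thesis unfolding k_def using absolutely_integrable_on_def by blast
  qed
  have "(\<lambda>n. integral {a..b} (k n)) \<longlonglongrightarrow> integral {a..b} (\<lambda>x. 0)"
  proof (rule dominated_convergence(2))
    show "(\<lambda>x. \<bar>g x\<bar>) integrable_on {a..b}" using ai absolutely_integrable_on_def by blast
    show "norm (k n x) \<le> \<bar>g x\<bar>" for n x by (simp add: k_def)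
    show "(\<lambda>n. k n x) \<longlonglongrightarrow> 0" for x
    proof (rule tendsto_eventually)
      obtain N :: nat where "\<bar>g x\<bar> \<le> real N" using real_arch_simple by blast
      then show "\<forall>\<^sub>F n in sequentially. k n x = 0"
        unfolding eventually_sequentially k_def by (intro exI[of _ N]) (auto simp: max_def)
    qed
  qed (rule kint)
  then have "(\<lambda>n. integral {a..b} (k n)) \<longlonglongrightarrow> 0" by simp
  then have "\<forall>\<^sub>F n in sequentially. dist (integral {a..b} (k n)) 0 < \<epsilon> / 2"
    by (rule tendstoD) (use \<open>\<epsilon> > 0\<close> in simp)
  then obtain n where n: "\<bar>integral {a..b} (k n)\<bar> < \<epsilon> / 2"
    by (auto simp: eventually_sequentially)
  define \<delta> where "\<delta> = \<epsilon> / (2 * (real n + 1))"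
  have inc: "\<bar>primitive g v - primitive g u\<bar> \<le> real n * (v - u) + integral {u..v} (k n)" if "u \<le> v" for u v
  proof -
    have "\<bar>primitive g v - primitive g u\<bar> = norm (integral {u..v} g)"
      using primitive_diff[OF g that] by simp
    also have "\<dots> \<le> integral {u..v} (\<lambda>x. real n + k n x)"
      by (intro integral_norm_bound_integral loc_integrable_integrable_on[OF g] integrable_add kint integrable_const_ivl)
        (auto simp: k_def)
    also have "\<dots> = real n * (v - u) + integral {u..v} (k n)"
      using that by (subst Henstock_Kurzweil_Integration.integral_add) (auto intro: kint)
    finally show ?thesis .
  qed
  show "\<exists>\<delta>>0. \<forall>(n::nat) (u::nat \<Rightarrow> real) (v::nat \<Rightarrow> real).
        (\<forall>i<n. a \<le> u i \<and> u i \<le> v i \<and> v i \<le> b) \<and>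
        (\<forall>i<n. \<forall>j<n. i \<noteq> j \<longrightarrow> v i \<le> u j \<or> v j \<le> u i) \<and>
        (\<Sum>i<n. v i - u i) < \<delta>
        \<longrightarrow> (\<Sum>i<n. \<bar>primitive g (v i) - primitive g (u i)\<bar>) < \<epsilon>"
  proof (intro exI[of _ \<delta>] conjI allI impI)
    show "\<delta> > 0" using \<open>\<epsilon> > 0\<close> by (simp add: \<delta>_def)
    fix m :: nat and u v :: "nat \<Rightarrow> real"
    assume *: "(\<forall>i<m. a \<le> u i \<and> u i \<le> v i \<and> v i \<le> b) \<and>
        (\<forall>i<m. \<forall>j<m. i \<noteq> j \<longrightarrow> v i \<le> u j \<or> v j \<le> u i) \<and>
        (\<Sum>i<m. v i - u i) < \<delta>"
    have "(\<Sum>i<m. \<bar>primitive g (v i) - primitive g (u i)\<bar>) \<le> (\<Sum>i<m. real n * (v i - u i) + integral {u i..v i} (k n))"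
      using * by (intro sum_mono inc) auto
    also have "\<dots> = real n * (\<Sum>i<m. v i - u i) + (\<Sum>i<m. integral {u i..v i} (k n))"
      by (simp add: sum.distrib sum_distrib_left)
    also have "(\<Sum>i<m. integral {u i..v i} (k n)) \<le> integral {a..b} (k n)"
      using * by (intro sum_integral_nonoverlapping_le kint) (auto simp: k_def)
    also have "real n * (\<Sum>i<m. v i - u i) \<le> real n * \<delta>"
      using * by (intro mult_left_mono) auto
    also have "real n * \<delta> \<le> \<epsilon> / 2" using \<open>\<epsilon> > 0\<close> by (simp add: \<delta>_def field_simps)
    finally show "(\<Sum>i<m. \<bar>primitive g (v i) - primitive g (u i)\<bar>) < \<epsilon>" using n by simp
  qed
qed

lemma loc_integrable_mult_continuous:
  assumes f: "loc_integrable f" and h: "continuous_on UNIV h"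
  shows "loc_integrable (\<lambda>x. f x * h x)"
  unfolding loc_integrable_def set_integrable_def
proof (intro allI)
  fix a b :: real
  have "bounded (h ` {a..b})"
    by (intro compact_imp_bounded compact_continuous_image continuous_on_subset[OF h]) auto
  then obtain M where M: "\<And>x. x \<in> {a..b} \<Longrightarrow> \<bar>h x\<bar> \<le> M"
    unfolding bounded_iff by (metis imageI real_norm_def)
  have i: "integrable lborel (\<lambda>x. indicator {a..b} x *\<^sub>R f x)"
    using f by (simp add: loc_integrable_def set_integrable_def)
  have hm: "h \<in> borel_measurable lborel" using h by (simp add: borel_measurable_continuous_onI)
  have "(\<lambda>x. (indicator {a..b} x *\<^sub>R f x) * h x) \<in> borel_measurable lborel"
    by (intro borel_measurable_times borel_measurable_integrable[OF i] hm)
  moreover have "norm ((indicator {a..b} x *\<^sub>R f x) * h x) \<le> norm (M *\<^sub>R (indicator {a..b} x *\<^sub>R f x))" for x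
  proof (cases "x \<in> {a..b}")
    case True
    have "\<bar>f x\<bar> * \<bar>h x\<bar> \<le> \<bar>f x\<bar> * \<bar>M\<bar>" using M[OF True] by (intro mult_left_mono) auto
    then show ?thesis using True by (simp add: abs_mult mult.commute)
  qed simp
  ultimately have "integrable lborel (\<lambda>x. (indicator {a..b} x *\<^sub>R f x) * h x)"
    by (intro Bochner_Integration.integrable_bound[OF integrable_scaleR_right[OF i, of M]]) auto
  then show "integrable lborel (\<lambda>x. indicator {a..b} x *\<^sub>R (f x * h x))" by (simp add: mult.assoc)
qed

lemma one_loc_integrable: "loc_integrable (\<lambda>x. 1)"
  by (auto simp: loc_integrable_def intro!: borel_integrable_atLeastAtMost' continuous_intros)

text \<open>For finite exponents \<open>r \<ge> 1\<close> the reason is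
  \<open>\<bar>f x\<bar> \<le> 1 + \<bar>f x\<bar> powr r\<close>, with the constant 1 integrable on
  bounded intervals.\<close>

lemma in_Lp_loc_integrable:
  assumes f: "in_Lp p f" and p: "1 \<le> p"
  shows "loc_integrable f"
proof (cases "p = \<infinity>")
  case True
  then show ?thesis using f by (auto simp: in_Lp_def loc_integrable_def intro!: borel_integrable_atLeastAtMost' continuous_on_subset[of UNIV])
next
  case False
  define r where "r = real_of_ereal p"
  have r: "r \<ge> 1" using p False by (cases p) (auto simp: r_def)
  have m: "f \<in> borel_measurable lborel" and i: "integrable lborel (\<lambda>x. \<bar>f x\<bar> powr r)"
    using f False by (auto simp: in_Lp_def r_def)
  have le: "\<bar>f x\<bar> \<le> 1 + \<bar>f x\<bar> powr r" for x
  proof (cases "\<bar>f x\<bar> \<le> 1")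
    case False
    then have "\<bar>f x\<bar> powr 1 \<le> \<bar>f x\<bar> powr r" using r by (intro powr_mono) auto
    then show ?thesis using False by simp
  qed (simp add: add_increasing2)
  show ?thesis unfolding loc_integrable_def set_integrable_def
  proof (intro allI)
    fix a b :: real
    have "integrable lborel (\<lambda>x. indicator {a..b} x *\<^sub>R (1::real))"
      using borel_integrable_atLeastAtMost'[of a b "\<lambda>x. 1::real"] by (simp add: set_integrable_def)
    then have "integrable lborel (\<lambda>x. indicator {a..b} x *\<^sub>R (1::real) + \<bar>f x\<bar> powr r)" using i by (rule Bochner_Integration.integrable_add)
    then show "integrable lborel (\<lambda>x. indicator {a..b} x *\<^sub>R f x)"
    proof (rule Bochner_Integration.integrable_bound)
      show "(\<lambda>x. indicat_real {a..b} x *\<^sub>R f x) \<in> borel_measurable lborel" using m by measurable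
      show "AE x in lborel. norm (indicat_real {a..b} x *\<^sub>R f x) \<le> norm (indicat_real {a..b} x *\<^sub>R 1 + \<bar>f x\<bar> powr r)"
        using le by (intro AE_I2) (simp add: indicator_def)
    qed
  qed
qed

lemma AE_lborel_if_negligible:
  assumes "negligible N" "\<And>x. x \<notin> N \<Longrightarrow> P x"
  shows "AE x in lborel. P x"
proof -
  have "AE x in lebesgue. P x"
    using assms by (intro AE_I'[of N]) (auto simp: negligible_iff_null_sets)
  then show ?thesis by (simp add: AE_completion_iff)
qed

lemma AE_lborel_obtain_negligible:
  assumes "AE x in lborel. P x"
  obtains N where "negligible N" "\<And>x. x \<notin> N \<Longrightarrow> P x"
proof -
  obtain N where N: "{x \<in> space lborel. \<not> P x} \<subseteq> N" "emeasure lborel N = 0" "N \<in> sets lborel"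
    by (rule AE_E[OF assms])
  then have "N \<in> null_sets lebesgue" by (intro null_sets_completionI) auto
  then have "negligible N" by (simp add: negligible_iff_null_sets)
  moreover have "P x" if "x \<notin> N" for x using N(1) that by auto
  ultimately show thesis by (rule that)
qed

subsection \<open>The equation with a dissipative coefficient\<close>

locale dissipative =
  fixes q :: "real \<Rightarrow> real" and a c :: real
  assumes q_nonneg: "\<And>x. 0 \<le> q x" and q_loc: "loc_integrable q" and a_pos: "0 < a" and c_pos: "0 < c"
    and q_mass: "\<And>x. c \<le> integral {x - a..x + a} q"
begin

abbreviation "Q \<equiv> primitive q"

lemma Q_abs_cont: "abs_cont Q" by (rule abs_cont_primitive[OF q_loc])

lemma Q_continuous: "continuous_on S Q"
  using continuous_on_subset[OF abs_cont_imp_continuous[OF Q_abs_cont]] by blast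

lemma Q_mono: "x \<le> y \<Longrightarrow> Q x \<le> Q y"
  using primitive_diff[OF q_loc, of x y] integral_nonneg[OF loc_integrable_integrable_on[OF q_loc], of x y] q_nonneg
  by simp

lemma Q_period: "Q x + c \<le> Q (x + 2 * a)"
  using q_mass[of "x + a"] primitive_diff[OF q_loc, of x "x + 2 * a"] a_pos by (simp add: algebra_simps)

definition "rate = c / (2 * a)"

lemma rate_pos: "rate > 0" using a_pos c_pos by (simp add: rate_def)

text \<open>Each full window of length \<open>2 * a\<close> adds at least \<open>c\<close> to
  \<open>Q\<close>. An incomplete last window costs at most one further \<open>c\<close>, hence the
  subtracted constant.\<close>

lemma Q_growth:
  assumes "x \<le> t"
  shows "rate * (t - x) - c \<le> Q t - Q x"
proof -
  have ind: "Q x + real n * c \<le> Q (x + real n * (2 * a))" for n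
  proof (induction n)
    case (Suc n)
    have "Q x + real (Suc n) * c = (Q x + real n * c) + c" by (simp add: algebra_simps)
    also have "\<dots> \<le> Q (x + real n * (2 * a)) + c" using Suc by simp
    also have "\<dots> \<le> Q (x + real n * (2 * a) + 2 * a)" by (rule Q_period)
    also have "x + real n * (2 * a) + 2 * a = x + real (Suc n) * (2 * a)" by (simp add: algebra_simps)
    finally show ?case .
  qed simp
  define n where "n = nat \<lfloor>(t - x) / (2 * a)\<rfloor>"
  have "(t - x) / (2 * a) \<ge> 0" using assms a_pos by simp
  then have n: "real n \<le> (t - x) / (2 * a)" "(t - x) / (2 * a) < real n + 1"
    unfolding n_def by linarith+
  have "x + real n * (2 * a) \<le> t" using n(1) a_pos by (simp add: field_simps)
  then have "Q (x + real n * (2 * a)) \<le> Q t" by (rule Q_mono)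
  then have "real n * c \<le> Q t - Q x" using ind[of n] by simp
  moreover have "rate * (t - x) \<le> (real n + 1) * c"
  proof -
    have "rate * (t - x) = ((t - x) / (2 * a)) * c" by (simp add: rate_def)
    also have "\<dots> \<le> (real n + 1) * c" using n(2) c_pos by (intro mult_right_mono) auto
    finally show ?thesis .
  qed
  ultimately show ?thesis by (simp add: algebra_simps)
qed

section \<open>The kernel and its integrals over half-lines\<close>

lemma exp_Q_bound:
  assumes "r > 0" "x \<le> t"
  shows "exp (- r * Q t) \<le> exp (r * (c - Q x + rate * x)) * exp (- (r * rate) * t)"
proof -
  have "r * (rate * (t - x) - c) \<le> r * (Q t - Q x)" using Q_growth[OF assms(2)] assms(1) by simp
  then show ?thesis by (simp add: algebra_simps flip: exp_add)
qed

text \<open>The integrand is not normalised by \<open>Q x\<close>, so that moving the base point is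
  plain additivity of the integral.\<close>

definition "tail r x = integral {x..} (\<lambda>t. exp (- r * Q t))"

lemma tail_integrable: "r > 0 \<Longrightarrow> (\<lambda>t. exp (- r * Q t)) integrable_on {x..}"
proof (rule measurable_bounded_by_integrable_imp_integrable)
  assume r: "r > 0"
  show "(\<lambda>t. exp (- r * Q t)) \<in> borel_measurable (lebesgue_on {x..})"
    by (intro continuous_imp_measurable_on_sets_lebesgue continuous_intros Q_continuous) auto
  show "(\<lambda>t. exp (r * (c - Q x + rate * x)) * exp (- (r * rate) * t)) integrable_on {x..}"
    using integrable_on_exp_minus_to_infinity[of "r * rate" x] r rate_pos by (intro integrable_on_mult_right) auto
  show "norm (exp (- r * Q t)) \<le> exp (r * (c - Q x + rate * x)) * exp (- (r * rate) * t)" if "t \<in> {x..}" for t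
    using exp_Q_bound[OF r, of x t] that by simp
qed auto

lemma tail_split:
  assumes "r > 0" "x \<le> y"
  shows "tail r x = integral {x..y} (\<lambda>t. exp (- r * Q t)) + tail r y"
proof -
  have "((\<lambda>t. exp (- r * Q t)) has_integral (integral {x..y} (\<lambda>t. exp (- r * Q t)) + tail r y)) ({x..y} \<union> {y..})"
  proof (rule has_integral_Un)
    show "((\<lambda>t. exp (- r * Q t)) has_integral integral {x..y} (\<lambda>t. exp (- r * Q t))) {x..y}"
      by (intro integrable_integral integrable_continuous_interval continuous_intros Q_continuous)
    show "((\<lambda>t. exp (- r * Q t)) has_integral tail r y) {y..}"
      unfolding tail_def by (intro integrable_integral tail_integrable assms)
    have "{x..y} \<inter> {y..} \<subseteq> {y}" by auto
    then show "negligible ({x..y} \<inter> {y..})" by (rule negligible_subset[rotated]) simp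
  qed
  moreover have "{x..y} \<union> {y..} = {x..}" using assms by auto
  ultimately show ?thesis unfolding tail_def by (metis integral_unique)
qed

text \<open>For \<open>r \<ge> 1\<close> this is the \<open>r\<close>-th power of the
  \<open>L_r\<close> norm of the kernel \<open>exp (- (Q t - Q x))\<close> over
  \<open>{x..}\<close>.\<close>

definition "J r x = exp (r * Q x) * tail r x"

text \<open>This recursion drives the iteration that bounds \<open>J r\<close> by a multiple of
  \<open>w\<close>, and it measures what is lost when the kernel is cut off at
  \<open>y\<close>.\<close>

lemma J_split:
  assumes "r > 0" "x \<le> y"
  shows "J r x = integral {x..y} (\<lambda>t. exp (- r * (Q t - Q x))) + exp (- r * (Q y - Q x)) * J r y"
proof -
  have "integral {x..y} (\<lambda>t. exp (- r * (Q t - Q x))) = integral {x..y} (\<lambda>t. exp (r * Q x) * exp (- r * Q t))"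
    by (intro arg_cong2[where f=integral] refl ext) (simp add: algebra_simps flip: exp_add)
  also have "\<dots> = exp (r * Q x) * integral {x..y} (\<lambda>t. exp (- r * Q t))" by simp
  finally have 1: "integral {x..y} (\<lambda>t. exp (- r * (Q t - Q x))) = exp (r * Q x) * integral {x..y} (\<lambda>t. exp (- r * Q t))" .
  have 2: "exp (- r * (Q y - Q x)) * J r y = exp (r * Q x) * tail r y"
    unfolding J_def mult.assoc[symmetric] exp_add[symmetric] by (simp add: algebra_simps)
  show ?thesis unfolding 1 2 by (simp add: J_def tail_split[OF assms] distrib_left)
qed

lemma tail_nonneg: "0 \<le> tail r x"
  unfolding tail_def
  \<comment> \<open>Here \<open>r\<close> is unrestricted; where the integral does not exist, it has
    the default value 0.\<close>
  by (cases "(\<lambda>t. exp (- r * Q t)) integrable_on {x..}")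
    (auto intro!: Henstock_Kurzweil_Integration.integral_nonneg simp: not_integrable_integral)

lemma J_nonneg: "0 \<le> J r x" by (simp add: J_def tail_nonneg)

lemma J_ge_integral:
  assumes "r > 0" "x \<le> y"
  shows "integral {x..y} (\<lambda>t. exp (- r * (Q t - Q x))) \<le> J r x"
  using J_split[OF assms] J_nonneg[of r y] by simp

text \<open>The growth rate of \<open>Q\<close> is uniform, so the bound does not depend on
  \<open>x\<close>. It makes \<open>J 1\<close> a bounded solution and starts the iteration against
  \<open>w\<close>.\<close>

lemma J_bound:
  assumes "r > 0"
  shows "J r x \<le> exp (r * c) / (r * rate)"
proof -
  have rr: "r * rate > 0" using assms rate_pos by simp
  have "tail r x \<le> integral {x..} (\<lambda>t. exp (r * (c - Q x + rate * x)) * exp (- (r * rate) * t))"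
    unfolding tail_def using exp_Q_bound[OF assms] integrable_on_exp_minus_to_infinity[OF rr]
    by (intro integral_le tail_integrable assms integrable_on_mult_right) auto
  also have "\<dots> = exp (r * (c - Q x + rate * x)) * (exp (- (r * rate) * x) / (r * rate))"
    using has_integral_exp_minus_to_infinity[OF rr, of x] by (simp add: integral_unique)
  finally have "J r x \<le> exp (r * Q x) * (exp (r * (c - Q x + rate * x)) * (exp (- (r * rate) * x) / (r * rate)))"
    unfolding J_def by (intro mult_left_mono) auto
  also have "\<dots> = (exp (r * Q x) * exp (r * (c - Q x + rate * x)) * exp (- (r * rate) * x)) / (r * rate)" by simp
  also have "exp (r * Q x) * exp (r * (c - Q x + rate * x)) * exp (- (r * rate) * x) = exp (r * c)"
    unfolding exp_add[symmetric] by (simp add: algebra_simps)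
  finally show ?thesis .
qed

lemma J_pos:
  assumes "r > 0"
  shows "0 < J r x"
proof -
  have "exp (- r * (Q (x + 1) - Q x)) = integral {x..x+1} (\<lambda>t. exp (- r * (Q (x + 1) - Q x)))" by simp
  also have "\<dots> \<le> integral {x..x+1} (\<lambda>t. exp (- r * (Q t - Q x)))"
    using assms Q_mono by (intro integral_le integrable_continuous_interval continuous_intros Q_continuous) auto
  also have "\<dots> \<le> J r x" by (rule J_ge_integral[OF assms]) simp
  finally show ?thesis using exp_gt_zero less_le_trans by blast
qed

section \<open>Solutions by variation of constants\<close>

lemma exp_Q_abs_cont: "abs_cont (\<lambda>x. exp (\<sigma> * Q x))"
  unfolding abs_cont_def
proof (intro allI)
  fix u v
  have "bounded (Q ` {u..v})"
    by (intro compact_imp_bounded compact_continuous_image Q_continuous) auto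
  then obtain M where M: "\<And>x. x \<in> {u..v} \<Longrightarrow> \<bar>Q x\<bar> \<le> M"
    unfolding bounded_iff by (metis imageI real_norm_def)
  show "abs_cont_on u v (\<lambda>x. exp (\<sigma> * Q x))"
  proof (rule abs_cont_on_lipschitz_comp[where f=Q and L="exp (\<bar>\<sigma>\<bar> * M) * \<bar>\<sigma>\<bar>"])
    show "abs_cont_on u v Q" using Q_abs_cont by (simp add: abs_cont_def)
    fix x y assume xy: "x \<in> {u..v}" "y \<in> {u..v}"
    have "norm (exp (\<sigma> * Q y) - exp (\<sigma> * Q x)) \<le> (exp (\<bar>\<sigma>\<bar> * M) * \<bar>\<sigma>\<bar>) * norm (Q y - Q x)"
    proof (rule field_differentiable_bound[of "{-M..M}" "\<lambda>z. exp (\<sigma> * z)" "\<lambda>z. exp (\<sigma> * z) * \<sigma>"])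
      show "norm (exp (\<sigma> * z) * \<sigma>) \<le> exp (\<bar>\<sigma>\<bar> * M) * \<bar>\<sigma>\<bar>" if "z \<in> {-M..M}" for z
      proof -
        have "\<sigma> * z \<le> \<bar>\<sigma>\<bar> * M"
          using that by (metis abs_ge_self abs_le_iff abs_mult abs_of_nonneg atLeastAtMost_iff minus_le_iff mult_left_mono order_trans abs_ge_zero)
        then show ?thesis by (simp add: abs_mult mult_right_mono)
      qed
    qed (use M[OF xy(1)] M[OF xy(2)] in \<open>auto intro!: derivative_eq_intros\<close>)
    then show "\<bar>exp (\<sigma> * Q y) - exp (\<sigma> * Q x)\<bar> \<le> exp (\<bar>\<sigma>\<bar> * M) * \<bar>\<sigma>\<bar> * \<bar>Q y - Q x\<bar>" by simp
  qed
qed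

text \<open>The constant \<open>C\<close> is left free for two uses: \<open>tail 1 0\<close>
  produces \<open>J 1\<close>, and the value of the primitive at the right end of the support
  produces the solutions with compactly supported right-hand side.\<close>

lemma solution_abs_cont:
  assumes f: "loc_integrable f"
  shows "abs_cont (\<lambda>x. exp (Q x) * (C - primitive (\<lambda>t. f t * exp (- Q t)) x))"
proof -
  have "loc_integrable (\<lambda>t. f t * exp (- Q t))"
    by (intro loc_integrable_mult_continuous f continuous_intros Q_continuous)
  then have P: "abs_cont (primitive (\<lambda>t. f t * exp (- Q t)))" by (rule abs_cont_primitive)
  have "abs_cont (\<lambda>x. C - primitive (\<lambda>t. f t * exp (- Q t)) x)"
    unfolding abs_cont_def
  proof (intro allI)
    fix u v
    show "abs_cont_on u v (\<lambda>x. C - primitive (\<lambda>t. f t * exp (- Q t)) x)"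
      by (rule abs_cont_on_lipschitz_comp[where f="primitive (\<lambda>t. f t * exp (- Q t))" and L=1])
        (use P in \<open>simp_all add: abs_cont_def abs_minus_commute\<close>)
  qed
  then show ?thesis using abs_cont_mult[OF exp_Q_abs_cont[of 1]] by simp
qed

lemma solution_ae:
  fixes C :: real
  assumes f: "loc_integrable f"
  defines "y \<equiv> \<lambda>x. exp (Q x) * (C - primitive (\<lambda>t. f t * exp (- Q t)) x)"
  shows "AE x in lborel. (y has_real_derivative (q x * y x - f x)) (at x)"
proof -
  have "loc_integrable (\<lambda>t. f t * exp (- Q t))"
    by (intro loc_integrable_mult_continuous f continuous_intros Q_continuous)
  then obtain N1 where N1: "negligible N1" "\<And>x. x \<notin> N1 \<Longrightarrow>
      (primitive (\<lambda>t. f t * exp (- Q t)) has_real_derivative f x * exp (- Q x)) (at x)"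
    using primitive_ae_derivative by blast
  obtain N2 where N2: "negligible N2" "\<And>x. x \<notin> N2 \<Longrightarrow> (Q has_real_derivative q x) (at x)"
    using primitive_ae_derivative[OF q_loc] by blast
  show ?thesis
  proof (rule AE_lborel_if_negligible[of "N1 \<union> N2"])
    show "negligible (N1 \<union> N2)" using N1 N2 by (intro negligible_Un)
    fix x assume x: "x \<notin> N1 \<union> N2"
    have "(y has_real_derivative (exp (Q x) * q x * (C - primitive (\<lambda>t. f t * exp (- Q t)) x) + exp (Q x) * (0 - f x * exp (- Q x)))) (at x)"
      unfolding y_def using x by (auto intro!: derivative_eq_intros N1(2) N2(2))
    moreover have "exp (Q x) * exp (- Q x) = 1" by (simp flip: exp_add)
    ultimately show "(y has_real_derivative (q x * y x - f x)) (at x)"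
      by (simp add: y_def algebra_simps)
  qed
qed

text \<open>The integrating factor \<open>exp (- Q t)\<close> turns the equation into
  \<open>(y * exp (- Q))' = - f * exp (- Q)\<close> almost everywhere. The boundary term at
  \<open>T\<close> is kept, since its decay depends on how \<open>y\<close> behaves far out.\<close>

lemma solution_representation:
  assumes y: "abs_cont y" and ode: "AE x in lborel. (y has_real_derivative (q x * y x - f x)) (at x)" and "x \<le> T"
  shows "((\<lambda>t. exp (- (Q t - Q x)) * f t) has_integral (y x - exp (- (Q T - Q x)) * y T)) {x..T}"
proof -
  obtain N1 where N1: "negligible N1" "\<And>x. x \<notin> N1 \<Longrightarrow> (y has_real_derivative (q x * y x - f x)) (at x)"
    using AE_lborel_obtain_negligible[OF ode] by blast
  obtain N2 where N2: "negligible N2" "\<And>x. x \<notin> N2 \<Longrightarrow> (Q has_real_derivative q x) (at x)"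
    using primitive_ae_derivative[OF q_loc] by blast
  define z where "z = (\<lambda>t. y t * exp (-1 * Q t))"
  have z: "abs_cont z" unfolding z_def by (intro abs_cont_mult y exp_Q_abs_cont)
  have "((\<lambda>t. - (exp (- Q t) * f t)) has_integral (z T - z x)) {x..T}"
  proof (rule abs_cont_on_FTC[of x T z "N1 \<union> N2"])
    show "abs_cont_on x T z" using z by (simp add: abs_cont_def)
    show "negligible (N1 \<union> N2)" using N1 N2 by (intro negligible_Un)
    fix t assume t: "t \<in> {x..T} - (N1 \<union> N2)"
    have "(z has_real_derivative ((q t * y t - f t) * exp (- Q t) + y t * (- (exp (- Q t) * q t)))) (at t)"
      unfolding z_def using t by (auto intro!: derivative_eq_intros N1(2) N2(2))
    then show "(z has_real_derivative - (exp (- Q t) * f t)) (at t)" by (simp add: algebra_simps)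
  qed fact
  then have "((\<lambda>t. - exp (Q x) * - (exp (- Q t) * f t)) has_integral (- exp (Q x) * (z T - z x))) {x..T}"
    by (rule has_integral_mult_right)
  moreover have "(\<lambda>t. - exp (Q x) * - (exp (- Q t) * f t)) = (\<lambda>t. exp (- (Q t - Q x)) * f t)"
    by (rule ext) (simp add: exp_diff exp_minus field_simps)
  moreover have "- exp (Q x) * (z T - z x) = y x - exp (- (Q T - Q x)) * y T"
  proof -
    have "exp (Q x) * exp (- Q x) = 1" by (simp flip: exp_add)
    moreover have "exp (Q x) * exp (- Q T) = exp (- (Q T - Q x))" by (simp flip: exp_add)
    ultimately show ?thesis by (simp add: z_def algebra_simps)
  qed
  ultimately show ?thesis by (simp only:)
qed

end

section \<open>Integrals over the line and values of \<open>L_p\<close> functions far out\<close>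

lemma integral_le_lborel:
  fixes g :: "real \<Rightarrow> real"
  assumes g: "integrable lborel g" "\<And>x. 0 \<le> g x"
  shows "g integrable_on {x..T}" "integral {x..T} g \<le> (LINT x|lborel. g x)"
proof -
  have U: "g integrable_on UNIV" by (rule integrable_on_lborel[OF g(1)])
  show I: "g integrable_on {x..T}" using integrable_on_subcbox[OF U, of x T] by simp
  have "integral {x..T} g \<le> integral UNIV g"
    by (rule integral_subset_le[OF _ I U]) (simp_all add: g(2))
  then show "integral {x..T} g \<le> (LINT x|lborel. g x)" using integral_lborel[OF g(1)] by simp
qed

lemma integrable_exp_neg_abs:
  fixes k x :: real
  assumes k: "k > 0"
  shows "integrable lborel (\<lambda>u. exp (- k * \<bar>u - x\<bar>))"
proof -
  define h where "h u = indicator {0..} u *\<^sub>R exp (- k * u)" for u :: real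
  have hm: "h \<in> borel_measurable lborel" unfolding h_def by measurable
  have "(\<lambda>u. exp (- k * u)) absolutely_integrable_on {0..}"
    by (intro nonnegative_absolutely_integrable_1 integrable_on_exp_minus_to_infinity k) auto
  then have "integrable lebesgue h" unfolding h_def set_integrable_def .
  then have h: "integrable lborel h" using integrable_completion[OF hm] by simp
  have h1: "integrable lborel (\<lambda>u. h (- x + 1 * u))" by (rule lborel_integrable_real_affine[OF h]) simp
  have h2: "integrable lborel (\<lambda>u. h (x + (-1) * u))" by (rule lborel_integrable_real_affine[OF h]) simp
  show ?thesis
  proof (rule Bochner_Integration.integrable_bound[OF Bochner_Integration.integrable_add[OF h1 h2]])
    show "AE u in lborel. norm (exp (- k * \<bar>u - x\<bar>)) \<le> norm (h (- x + 1 * u) + h (x + - 1 * u))"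
      by (intro AE_I2) (auto simp: h_def indicator_def abs_if)
  qed measurable
qed

text \<open>A function in \<open>L_p\<close> need not tend to 0, but it returns below a fixed level
  arbitrarily far out; for finite \<open>p\<close> the level 1 works, as otherwise the integral of
  the \<open>p\<close>-th power would exceed every length. Together with the decay of the kernel
  this excludes the growing homogeneous solution.\<close>

lemma in_Lp_bounded_frequently:
  assumes y: "in_Lp p y" and p: "1 \<le> p"
  obtains K where "\<forall>N. \<exists>T\<ge>N. \<bar>y T\<bar> \<le> K"
proof (cases "p = \<infinity>")
  case True
  then obtain K where "\<And>x. \<bar>y x\<bar> \<le> K" using y by (auto simp: in_Lp_def bounded_iff)
  then show thesis by (intro that[of K]) blast
next
  case False
  define r where "r = real_of_ereal p"
  have r: "r \<ge> 1" using p False by (cases p) (auto simp: r_def)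
  have i: "integrable lborel (\<lambda>x. \<bar>y x\<bar> powr r)" using y False by (auto simp: in_Lp_def r_def)
  have "\<exists>T\<ge>N. \<bar>y T\<bar> \<le> 1" for N
  proof (rule ccontr)
    assume "\<not> ?thesis"
    then have big: "1 < \<bar>y T\<bar>" if "T \<ge> N" for T using that by force
    obtain k :: nat where k: "(LINT x|lborel. \<bar>y x\<bar> powr r) < real k" using reals_Archimedean2 by blast
    have "real k = integral {N..N + real k} (\<lambda>t. 1::real)" by simp
    also have "\<dots> \<le> integral {N..N + real k} (\<lambda>x. \<bar>y x\<bar> powr r)"
    proof (rule integral_le)
      show "(\<lambda>x. \<bar>y x\<bar> powr r) integrable_on {N..N + real k}"
        by (rule integral_le_lborel(1)[OF i]) simp
      show "1 \<le> \<bar>y x\<bar> powr r" if "x \<in> {N..N + real k}" for x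
        using big[of x] that r by (intro ge_one_powr_ge_zero) auto
    qed auto
    also have "\<dots> \<le> (LINT x|lborel. \<bar>y x\<bar> powr r)"
      by (rule integral_le_lborel(2)[OF i]) simp
    finally show False using k by simp
  qed
  then show thesis by (intro that[of 1]) blast
qed

context dissipative
begin

lemma solution_bound:
  assumes y: "abs_cont y" and ode: "AE x in lborel. (y has_real_derivative (q x * y x - f x)) (at x)"
    and freq: "\<forall>N. \<exists>T\<ge>N. \<bar>y T\<bar> \<le> K"
    and B: "\<And>T. x \<le> T \<Longrightarrow> \<bar>integral {x..T} (\<lambda>t. exp (- (Q t - Q x)) * f t)\<bar> \<le> B"
  shows "\<bar>y x\<bar> \<le> B"
proof (rule field_le_epsilon)
  fix \<epsilon> :: real assume \<epsilon>: "\<epsilon> > 0"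
  define M where "M = exp c * \<bar>K\<bar>"
  \<comment> \<open>The threshold makes \<open>z \<ge> M / \<epsilon>\<close>, and
    \<open>exp (- z) \<le> 1 / (1 + z)\<close> then brings the boundary term below
    \<open>\<epsilon>\<close>.\<close>
  obtain T where T: "T \<ge> max x (x + M / (\<epsilon> * rate))" "\<bar>y T\<bar> \<le> K" using freq by blast
  define z where "z = rate * (T - x)"
  have xT: "x \<le> T" using T by simp
  have "M / (\<epsilon> * rate) \<le> T - x" using T by simp
  then have z: "M \<le> z * \<epsilon>" using \<epsilon> rate_pos by (simp add: z_def field_simps)
  have z0: "z \<ge> 0" using xT rate_pos by (simp add: z_def)
  have "exp (- (Q T - Q x)) \<le> exp (c - z)" using Q_growth[OF xT] by (simp add: z_def)
  then have "exp (- (Q T - Q x)) * \<bar>y T\<bar> \<le> exp (c - z) * \<bar>K\<bar>" using T(2) by (intro mult_mono) auto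
  also have "\<dots> = M * exp (- z)" by (simp add: M_def exp_diff exp_minus field_simps)
  also have "\<dots> \<le> M * (1 / (1 + z))"
  proof (rule mult_left_mono)
    have "1 + z \<le> exp z" by (rule exp_ge_add_one_self)
    then show "exp (- z) \<le> 1 / (1 + z)" using z0 by (simp add: exp_minus field_simps)
  qed (simp add: M_def)
  also have "\<dots> \<le> \<epsilon>" using z z0 \<epsilon> by (simp add: field_simps)
  finally have small: "exp (- (Q T - Q x)) * \<bar>y T\<bar> \<le> \<epsilon>" .
  have "integral {x..T} (\<lambda>t. exp (- (Q t - Q x)) * f t) = y x - exp (- (Q T - Q x)) * y T"
    by (rule integral_unique[OF solution_representation[OF y ode xT]])
  then have "\<bar>y x - exp (- (Q T - Q x)) * y T\<bar> \<le> B" using B[OF xT] by simp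
  moreover have "\<bar>exp (- (Q T - Q x)) * y T\<bar> \<le> \<epsilon>" using small by (simp add: abs_mult)
  ultimately show "\<bar>y x\<bar> \<le> B + \<epsilon>" by linarith
qed

lemma kernel_integrable: "loc_integrable f \<Longrightarrow> (\<lambda>t. exp (- (Q t - Q x)) * f t) integrable_on {u..v}"
proof -
  assume f: "loc_integrable f"
  have "loc_integrable (\<lambda>t. f t * exp (- (Q t - Q x)))"
    by (intro loc_integrable_mult_continuous f continuous_intros Q_continuous)
  then show ?thesis using loc_integrable_integrable_on by (simp add: mult.commute)
qed

lemma exp_kernel_le_one: "x \<le> t \<Longrightarrow> exp (- (Q t - Q x)) \<le> 1"
  using Q_mono[of x t] by simp

text \<open>All upper bounds reduce to integrals over \<open>{x..T}\<close>, estimated uniformly in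
  \<open>T\<close>; improper integrals of \<open>f\<close> never arise.\<close>

lemma D_pointwise_bound:
  assumes "y \<in> D p q" "1 \<le> p"
    and B: "\<And>f T. in_Lp p f \<Longrightarrow> Lp_norm p f = 1 \<Longrightarrow> loc_integrable f \<Longrightarrow> x \<le> T \<Longrightarrow>
      \<bar>integral {x..T} (\<lambda>t. exp (- (Q t - Q x)) * f t)\<bar> \<le> B"
  shows "\<bar>y x\<bar> \<le> B"
proof -
  have yp: "in_Lp p y" and y: "abs_cont y" and ex: "\<exists>f. in_Lp p f \<and> Lp_norm p f = 1 \<and>
      (AE x in lborel. (y has_real_derivative (q x * y x - f x)) (at x))"
    using assms(1) by (simp_all add: D_def)
  obtain f where f: "in_Lp p f" "Lp_norm p f = 1" and ode: "AE x in lborel. (y has_real_derivative (q x * y x - f x)) (at x)"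
    using ex by auto
  obtain K where K: "\<forall>N. \<exists>T\<ge>N. \<bar>y T\<bar> \<le> K" by (rule in_Lp_bounded_frequently[OF yp assms(2)])
  show ?thesis
    by (rule solution_bound[OF y ode K]) (rule B[OF f in_Lp_loc_integrable[OF f(1) assms(2)]])
qed

section \<open>Upper bounds by duality\<close>

lemma D_infty_upper:
  assumes y: "y \<in> D \<infinity> q"
  shows "\<bar>y x\<bar> \<le> J 1 x"
proof (rule D_pointwise_bound[OF y])
  fix f T assume f: "in_Lp \<infinity> f" "Lp_norm \<infinity> f = 1" "loc_integrable f" and xT: "x \<le> T"
  have bdd: "bdd_above (range (\<lambda>x. \<bar>f x\<bar>))"
    using f(1) by (auto simp: in_Lp_def bounded_iff bdd_above_def)
  have f1: "\<bar>f t\<bar> \<le> 1" for t using cSUP_upper[OF UNIV_I bdd, of t] f(2) by (simp add: Lp_norm_def)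
  have "norm (integral {x..T} (\<lambda>t. exp (- (Q t - Q x)) * f t)) \<le> integral {x..T} (\<lambda>t. exp (- 1 * (Q t - Q x)))"
  proof (rule integral_norm_bound_integral)
    show "norm (exp (- (Q t - Q x)) * f t) \<le> exp (- 1 * (Q t - Q x))" for t
      using mult_left_mono[OF f1[of t], of "exp (- (Q t - Q x))"] by (simp add: abs_mult)
  qed (intro kernel_integrable f integrable_continuous_interval continuous_intros Q_continuous)+
  also have "\<dots> \<le> J 1 x" using J_ge_integral[OF zero_less_one xT] by simp
  finally show "\<bar>integral {x..T} (\<lambda>t. exp (- (Q t - Q x)) * f t)\<bar> \<le> J 1 x" by simp
qed simp

lemma Lp_norm_one:
  assumes "Lp_norm (ereal p) f = 1" "p > 0"
  shows "(LINT x|lborel. \<bar>f x\<bar> powr p) = 1"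
proof -
  have "(LINT x|lborel. \<bar>f x\<bar> powr p) \<ge> 0" by (intro Bochner_Integration.integral_nonneg) auto
  then have "((LINT x|lborel. \<bar>f x\<bar> powr p) powr (1 / p)) powr p = (LINT x|lborel. \<bar>f x\<bar> powr p)"
    using assms(2) by (simp add: powr_powr)
  then show ?thesis using assms(1) by (simp add: Lp_norm_def)
qed

lemma D_one_upper:
  assumes y: "y \<in> D 1 q"
  shows "\<bar>y x\<bar> \<le> 1"
proof (rule D_pointwise_bound[OF y])
  fix f T assume f: "in_Lp 1 f" "Lp_norm 1 f = 1" "loc_integrable f" and xT: "x \<le> T"
  have i: "integrable lborel (\<lambda>x. \<bar>f x\<bar>)" using f(1) by (simp add: in_Lp_def)
  have n: "(LINT x|lborel. \<bar>f x\<bar>) = 1" using Lp_norm_one[of 1 f] f(2) by (simp add: one_ereal_def)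
  have "norm (integral {x..T} (\<lambda>t. exp (- (Q t - Q x)) * f t)) \<le> integral {x..T} (\<lambda>t. \<bar>f t\<bar>)"
  proof (rule integral_norm_bound_integral)
    show "norm (exp (- (Q t - Q x)) * f t) \<le> \<bar>f t\<bar>" if "t \<in> {x..T}" for t
      using mult_right_mono[OF exp_kernel_le_one[of x t], of "\<bar>f t\<bar>"] that by (simp add: abs_mult)
    show "(\<lambda>t. \<bar>f t\<bar>) integrable_on {x..T}" by (rule integral_le_lborel(1)[OF i]) simp
  qed (intro kernel_integrable f)
  also have "\<dots> \<le> 1" using integral_le_lborel(2)[OF i, of x T] n by simp
  finally show "\<bar>integral {x..T} (\<lambda>t. exp (- (Q t - Q x)) * f t)\<bar> \<le> 1" by simp
qed simp

lemma D_p_upper: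
  assumes p: "1 < p" and r: "r = p / (p - 1)" and y: "y \<in> D (ereal p) q"
  shows "\<bar>y x\<bar> \<le> J r x powr (1 / r)"
proof (rule D_pointwise_bound[OF y])
  show "1 \<le> ereal p" using p by simp
  fix f T assume f: "in_Lp (ereal p) f" "Lp_norm (ereal p) f = 1" "loc_integrable f" and xT: "x \<le> T"
  have r1: "r > 1" "1 / p + 1 / r = 1" using p by (simp_all add: r field_simps)
  have i: "integrable lborel (\<lambda>x. \<bar>f x\<bar> powr p)" using f(1) by (simp add: in_Lp_def)
  have n: "(LINT x|lborel. \<bar>f x\<bar> powr p) = 1" using Lp_norm_one[of p f] f(2) p by simp
  \<comment> \<open>\<open>j\<close> is the \<open>L_r\<close> norm of the kernel. Dividing the
    kernel by it and applying Young's inequality pointwise gives Hoelder's inequality after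
    integration, because \<open>1 / p + 1 / r = 1\<close>.\<close>
  define j where "j = J r x powr (1 / r)"
  have Jp: "J r x > 0" using J_pos r1 by simp
  then have j: "j > 0" by (simp add: j_def)
  have jr: "j powr r = J r x" using Jp r1 by (simp add: j_def powr_powr)
  have pt: "norm (exp (- (Q t - Q x)) * f t) \<le> j * (exp (- r * (Q t - Q x)) / (J r x * r) + \<bar>f t\<bar> powr p / p)" for t
  proof -
    have "\<bar>f t\<bar> * (exp (- (Q t - Q x)) / j) \<le> \<bar>f t\<bar> powr p / p + (exp (- (Q t - Q x)) / j) powr r / r"
      using j by (intro Youngs_inequality p r1) auto
    moreover have "(exp (- (Q t - Q x)) / j) powr r = exp (- r * (Q t - Q x)) / J r x"
      using j by (simp add: powr_divide jr) (simp add: powr_def algebra_simps)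
    ultimately have "j * (\<bar>f t\<bar> * (exp (- (Q t - Q x)) / j)) \<le> j * (exp (- r * (Q t - Q x)) / (J r x * r) + \<bar>f t\<bar> powr p / p)"
      using j by (intro mult_left_mono) (auto simp: add.commute)
    then show ?thesis using j by (simp add: abs_mult mult.commute)
  qed
  have i1: "(\<lambda>t. exp (- r * (Q t - Q x))) integrable_on {x..T}"
    by (intro integrable_continuous_interval continuous_intros Q_continuous)
  have i2: "(\<lambda>t. \<bar>f t\<bar> powr p) integrable_on {x..T}" by (rule integral_le_lborel(1)[OF i]) simp
  have "norm (integral {x..T} (\<lambda>t. exp (- (Q t - Q x)) * f t))
      \<le> integral {x..T} (\<lambda>t. j * (exp (- r * (Q t - Q x)) / (J r x * r) + \<bar>f t\<bar> powr p / p))"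
    by (rule integral_norm_bound_integral[OF _ _ pt])
      (intro kernel_integrable f integrable_on_mult_right integrable_add integrable_on_divide i1 i2)+
  also have "\<dots> = j * (integral {x..T} (\<lambda>t. exp (- r * (Q t - Q x))) / (J r x * r) + integral {x..T} (\<lambda>t. \<bar>f t\<bar> powr p) / p)"
    by (simp only: integral_mult_right Henstock_Kurzweil_Integration.integral_add[OF integrable_on_divide[OF i1] integrable_on_divide[OF i2]] integral_divide)
  also have "\<dots> \<le> j * (1 / r + 1 / p)"
  proof (intro mult_left_mono add_mono divide_right_mono)
    have "integral {x..T} (\<lambda>t. exp (- r * (Q t - Q x))) \<le> J r x" using r1 xT by (intro J_ge_integral) auto
    then have "integral {x..T} (\<lambda>t. exp (- r * (Q t - Q x))) / (J r x * r) \<le> J r x / (J r x * r)"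
      using Jp r1 by (intro divide_right_mono) auto
    then show "integral {x..T} (\<lambda>t. exp (- r * (Q t - Q x))) / (J r x * r) \<le> 1 / r" using Jp by simp
    show "integral {x..T} (\<lambda>t. \<bar>f t\<bar> powr p) \<le> 1" using integral_le_lborel(2)[OF i, of x T] n by simp
  qed (use p j in auto)
  also have "\<dots> = j" using r1 by (simp add: add.commute)
  finally show "\<bar>integral {x..T} (\<lambda>t. exp (- (Q t - Q x)) * f t)\<bar> \<le> J r x powr (1 / r)" by (simp add: j_def)
qed

section \<open>Extremal right-hand sides and the exact suprema\<close>

lemma J_one_eq: "J 1 x = exp (Q x) * (tail 1 0 - primitive (\<lambda>t. 1 * exp (- Q t)) x)"
proof -
  have li: "loc_integrable (\<lambda>t. 1 * exp (- Q t))"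
    by (intro loc_integrable_mult_continuous one_loc_integrable continuous_intros Q_continuous)
  have "tail 1 x = tail 1 0 - primitive (\<lambda>t. 1 * exp (- Q t)) x"
  proof (cases "0 \<le> x")
    case True
    then show ?thesis using tail_split[OF zero_less_one True] by (simp add: primitive_def)
  next
    case False
    then have "x \<le> 0" by simp
    from tail_split[OF zero_less_one this] show ?thesis using False by (simp add: primitive_def)
  qed
  then show ?thesis by (simp add: J_def)
qed

text \<open>The constant right-hand side 1 is extremal for \<open>p = \<infinity>\<close> at every
  point simultaneously, and its bounded solution is \<open>J 1\<close>; so the supremum is
  attained.\<close>

lemma J_one_in_D: "J 1 \<in> D \<infinity> q"
proof -
  have eq: "J 1 = (\<lambda>x. exp (Q x) * (tail 1 0 - primitive (\<lambda>t. 1 * exp (- Q t)) x))"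
    by (rule ext) (rule J_one_eq)
  have ac: "abs_cont (J 1)"
    unfolding eq by (rule solution_abs_cont[OF one_loc_integrable])
  have ode: "AE x in lborel. (J 1 has_real_derivative (q x * J 1 x - 1)) (at x)"
    unfolding eq by (rule solution_ae[OF one_loc_integrable])
  have "bounded (range (J 1))"
    using J_bound[of 1] J_nonneg[of 1] by (auto simp: bounded_iff intro!: exI[of _ "exp (1 * c) / (1 * rate)"])
  then have "in_Lp \<infinity> (J 1)" using abs_cont_imp_continuous[OF ac] by (simp add: in_Lp_def)
  moreover have "in_Lp \<infinity> (\<lambda>x. 1)" "Lp_norm \<infinity> (\<lambda>x. 1) = 1" by (auto simp: in_Lp_def Lp_norm_def)
  ultimately show ?thesis using ac ode unfolding D_def by blast
qed

lemma D_infty_sup: "bdd_above ((\<lambda>y. \<bar>y x\<bar>) ` D \<infinity> q)" "(SUP y\<in>D \<infinity> q. \<bar>y x\<bar>) = J 1 x"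
proof -
  show "bdd_above ((\<lambda>y. \<bar>y x\<bar>) ` D \<infinity> q)" using D_infty_upper by (auto simp: bdd_above_def)
  show "(SUP y\<in>D \<infinity> q. \<bar>y x\<bar>) = J 1 x"
    using J_one_in_D J_nonneg[of 1 x] D_infty_upper by (intro cSup_eq_maximum) (auto simp: image_iff intro!: bexI[of _ "J 1"])
qed

text \<open>Taking \<open>G T\<close> as the constant makes \<open>y\<close> vanish beyond
  \<open>T\<close>; to the left of \<open>x\<close> the solution is homogeneous and decays
  exponentially as its argument moves left. Both ends are therefore harmless for \<open>L_p\<close>,
  and a compact middle part remains.\<close>

lemma compact_support_solution:
  assumes p: "1 \<le> p" and fm: "f \<in> borel_measurable borel" and fB: "\<And>t. \<bar>f t\<bar> \<le> B"
    and supp: "\<And>t. t \<notin> {x..T} \<Longrightarrow> f t = 0" and xT: "x \<le> T"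
    and norm: "(LINT t|lborel. \<bar>f t\<bar> powr p) = 1"
  shows "\<exists>y\<in>D (ereal p) q. y x = integral {x..T} (\<lambda>t. exp (- (Q t - Q x)) * f t)"
proof -
  have fint: "integrable lborel (\<lambda>t. \<bar>f t\<bar> powr p)" using norm not_integrable_integral_eq by fastforce
  have fp: "in_Lp (ereal p) f" using fm fint by (simp add: in_Lp_def)
  have fn: "Lp_norm (ereal p) f = 1" using norm by (simp add: Lp_norm_def)
  have fl: "loc_integrable f" by (rule in_Lp_loc_integrable[OF fp]) (use p in simp)
  define g where "g = (\<lambda>t. f t * exp (- Q t))"
  have gl: "loc_integrable g" unfolding g_def
    by (intro loc_integrable_mult_continuous fl continuous_intros Q_continuous)
  define G where "G = primitive g"
  define y where "y u = exp (Q u) * (G T - G u)" for u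
  have ac: "abs_cont y" unfolding y_def G_def g_def by (rule solution_abs_cont[OF fl])
  have ode: "AE x in lborel. (y has_real_derivative (q x * y x - f x)) (at x)"
    unfolding y_def G_def g_def by (rule solution_ae[OF fl])
  have const: "G v = G u" if "u \<le> v" "v \<le> x \<or> T \<le> u" for u v
  proof -
    \<comment> \<open>The support is closed, so \<open>f\<close> may be nonzero at \<open>x\<close>
      and \<open>T\<close>; these two points are discarded as a null set.\<close>
    have "(g has_integral 0) {u..v}"
    proof (rule has_integral_spike[of "{x, T}" _ _ "\<lambda>t. 0"])
      show "g t = 0" if "t \<in> {u..v} - {x, T}" for t
        using that \<open>v \<le> x \<or> T \<le> u\<close> supp[of t] by (auto simp: g_def)
    qed auto
    then show ?thesis using primitive_diff[OF gl \<open>u \<le> v\<close>] by (simp add: G_def integral_unique)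
  qed
  have yx: "y x = integral {x..T} (\<lambda>t. exp (- (Q t - Q x)) * f t)"
  proof -
    have "y x = exp (Q x) * integral {x..T} g" using primitive_diff[OF gl xT] by (simp add: y_def G_def)
    also have "\<dots> = integral {x..T} (\<lambda>t. exp (Q x) * g t)" by simp
    also have "\<dots> = integral {x..T} (\<lambda>t. exp (- (Q t - Q x)) * f t)"
      by (intro arg_cong2[where f=integral] refl ext) (simp add: g_def exp_diff exp_minus field_simps)
    finally show ?thesis .
  qed
  have yc: "continuous_on S y" for S using continuous_on_subset[OF abs_cont_imp_continuous[OF ac]] by blast
  have "bounded (y ` {x..T})" by (intro compact_imp_bounded compact_continuous_image yc) auto
  then obtain M where M: "\<And>u. u \<in> {x..T} \<Longrightarrow> \<bar>y u\<bar> \<le> M"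
    unfolding bounded_iff by (metis imageI real_norm_def)
  \<comment> \<open>The first summand serves \<open>u \<le> x\<close>, where the growth estimate for
    \<open>Q\<close> costs the factor \<open>exp c\<close>; the second compensates the smallest
    value of \<open>exp (- rate * \<bar>u - x\<bar>)\<close> on \<open>{x..T}\<close>.\<close>
  define K where "K = exp c * \<bar>y x\<bar> + \<bar>M\<bar> * exp (rate * (T - x))"
  have K0: "K \<ge> 0" by (simp add: K_def)
  have decay: "\<bar>y u\<bar> \<le> K * exp (- rate * \<bar>u - x\<bar>)" for u
  proof -
    consider "u \<le> x" | "u \<in> {x..T}" | "T < u" using xT by force
    then show ?thesis
    proof cases
      case 1
      have "y u = exp (Q u) * (G T - G x)" using const[OF 1] by (simp add: y_def)
      also have "exp (Q u) = exp (- (Q x - Q u)) * exp (Q x)" by (simp flip: exp_add)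
      finally have "\<bar>y u\<bar> = exp (- (Q x - Q u)) * \<bar>y x\<bar>" by (simp add: y_def abs_mult)
      also have "\<dots> \<le> exp (c - rate * (x - u)) * \<bar>y x\<bar>"
        using Q_growth[OF 1] by (intro mult_right_mono) auto
      also have "exp (c - rate * (x - u)) = exp c * exp (- rate * \<bar>u - x\<bar>)" using 1 by (simp flip: exp_add)
      also have "\<dots> * \<bar>y x\<bar> = exp c * \<bar>y x\<bar> * exp (- rate * \<bar>u - x\<bar>)" by simp
      also have "\<dots> \<le> K * exp (- rate * \<bar>u - x\<bar>)" by (intro mult_right_mono) (simp_all add: K_def)
      finally show ?thesis .
    next
      case 2
      have "\<bar>y u\<bar> \<le> \<bar>M\<bar> * (exp (rate * (T - x)) * exp (- rate * \<bar>u - x\<bar>))"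
      proof -
        have "rate * (u - x) \<le> rate * (T - x)" using 2 rate_pos by (intro mult_left_mono) auto
        then have "1 \<le> exp (rate * (T - x)) * exp (- rate * \<bar>u - x\<bar>)" using 2 by (simp flip: exp_add)
        then have "\<bar>M\<bar> * 1 \<le> \<bar>M\<bar> * (exp (rate * (T - x)) * exp (- rate * \<bar>u - x\<bar>))" by (intro mult_left_mono) auto
        then show ?thesis using M[OF 2] by linarith
      qed
      also have "\<dots> = \<bar>M\<bar> * exp (rate * (T - x)) * exp (- rate * \<bar>u - x\<bar>)" by simp
      also have "\<dots> \<le> K * exp (- rate * \<bar>u - x\<bar>)" by (intro mult_right_mono) (simp_all add: K_def)
      finally show ?thesis .
    next
      case 3
      then have "y u = 0" using const[of T u] by (simp add: y_def)
      then show ?thesis using K0 by simp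
    qed
  qed
  have "integrable lborel (\<lambda>u. K powr p * exp (- (p * rate) * \<bar>u - x\<bar>))"
    using p rate_pos by (intro integrable_mult_right integrable_exp_neg_abs) auto
  then have "integrable lborel (\<lambda>u. \<bar>y u\<bar> powr p)"
  proof (rule Bochner_Integration.integrable_bound)
    have "y \<in> borel_measurable borel" by (rule borel_measurable_continuous_onI[OF yc])
    then show "(\<lambda>u. \<bar>y u\<bar> powr p) \<in> borel_measurable lborel" by measurable
    have "\<bar>y u\<bar> powr p \<le> K powr p * exp (- (p * rate) * \<bar>u - x\<bar>)" for u
    proof -
      have "\<bar>y u\<bar> powr p \<le> (K * exp (- rate * \<bar>u - x\<bar>)) powr p"
        using p by (intro powr_mono2 decay) auto
      also have "\<dots> = K powr p * exp (- rate * \<bar>u - x\<bar>) powr p" using K0 by (simp add: powr_mult)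
      also have "exp (- rate * \<bar>u - x\<bar>) powr p = exp (- (p * rate) * \<bar>u - x\<bar>)" by (simp add: powr_def)
      finally show ?thesis .
    qed
    then show "AE u in lborel. norm (\<bar>y u\<bar> powr p) \<le> norm (K powr p * exp (- (p * rate) * \<bar>u - x\<bar>))"
      by (intro AE_I2) simp
  qed
  moreover have "y \<in> borel_measurable borel" by (rule borel_measurable_continuous_onI[OF yc])
  ultimately have "in_Lp (ereal p) y" by (simp add: in_Lp_def)
  then have "y \<in> D (ereal p) q" using ac ode fp fn unfolding D_def by blast
  then show ?thesis using yx by blast
qed

lemma D_bdd:
  assumes "\<And>y. y \<in> D p q \<Longrightarrow> \<bar>y x\<bar> \<le> B"
  shows "bdd_above ((\<lambda>y. \<bar>y x\<bar>) ` D p q)"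
  using assms by (auto simp: bdd_above_def)

text \<open>Equality in Hoelder's inequality calls for \<open>f\<close> proportional to the power
  \<open>r - 1\<close> of the kernel. Cut off at \<open>T\<close> and normalised, it produces at
  \<open>x\<close> exactly the \<open>L_r\<close> norm of the truncated kernel.\<close>

lemma D_p_lower:
  assumes p: "1 < p" and r: "r = p / (p - 1)" and xT: "x < T"
  shows "integral {x..T} (\<lambda>t. exp (- r * (Q t - Q x))) powr (1 / r) \<le> (SUP y\<in>D (ereal p) q. \<bar>y x\<bar>)"
proof -
  have r1: "r > 1" "1 / p + 1 / r = 1" "p * (r - 1) = r" using p by (simp_all add: r field_simps)
  define I where "I = integral {x..T} (\<lambda>t. exp (- r * (Q t - Q x)))"
  define E where "E t = exp (- r * (Q t - Q x))" for t
  have Ec: "continuous_on S E" for S unfolding E_def by (intro continuous_intros Q_continuous)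
  have I: "I > 0"
  proof -
    have "0 < (T - x) * exp (- r * (Q T - Q x))" using xT by simp
    also have "\<dots> = integral {x..T} (\<lambda>t. exp (- r * (Q T - Q x)))" using xT by simp
    also have "\<dots> \<le> I" unfolding I_def
      using r1 Q_mono by (intro integral_le integrable_continuous_interval continuous_intros Q_continuous) auto
    finally show ?thesis .
  qed
  \<comment> \<open>Normalisation \<open>b powr p * I = 1\<close>: the \<open>p\<close>-th power of
    the test function has the exponent \<open>p * (r - 1) = r\<close> in the kernel.\<close>
  define b where "b = I powr (- 1 / p)"
  have b: "b > 0" using I by (simp add: b_def)
  define f where "f t = indicator {x..T} t * (b * exp (- (r - 1) * (Q t - Q x)))" for t
  have "\<exists>y\<in>D (ereal p) q. y x = integral {x..T} (\<lambda>t. exp (- (Q t - Q x)) * f t)"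
  proof (rule compact_support_solution[of p f b])
    have "(\<lambda>t. b * exp (- (r - 1) * (Q t - Q x))) \<in> borel_measurable borel"
      by (intro borel_measurable_continuous_onI continuous_intros Q_continuous)
    then show "f \<in> borel_measurable borel" unfolding f_def by measurable
    show "\<bar>f t\<bar> \<le> b" for t
      using b Q_mono[of x t] r1 by (auto simp: f_def indicator_def intro!: mult_nonpos_nonneg)
    have "\<bar>f t\<bar> powr p = indicator {x..T} t *\<^sub>R ((1 / I) * E t)" for t
    proof (cases "t \<in> {x..T}")
      case True
      have "\<bar>f t\<bar> powr p = b powr p * exp (- (r - 1) * (Q t - Q x)) powr p"
        using True b by (simp add: f_def abs_mult powr_mult)
      also have "b powr p = I powr (- 1)" using p unfolding b_def by (simp add: powr_powr del: powr_minus)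
      also have "\<dots> = 1 / I" using I by (simp add: powr_minus_divide)
      also have "exp (- (r - 1) * (Q t - Q x)) powr p = exp (- (p * (r - 1)) * (Q t - Q x))"
        by (simp add: powr_def algebra_simps)
      finally show ?thesis using True by (simp add: r1(3) E_def)
    qed (simp add: f_def)
    then have "(LINT t|lborel. \<bar>f t\<bar> powr p) = (LINT t:{x..T}|lborel. (1 / I) * E t)"
      by (simp add: set_lebesgue_integral_def)
    also have "\<dots> = integral {x..T} (\<lambda>t. (1 / I) * E t)"
      by (intro set_borel_integral_eq_integral borel_integrable_atLeastAtMost' continuous_intros Ec)
    also have "\<dots> = (1 / I) * I" by (simp only: integral_mult_right) (simp add: I_def E_def)
    also have "\<dots> = 1" using I by simp
    finally show "(LINT t|lborel. \<bar>f t\<bar> powr p) = 1" .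
  qed (use p xT in \<open>auto simp: f_def\<close>)
  then obtain y where y: "y \<in> D (ereal p) q" "y x = integral {x..T} (\<lambda>t. exp (- (Q t - Q x)) * f t)" by blast
  have "y x = integral {x..T} (\<lambda>t. b * E t)"
    unfolding y(2)
  proof (rule Henstock_Kurzweil_Integration.integral_cong)
    fix t assume t: "t \<in> {x..T}"
    have "exp (- (Q t - Q x)) * (b * exp (- (r - 1) * (Q t - Q x))) = b * (exp (- (Q t - Q x)) * exp (- (r - 1) * (Q t - Q x)))" by simp
    also have "\<dots> = b * E t" unfolding E_def exp_add[symmetric] by (simp add: algebra_simps)
    finally show "exp (- (Q t - Q x)) * f t = b * E t" using t by (simp add: f_def)
  qed
  also have "\<dots> = b * I" by (simp only: integral_mult_right) (simp add: I_def E_def)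
  also have "\<dots> = I powr (- 1 / p) * I powr 1" using I by (simp add: b_def)
  also have "\<dots> = I powr (1 - 1 / p)" using I by (simp only: powr_add[symmetric]) simp
  also have "1 - 1 / p = 1 / r" using r1 by simp
  finally have "I powr (1 / r) \<le> \<bar>y x\<bar>" by simp
  also have "\<dots> \<le> (SUP y\<in>D (ereal p) q. \<bar>y x\<bar>)"
    using y(1) D_p_upper[OF p r] by (intro cSUP_upper D_bdd) auto
  finally show ?thesis by (simp add: I_def)
qed

lemma D_p_nonempty:
  assumes p: "1 \<le> p"
  shows "\<exists>y. y \<in> D (ereal p) q"
proof -
  have "\<exists>y\<in>D (ereal p) q. y 0 = integral {0..1} (\<lambda>t. exp (- (Q t - Q 0)) * indicator {0..1} t)"
  proof (rule compact_support_solution[of p _ 1])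
    have "\<bar>indicator {0..1} t\<bar> powr p = (indicator {0..1} t :: real)" for t :: real
      using p by (simp add: indicator_def)
    then show "(LINT t|lborel. \<bar>indicator {0..1::real} t\<bar> powr p) = 1" by simp
  qed (use p in \<open>auto simp: indicator_def\<close>)
  then show ?thesis by blast
qed

text \<open>For \<open>p = 1\<close> the extremal right-hand side would be a unit mass at
  \<open>x\<close>, which is not a function; the densities \<open>1 / h\<close> on
  \<open>{x..x+h}\<close> approximate it as \<open>h\<close> decreases to 0, where the kernel is
  close to 1.\<close>

lemma D_one_sup: "bdd_above ((\<lambda>y. \<bar>y x\<bar>) ` D 1 q)" "(SUP y\<in>D 1 q. \<bar>y x\<bar>) = 1"
proof -
  show bdd: "bdd_above ((\<lambda>y. \<bar>y x\<bar>) ` D 1 q)" by (rule D_bdd[of 1 x 1]) (rule D_one_upper)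
  have low: "exp (- (Q (x + h) - Q x)) \<le> (SUP y\<in>D 1 q. \<bar>y x\<bar>)" if h: "h > 0" for h
  proof -
    have "\<exists>y\<in>D (ereal 1) q. y x = integral {x..x+h} (\<lambda>t. exp (- (Q t - Q x)) * (indicator {x..x+h} t / h))"
    proof (rule compact_support_solution[of 1 _ "1 / h"])
      show "(LINT t|lborel. \<bar>indicator {x..x+h} t / h\<bar> powr 1) = 1" using h by simp
    qed (use h in \<open>auto simp: indicator_def\<close>)
    then obtain y where y: "y \<in> D 1 q" "y x = integral {x..x+h} (\<lambda>t. exp (- (Q t - Q x)) * (indicator {x..x+h} t / h))"
      by (auto simp: one_ereal_def)
    have "exp (- (Q (x + h) - Q x)) = integral {x..x+h} (\<lambda>t. exp (- (Q (x + h) - Q x)) * (1 / h))" using h by simp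
    also have "\<dots> \<le> integral {x..x+h} (\<lambda>t. exp (- (Q t - Q x)) * (1 / h))"
      using h Q_mono by (intro integral_le integrable_continuous_interval continuous_intros Q_continuous mult_right_mono) auto
    also have "\<dots> = y x" unfolding y(2) by (intro Henstock_Kurzweil_Integration.integral_cong) simp
    also have "\<dots> \<le> \<bar>y x\<bar>" by simp
    also have "\<dots> \<le> (SUP y\<in>D 1 q. \<bar>y x\<bar>)" by (rule cSUP_upper[OF y(1) bdd])
    finally show ?thesis .
  qed
  have "((\<lambda>h. exp (- (Q (x + h) - Q x))) \<longlongrightarrow> exp (- (Q (x + 0) - Q x))) (at_right 0)"
  proof -
    have "continuous_on UNIV (\<lambda>h. exp (- (Q (x + h) - Q x)))"
      by (intro continuous_intros continuous_on_compose2[OF Q_continuous[of UNIV]]) auto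
    then have "isCont (\<lambda>h. exp (- (Q (x + h) - Q x))) 0" by (simp add: continuous_on_eq_continuous_at)
    then show ?thesis by (simp add: isCont_def filterlim_at_split)
  qed
  then have "exp (- (Q (x + 0) - Q x)) \<le> (SUP y\<in>D 1 q. \<bar>y x\<bar>)"
    by (rule tendsto_upperbound) (use low in \<open>auto simp: eventually_at_right_field intro!: exI[of _ 1]\<close>)
  then have ge: "1 \<le> (SUP y\<in>D 1 q. \<bar>y x\<bar>)" by simp
  have "(SUP y\<in>D 1 q. \<bar>y x\<bar>) \<le> 1"
    using D_p_nonempty[of 1] by (intro cSUP_least D_one_upper) (auto simp: one_ereal_def)
  then show "(SUP y\<in>D 1 q. \<bar>y x\<bar>) = 1" using ge by simp
qed

lemma D_p_sup_le:
  assumes p: "1 < p" and r: "r = p / (p - 1)"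
  shows "(SUP y\<in>D (ereal p) q. \<bar>y x\<bar>) \<le> J r x powr (1 / r)"
  using D_p_nonempty[of p] p by (intro cSUP_least D_p_upper[OF p r]) auto

text \<open>The lower bound holds for every truncation, and the part of \<open>J r x\<close> beyond
  \<open>T\<close> is \<open>exp (- r * (Q T - Q x)) * J r T\<close>, which vanishes as
  \<open>T\<close> grows because \<open>J r\<close> is bounded.\<close>

lemma D_p_sup:
  assumes p: "1 < p" and r: "r = p / (p - 1)"
  shows "(SUP y\<in>D (ereal p) q. \<bar>y x\<bar>) = J r x powr (1 / r)"
proof (rule antisym)
  have r1: "r > 1" using p by (simp add: r field_simps)
  define I where "I T = integral {x..T} (\<lambda>t. exp (- r * (Q t - Q x)))" for T
  define C where "C = exp (r * c) / (r * rate)"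
  have C0: "C \<ge> 0" using r1 rate_pos by (simp add: C_def)
  have "(I \<longlongrightarrow> J r x) at_top"
  proof (rule tendsto_sandwich[where h="\<lambda>T. J r x"])
    have rr: "r * rate > 0" using r1 rate_pos by simp
    have exp0: "((\<lambda>T. exp (- k * (T - x))) \<longlongrightarrow> 0) at_top" if "k > 0" for k :: real
      using that by real_asymp
    have "((\<lambda>T. J r x - exp (r * c) * exp (- (r * rate) * (T - x)) * C) \<longlongrightarrow> J r x - exp (r * c) * 0 * C) at_top"
      by (intro tendsto_intros exp0 rr)
    then show "((\<lambda>T. J r x - exp (r * c) * exp (- (r * rate) * (T - x)) * C) \<longlongrightarrow> J r x) at_top" by simp
    show "\<forall>\<^sub>F T in at_top. J r x - exp (r * c) * exp (- (r * rate) * (T - x)) * C \<le> I T"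
      using eventually_ge_at_top[of x]
    proof eventually_elim
      case (elim T)
      have "r * (rate * (T - x) - c) \<le> r * (Q T - Q x)" using Q_growth[OF elim] r1 by (intro mult_left_mono) auto
      then have "exp (- r * (Q T - Q x)) \<le> exp (r * c) * exp (- (r * rate) * (T - x))"
        by (simp add: algebra_simps flip: exp_add)
      then have "exp (- r * (Q T - Q x)) * J r T \<le> exp (r * c) * exp (- (r * rate) * (T - x)) * C"
        using J_bound[of r T] r1 J_nonneg[of r T] by (intro mult_mono) (auto simp: C_def)
      then show ?case using J_split[of r x T] elim r1 by (simp add: I_def)
    qed
    show "\<forall>\<^sub>F T in at_top. I T \<le> J r x"
      using eventually_ge_at_top[of x] by eventually_elim (use J_ge_integral r1 in \<open>simp add: I_def\<close>)
  qed simp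
  then have "((\<lambda>T. I T powr (1 / r)) \<longlongrightarrow> J r x powr (1 / r)) at_top"
    using J_pos[of r x] r1 by (intro tendsto_powr tendsto_const) auto
  then show "J r x powr (1 / r) \<le> (SUP y\<in>D (ereal p) q. \<bar>y x\<bar>)"
  proof (rule tendsto_upperbound)
    show "\<forall>\<^sub>F T in at_top. I T powr (1 / r) \<le> (SUP y\<in>D (ereal p) q. \<bar>y x\<bar>)"
      using eventually_gt_at_top[of x] by eventually_elim (use D_p_lower[OF p r] in \<open>simp add: I_def\<close>)
  qed simp
qed (rule D_p_sup_le[OF p r])

end

subsection \<open>Asymptotics\<close>

locale slowly_varying_split = dissipative +
  fixes q1 q2 s :: "real \<Rightarrow> real"
  assumes q_split: "\<And>x. q x = q1 x + q2 x"
    and q1_pos: "\<And>x. q1 x > 0"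
    and q1_ac: "abs_cont q1"
    and q2_loc: "loc_integrable q2"
    and s_pos: "\<And>x. s x > 0"
    and cond_a: "filterlim s at_top at_infinity"
    and cond_b: "\<forall>\<^sub>F x in at_infinity. \<forall>d. (q1 has_real_derivative d) (at x)
                    \<longrightarrow> 1 / s x \<ge> \<bar>d\<bar> / (q1 x)\<^sup>2"
    and cond_c: "((\<lambda>x. s x / (x * q1 x)) \<longlongrightarrow> 0) at_infinity"
    and cond_d: "\<exists>\<nu>\<ge>1. \<forall>\<^sub>F x in at_infinity. \<forall>t\<in>Delta s q1 x.
                    1 / \<nu> \<le> s t / s x \<and> s t / s x \<le> \<nu>"
    and cond_e: "(kappa_tilde s q1 q2 \<longlongrightarrow> 0) at_infinity"
begin

text \<open>The local length scale of the kernel: \<open>J r\<close> turns out to be asymptotic to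
  \<open>w / r\<close>, and the derivative \<open>- q1' / q1^2\<close> of \<open>w\<close> is the
  quantity that hypothesis (b) bounds.\<close>

definition "w x = 1 / q1 x"

lemma w_pos: "w x > 0" using q1_pos by (simp add: w_def)

lemma w_abs_cont: "abs_cont w"
  using abs_cont_inverse[OF q1_ac q1_pos] by (simp add: w_def[abs_def])

lemma q1_continuous: "continuous_on S q1"
  using continuous_on_subset[OF abs_cont_imp_continuous[OF q1_ac]] by blast

lemma w_continuous: "continuous_on S w"
  using continuous_on_subset[OF abs_cont_imp_continuous[OF w_abs_cont]] by blast

lemma Delta_eq: "Delta s q1 x = {x - s x * w x..x + s x * w x}"
  by (simp add: Delta_def w_def)

text \<open>By hypothesis (c) the half-width \<open>s x * w x\<close> is eventually below
  \<open>\<bar>x\<bar> / 2\<close>, so the whole window recedes to infinity with its centre.\<close>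

lemma eventually_on_Delta:
  assumes P: "\<forall>\<^sub>F x in at_infinity. P x"
  shows "\<forall>\<^sub>F x in at_infinity. \<forall>t\<in>Delta s q1 x. P t"
proof -
  obtain b where b: "\<And>x. \<bar>x\<bar> \<ge> b \<Longrightarrow> P x" using P by (auto simp: eventually_at_infinity)
  have "\<forall>\<^sub>F x in at_infinity. dist (s x / (x * q1 x)) 0 < 1 / 2" by (rule tendstoD[OF cond_c]) simp
  moreover have "\<forall>\<^sub>F x::real in at_infinity. \<bar>x\<bar> \<ge> max 1 (2 * b)"
    unfolding eventually_at_infinity by (rule exI[of _ "max 1 (2 * b)"]) simp
  ultimately show ?thesis
  proof eventually_elim
    case (elim x)
    have "s x * w x / \<bar>x\<bar> = \<bar>s x / (x * q1 x)\<bar>" using s_pos[of x] q1_pos[of x] by (simp add: w_def abs_mult)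
    then have "s x * w x / \<bar>x\<bar> < 1 / 2" using elim(1) by simp
    then have "s x * w x < \<bar>x\<bar> / 2" using elim(2) by (simp add: field_simps)
    then show ?case using elim(2) by (auto simp: Delta_eq intro!: b)
  qed
qed

text \<open>Taken from a primitive so that absolute continuity in \<open>t\<close> and the
  derivative \<open>q2 / q1\<close> almost everywhere are at hand for the integration by parts, on
  whichever side of \<open>x\<close> the point \<open>t\<close> lies.\<close>

definition "H x t = primitive (\<lambda>\<xi>. q2 \<xi> / q1 \<xi>) t - primitive (\<lambda>\<xi>. q2 \<xi> / q1 \<xi>) x"

lemma ratio_loc_integrable: "loc_integrable (\<lambda>\<xi>. q2 \<xi> / q1 \<xi>)"
  using loc_integrable_mult_continuous[OF q2_loc w_continuous] by (simp add: w_def)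

lemma kappa_x_eq: "kappa_x q1 q2 x t = q1 t * H x t"
proof -
  have le: "(LBINT \<xi>=ereal u..ereal v. q2 \<xi> / q1 \<xi>) = H u v" if "u \<le> v" for u v
  proof -
    have "set_integrable lborel {u..v} (\<lambda>\<xi>. q2 \<xi> / q1 \<xi>)"
      using ratio_loc_integrable by (simp add: loc_integrable_def)
    then show ?thesis
      using interval_integral_eq_integral[OF that] primitive_diff[OF ratio_loc_integrable that] by (simp add: H_def)
  qed
  show ?thesis
  proof (cases "x \<le> t")
    case False
    then have "(LBINT \<xi>=ereal x..ereal t. q2 \<xi> / q1 \<xi>) = - (LBINT \<xi>=ereal t..ereal x. q2 \<xi> / q1 \<xi>)"
      by (intro interval_integral_endpoints_reverse)
    then show ?thesis using le[of t x] False by (simp add: kappa_x_def H_def)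
  qed (simp add: kappa_x_def le)
qed

lemma H_abs_cont: "abs_cont (H x)"
proof -
  have "abs_cont (\<lambda>t. primitive (\<lambda>\<xi>. q2 \<xi> / q1 \<xi>) x)" by (auto simp: abs_cont_def abs_cont_on_def intro: exI[of _ 1])
  then show ?thesis unfolding H_def[abs_def] by (intro abs_cont_diff abs_cont_primitive ratio_loc_integrable)
qed

text \<open>A supremum of reals dominates its terms only if they are bounded above; continuity on
  the compact window ensures this.\<close>

lemma kappa_tilde_bound:
  assumes "t \<in> Delta s q1 x"
  shows "\<bar>q1 t * H x t\<bar> \<le> kappa_tilde s q1 q2 x"
proof -
  have "continuous_on S (\<lambda>t. \<bar>q1 t * H x t\<bar>)" for S
    using continuous_on_subset[OF abs_cont_imp_continuous[OF H_abs_cont]]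
    by (intro continuous_intros q1_continuous) blast
  then have "bounded ((\<lambda>t. \<bar>q1 t * H x t\<bar>) ` Delta s q1 x)"
    unfolding Delta_def by (intro compact_imp_bounded compact_continuous_image) auto
  then have "bdd_above ((\<lambda>t. \<bar>q1 t * H x t\<bar>) ` Delta s q1 x)" by (rule bounded_imp_bdd_above)
  then show ?thesis unfolding kappa_tilde_def kappa_x_eq by (rule cSUP_upper[OF assms])
qed

text \<open>The bound on \<open>q1'\<close> says that \<open>w = 1 / q1\<close> is Lipschitz with a small constant. Integrating
  \<open>q2 = q1 * (q2 / q1)\<close> by parts shows that \<open>q2\<close> has a small integral over the window.\<close>

lemma window_estimates:
  assumes b: "\<And>t d. t \<in> Delta s q1 x \<Longrightarrow> (q1 has_real_derivative d) (at t) \<Longrightarrow> \<bar>d\<bar> \<le> \<nu> * (q1 t)\<^sup>2 / s x"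
    and \<nu>: "\<nu> > 0" and K: "0 \<le> K" "K \<le> s x" and \<delta>: "\<nu> * K / s x \<le> \<delta>" "\<delta> \<le> 1 / 2" and \<tau>: "\<tau> \<in> {0..K}"
  shows "\<bar>w (x + \<tau> * w x) / w x - 1\<bar> \<le> \<delta>"
    and "\<bar>Q (x + \<tau> * w x) - Q x - \<tau>\<bar> \<le> 2 * K * \<delta> + 2 * kappa_tilde s q1 q2 x"
proof -
  define T where "T = x + \<tau> * w x"
  have wx: "w x > 0" by (rule w_pos)
  have xT: "x \<le> T" using \<tau> wx by (simp add: T_def)
  have sx: "s x > 0" by (rule s_pos)
  have \<delta>0: "\<delta> \<ge> 0" using \<delta>(1) \<nu> K(1) sx by (meson divide_nonneg_pos less_imp_le mult_nonneg_nonneg order_trans)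
  have "\<tau> * w x \<le> s x * w x" using \<tau> K wx by (intro mult_right_mono) auto
  then have sub: "{x..T} \<subseteq> Delta s q1 x" using sx wx by (auto simp: Delta_eq T_def add_increasing2)
  obtain N1 where N1: "negligible N1" "\<And>t. t \<notin> N1 \<Longrightarrow> \<exists>d. (q1 has_real_derivative d) (at t)"
    using abs_cont_differentiable_ae[OF q1_ac] by blast
  \<comment> \<open>The derivative of \<open>w\<close> is at most \<open>\<nu> / s x\<close> in
    absolute value almost everywhere, and \<open>t\<close> is within \<open>K * w x\<close> of
    \<open>x\<close>; so the relative change of \<open>w\<close> is at most
    \<open>\<nu> * K / s x\<close>.\<close>
  have wlip: "\<bar>w t - w x\<bar> \<le> \<delta> * w x" if t: "t \<in> {x..T}" for t
  proof -
    have "\<bar>w t - w x\<bar> \<le> (\<nu> / s x) * (t - x)"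
    proof (rule abs_cont_lipschitz[OF w_abs_cont _ N1(1)])
      fix z assume z: "z \<in> {x..t} - N1"
      then obtain d where d: "(q1 has_real_derivative d) (at z)" using N1(2) by blast
      have zD: "z \<in> Delta s q1 x" using z t sub by auto
      have "(w has_real_derivative (- d / (q1 z)\<^sup>2)) (at z)"
        unfolding w_def[abs_def] using q1_pos[of z]
        by (auto intro!: derivative_eq_intros d simp: power2_eq_square)
      moreover have "\<bar>- d / (q1 z)\<^sup>2\<bar> \<le> \<nu> / s x"
        using b[OF zD d] q1_pos[of z] sx by (simp add: abs_divide field_simps)
      ultimately show "\<exists>d. (w has_real_derivative d) (at z) \<and> \<bar>d\<bar> \<le> \<nu> / s x" by blast
    qed (use t \<nu> sx in auto)
    also have "\<dots> \<le> (\<nu> / s x) * (K * w x)"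
    proof (intro mult_left_mono)
      have "t - x \<le> \<tau> * w x" using t by (simp add: T_def)
      also have "\<dots> \<le> K * w x" using \<tau> wx by (intro mult_right_mono) auto
      finally show "t - x \<le> K * w x" .
    qed (use \<nu> sx in simp)
    also have "\<dots> = (\<nu> * K / s x) * w x" by simp
    also have "\<dots> \<le> \<delta> * w x" using \<delta>(1) wx by (intro mult_right_mono) auto
    finally show ?thesis .
  qed
  have "w T / w x - 1 = (w T - w x) / w x" using wx by (simp add: diff_divide_distrib)
  then have "\<bar>w T / w x - 1\<bar> = \<bar>w T - w x\<bar> / w x" using wx by (simp add: abs_divide)
  also have "\<dots> \<le> \<delta>" using wlip[of T] xT wx by (simp add: field_simps)
  finally show "\<bar>w (x + \<tau> * w x) / w x - 1\<bar> \<le> \<delta>" by (simp add: T_def)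
  \<comment> \<open>The bound \<open>\<delta> \<le> 1 / 2\<close> gives
    \<open>w t \<ge> w x / 2\<close>, that is \<open>q1 t \<le> 2 * q1 x\<close>, which is the
    origin of the factors 2 below.\<close>
  have q1w: "\<bar>q1 t - q1 x\<bar> \<le> 2 * \<delta> * q1 x" and q1le: "q1 t \<le> 2 * q1 x" if t: "t \<in> {x..T}" for t
  proof -
    have wt: "w t \<ge> w x / 2"
    proof -
      have "\<delta> * w x \<le> (1 / 2) * w x" using \<delta>(2) wx by (intro mult_right_mono) auto
      then show ?thesis using wlip[OF t] by (simp add: abs_le_iff)
    qed
    then show le: "q1 t \<le> 2 * q1 x" using q1_pos[of x] q1_pos[of t] by (simp add: w_def field_simps)
    have "q1 t - q1 x = q1 t * q1 x * (w x - w t)" using q1_pos[of x] q1_pos[of t] by (simp add: w_def field_simps)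
    then have "\<bar>q1 t - q1 x\<bar> = q1 t * q1 x * \<bar>w t - w x\<bar>"
      using q1_pos[of x] q1_pos[of t] by (simp add: abs_mult abs_minus_commute)
    also have "\<dots> \<le> q1 t * q1 x * (\<delta> * w x)"
      using wlip[OF t] q1_pos[of x] q1_pos[of t] by (intro mult_left_mono) auto
    also have "\<dots> = q1 t * \<delta>" using q1_pos[of x] by (simp add: w_def)
    also have "\<dots> \<le> 2 * q1 x * \<delta>" using le \<delta>0 by (intro mult_right_mono)
    finally show "\<bar>q1 t - q1 x\<bar> \<le> 2 * \<delta> * q1 x" by (simp add: mult_ac)
  qed
  have Tx: "(T - x) * q1 x = \<tau>" using q1_pos[of x] by (simp add: T_def w_def)
  have q1int: "q1 integrable_on {x..T}" by (intro integrable_continuous_interval q1_continuous)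
  have "norm (integral {x..T} (\<lambda>t. q1 t - q1 x)) \<le> integral {x..T} (\<lambda>t. 2 * \<delta> * q1 x)"
    using q1w by (intro integral_norm_bound_integral integrable_diff q1int) auto
  also have "\<dots> = 2 * \<delta> * ((T - x) * q1 x)" using xT by simp
  also have "\<dots> = 2 * \<delta> * \<tau>" unfolding Tx ..
  also have "\<dots> \<le> 2 * \<delta> * K" using \<tau> \<delta>0 by (intro mult_left_mono) auto
  finally have "norm (integral {x..T} (\<lambda>t. q1 t - q1 x)) \<le> 2 * K * \<delta>" by (simp add: mult_ac)
  moreover have "integral {x..T} (\<lambda>t. q1 t - q1 x) = integral {x..T} q1 - (T - x) * q1 x"
    using xT by (subst Henstock_Kurzweil_Integration.integral_diff[OF q1int]) auto
  ultimately have I1: "\<bar>integral {x..T} q1 - \<tau>\<bar> \<le> 2 * K * \<delta>" unfolding Tx by simp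
  define \<kappa> where "\<kappa> = kappa_tilde s q1 q2 x"
  have \<kappa>: "\<bar>q1 t * H x t\<bar> \<le> \<kappa>" if "t \<in> {x..T}" for t
    unfolding \<kappa>_def using sub that by (intro kappa_tilde_bound) auto
  have \<kappa>0: "\<kappa> \<ge> 0" using \<kappa>[of x] xT by auto
  \<comment> \<open>Integration by parts in differentiated form: almost everywhere
    \<open>q2 = q1 * H'\<close>, so subtracting \<open>q1 * H\<close> leaves the derivative
    \<open>- q1' * H\<close>, in which \<open>q2\<close> enters only through
    \<open>H\<close>.\<close>
  define \<Phi> where "\<Phi> t = primitive q2 t - q1 t * H x t" for t
  have \<Phi>ac: "abs_cont \<Phi>" unfolding \<Phi>_def[abs_def]
    by (intro abs_cont_diff abs_cont_mult abs_cont_primitive q2_loc q1_ac H_abs_cont)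
  obtain N2 where N2: "negligible N2" "\<And>t. t \<notin> N2 \<Longrightarrow> (primitive q2 has_real_derivative q2 t) (at t)"
    using primitive_ae_derivative[OF q2_loc] by blast
  obtain N3 where N3: "negligible N3" "\<And>t. t \<notin> N3 \<Longrightarrow>
      (primitive (\<lambda>\<xi>. q2 \<xi> / q1 \<xi>) has_real_derivative q2 t / q1 t) (at t)"
    using primitive_ae_derivative[OF ratio_loc_integrable] by blast
  have "\<bar>\<Phi> T - \<Phi> x\<bar> \<le> (2 * \<nu> * \<kappa> * q1 x / s x) * (T - x)"
  proof (rule abs_cont_lipschitz[OF \<Phi>ac xT])
    show "negligible (N1 \<union> N2 \<union> N3)" using N1 N2 N3 by (intro negligible_Un)
    show "0 \<le> 2 * \<nu> * \<kappa> * q1 x / s x" using \<nu> \<kappa>0 q1_pos[of x] sx by simp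
    fix t assume t: "t \<in> {x..T} - (N1 \<union> N2 \<union> N3)"
    then obtain d where d: "(q1 has_real_derivative d) (at t)" using N1(2) by blast
    have tD: "t \<in> Delta s q1 x" using t sub by auto
    have dH: "(H x has_real_derivative q2 t / q1 t) (at t)"
      unfolding H_def[abs_def] using t by (auto intro!: derivative_eq_intros N3(2))
    have "(\<Phi> has_real_derivative (q2 t - (d * H x t + (q2 t / q1 t) * q1 t))) (at t)"
      unfolding \<Phi>_def[abs_def] using t N2(2)[of t]
      by (intro DERIV_diff DERIV_mult d dH) auto
    moreover have "q2 t - (d * H x t + (q2 t / q1 t) * q1 t) = - (d * H x t)" using q1_pos[of t] by simp
    moreover have "\<bar>- (d * H x t)\<bar> \<le> 2 * \<nu> * \<kappa> * q1 x / s x"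
    proof -
      have "\<bar>- (d * H x t)\<bar> = \<bar>d\<bar> * \<bar>H x t\<bar>" by (simp add: abs_mult)
      also have "\<dots> \<le> (\<nu> * (q1 t)\<^sup>2 / s x) * \<bar>H x t\<bar>" by (intro mult_right_mono b[OF tD d]) simp
      \<comment> \<open>One of the two factors \<open>q1 t\<close> joins \<open>H x t\<close> to
        form the quantity bounded by \<open>\<kappa>\<close>; the other is at most
        \<open>2 * q1 x\<close>.\<close>
      also have "\<dots> = (\<nu> * q1 t / s x) * \<bar>q1 t * H x t\<bar>"
        using q1_pos[of t] by (simp add: abs_mult power2_eq_square)
      also have "\<dots> \<le> (\<nu> * q1 t / s x) * \<kappa>"
        using \<nu> q1_pos[of t] sx \<kappa>[of t] t by (intro mult_left_mono) auto
      also have "\<dots> \<le> (\<nu> * (2 * q1 x) / s x) * \<kappa>"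
        using q1le[of t] t \<nu> sx \<kappa>0 by (intro mult_right_mono divide_right_mono mult_left_mono) auto
      finally show ?thesis by (simp add: mult_ac)
    qed
    ultimately show "\<exists>d. (\<Phi> has_real_derivative d) (at t) \<and> \<bar>d\<bar> \<le> 2 * \<nu> * \<kappa> * q1 x / s x" by auto
  qed
  also have "\<dots> = 2 * \<nu> * \<kappa> / s x * ((T - x) * q1 x)" by simp
  also have "\<dots> = 2 * \<kappa> * (\<nu> * \<tau> / s x)" unfolding Tx by simp
  also have "\<dots> \<le> 2 * \<kappa> * \<delta>"
  proof (intro mult_left_mono)
    have "\<nu> * \<tau> / s x \<le> \<nu> * K / s x" using \<tau> \<nu> sx by (intro divide_right_mono mult_left_mono) auto
    then show "\<nu> * \<tau> / s x \<le> \<delta>" using \<delta>(1) by simp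
  qed (use \<kappa>0 in simp)
  also have "\<dots> \<le> 2 * \<kappa> * (1 / 2)" using \<delta>(2) \<kappa>0 by (intro mult_left_mono) auto
  finally have "\<bar>\<Phi> T - \<Phi> x\<bar> \<le> \<kappa>" by simp
  moreover have "\<Phi> T - \<Phi> x = integral {x..T} q2 - q1 T * H x T"
    using primitive_diff[OF q2_loc xT] by (simp add: \<Phi>_def H_def)
  \<comment> \<open>One \<open>\<kappa>\<close> comes from the boundary term
    \<open>q1 T * H x T\<close>, the other from the increment of \<open>\<Phi>\<close>.\<close>
  ultimately have I2: "\<bar>integral {x..T} q2\<bar> \<le> 2 * \<kappa>" using \<kappa>[of T] xT by auto
  have "q = (\<lambda>t. q1 t + q2 t)" by (rule ext) (rule q_split)
  then have "Q T - Q x = integral {x..T} (\<lambda>t. q1 t + q2 t)"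
    using primitive_diff[OF q_loc xT] by metis
  also have "\<dots> = integral {x..T} q1 + integral {x..T} q2"
    by (intro Henstock_Kurzweil_Integration.integral_add q1int loc_integrable_integrable_on q2_loc)
  finally show "\<bar>Q (x + \<tau> * w x) - Q x - \<tau>\<bar> \<le> 2 * K * \<delta> + 2 * kappa_tilde s q1 q2 x"
    using I1 I2 by (simp add: T_def \<kappa>_def)
qed

text \<open>From here on, hypotheses (a) to (e) enter only through this statement: in the rescaled
  variable \<open>\<tau>\<close>, \<open>w\<close> is nearly constant and \<open>Q\<close> grows
  nearly with slope 1.\<close>

lemma eventually_window:
  assumes K: "K \<ge> 0" and \<delta>: "\<delta> > 0"
  shows "\<forall>\<^sub>F x in at_infinity. \<forall>\<tau>\<in>{0..K}. \<bar>w (x + \<tau> * w x) / w x - 1\<bar> \<le> \<delta> \<and> \<bar>Q (x + \<tau> * w x) - Q x - \<tau>\<bar> \<le> \<delta>"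
proof -
  obtain \<nu> where \<nu>: "\<nu> \<ge> 1" and ev_s: "\<forall>\<^sub>F x in at_infinity. \<forall>t\<in>Delta s q1 x. 1 / \<nu> \<le> s t / s x \<and> s t / s x \<le> \<nu>"
    using cond_d by blast
  \<comment> \<open>The window estimates require \<open>1 / 2\<close>; \<open>\<delta>\<close>
    controls the ratio of \<open>w\<close>; the last term gives
    \<open>2 * K * \<epsilon> \<le> \<delta> / 2\<close>, leaving the other half of
    \<open>\<delta>\<close> to \<open>kappa_tilde\<close>.\<close>
  define \<epsilon> where "\<epsilon> = min (1 / 2) (min \<delta> (\<delta> / (4 * (K + 1))))"
  have \<epsilon>1: "\<epsilon> > 0" using \<delta> K by (simp add: \<epsilon>_def)
  have \<epsilon>2: "\<epsilon> \<le> 1 / 2" unfolding \<epsilon>_def by (rule min.cobounded1)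
  have "\<epsilon> \<le> \<delta>" by (simp add: \<epsilon>_def)
  with \<epsilon>1 \<epsilon>2 have \<epsilon>: "\<epsilon> > 0" "\<epsilon> \<le> 1 / 2" "\<epsilon> \<le> \<delta>" by auto
  have "\<epsilon> \<le> \<delta> / (4 * (K + 1))" by (simp add: \<epsilon>_def)
  then have "\<epsilon> * (4 * (K + 1)) \<le> \<delta>" using K by (simp add: pos_le_divide_eq)
  then have \<epsilon>K: "2 * K * \<epsilon> \<le> \<delta> / 2" using \<epsilon>(1) by (simp add: algebra_simps)
  have "\<forall>\<^sub>F x in at_infinity. s x \<ge> max K (\<nu> * K / \<epsilon>)"
    by (rule cond_a[unfolded filterlim_at_top, THEN spec])
  moreover have "\<forall>\<^sub>F x in at_infinity. dist (kappa_tilde s q1 q2 x) 0 < \<delta> / 4"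
    by (rule tendstoD[OF cond_e]) (use \<delta> in simp)
  ultimately show ?thesis using eventually_on_Delta[OF cond_b] ev_s
  proof eventually_elim
    case (elim x)
    have sx: "s x > 0" by (rule s_pos)
    \<comment> \<open>Hypothesis (b) involves \<open>s t\<close>; (d) exchanges it for the fixed
      \<open>s x\<close> at the price of the factor \<open>\<nu>\<close>.\<close>
    have b: "\<bar>d\<bar> \<le> \<nu> * (q1 t)\<^sup>2 / s x" if t: "t \<in> Delta s q1 x" and d: "(q1 has_real_derivative d) (at t)" for t d
    proof -
      have "\<bar>d\<bar> / (q1 t)\<^sup>2 \<le> 1 / s t" using elim(3) t d by blast
      then have "\<bar>d\<bar> \<le> (q1 t)\<^sup>2 / s t" using q1_pos[of t] by (simp add: pos_divide_le_eq)
      also have "1 / \<nu> \<le> s t / s x" using elim(4) t by blast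
      then have "s x / \<nu> \<le> s t" using sx \<nu> by (simp add: field_simps)
      then have "(q1 t)\<^sup>2 / s t \<le> (q1 t)\<^sup>2 / (s x / \<nu>)" using sx \<nu> s_pos[of t] by (intro divide_left_mono) auto
      also have "\<dots> = \<nu> * (q1 t)\<^sup>2 / s x" by simp
      finally show ?thesis .
    qed
    have "\<nu> * K / \<epsilon> \<le> s x" using elim(1) by simp
    then have \<epsilon>x: "\<nu> * K / s x \<le> \<epsilon>" using sx \<epsilon>(1) by (simp add: field_simps)
    have Ks: "K \<le> s x" using elim(1) by simp
    have \<nu>0: "\<nu> > 0" using \<nu> by simp
    show ?case
    proof (intro ballI conjI)
      fix \<tau> assume \<tau>: "\<tau> \<in> {0..K}"
      show "\<bar>w (x + \<tau> * w x) / w x - 1\<bar> \<le> \<delta>"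
        using window_estimates(1)[OF b \<nu>0 K Ks \<epsilon>x \<epsilon>(2) \<tau>] \<epsilon>(3) by simp
      have "\<bar>Q (x + \<tau> * w x) - Q x - \<tau>\<bar> \<le> 2 * K * \<epsilon> + 2 * kappa_tilde s q1 q2 x"
        by (rule window_estimates(2)[OF b \<nu>0 K Ks \<epsilon>x \<epsilon>(2) \<tau>])
      then show "\<bar>Q (x + \<tau> * w x) - Q x - \<tau>\<bar> \<le> \<delta>" using \<epsilon>K elim(2) by simp
    qed
  qed
qed

text \<open>Over a window of fixed length, \<open>J r\<close> gains at most \<open>K * w\<close> and the remainder is damped by a
  factor that beats the growth of \<open>w\<close>; iterating the window bounds \<open>J r\<close> by a multiple of \<open>w\<close>.\<close>

lemma J_le_w:
  assumes r: "r > 0"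
  obtains A where "A > 0" "\<forall>x. J r x \<le> A * w x"
proof -
  \<comment> \<open>The increment of \<open>Q\<close> over the window differs from \<open>K\<close>
    by at most 1 / 2, so it is at least \<open>ln 3 / r\<close> and the damping factor is at most 1
    / 3.\<close>
  define K where "K = 1 / 2 + ln 3 / r"
  have K: "K \<ge> 0" using r by (simp add: K_def)
  have "\<exists>X. \<forall>x. X \<le> \<bar>x\<bar> \<longrightarrow> (\<forall>\<tau>\<in>{0..K}.
      \<bar>w (x + \<tau> * w x) / w x - 1\<bar> \<le> 1 / 2 \<and> \<bar>Q (x + \<tau> * w x) - Q x - \<tau>\<bar> \<le> 1 / 2)"
    using eventually_window[OF K half_gt_zero[OF zero_less_one]] unfolding eventually_at_infinity real_norm_def .
  then obtain X where X: "\<forall>x. X \<le> \<bar>x\<bar> \<longrightarrow> (\<forall>\<tau>\<in>{0..K}.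
      \<bar>w (x + \<tau> * w x) / w x - 1\<bar> \<le> 1 / 2 \<and> \<bar>Q (x + \<tau> * w x) - Q x - \<tau>\<bar> \<le> 1 / 2)" ..
  have step: "J r x \<le> K * w x + (1 / 3) * J r (x + K * w x)" and w1: "w (x + K * w x) \<le> (3 / 2) * w x"
    if x: "\<bar>x\<bar> \<ge> X" for x
  proof -
    have KK: "K \<in> {0..K}" using K by simp
    have wx: "w x > 0" by (rule w_pos)
    have le: "x \<le> x + K * w x" using K wx by simp
    have W: "\<bar>w (x + K * w x) / w x - 1\<bar> \<le> 1 / 2" "\<bar>Q (x + K * w x) - Q x - K\<bar> \<le> 1 / 2"
      using X[rule_format, OF x KK] by auto
    then have "w (x + K * w x) / w x \<le> 3 / 2" by linarith
    then show "w (x + K * w x) \<le> (3 / 2) * w x" using wx by (simp add: pos_divide_le_eq)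
    have "ln 3 / r \<le> Q (x + K * w x) - Q x" using W(2) unfolding K_def by linarith
    then have "ln 3 \<le> r * (Q (x + K * w x) - Q x)" using r by (simp add: pos_divide_le_eq mult.commute)
    then have "exp (- r * (Q (x + K * w x) - Q x)) \<le> exp (- ln 3)" by simp
    also have "exp (- ln 3) = (1 / 3 :: real)" by (simp add: exp_minus)
    finally have e: "exp (- r * (Q (x + K * w x) - Q x)) \<le> 1 / 3" .
    have "integral {x..x + K * w x} (\<lambda>t. exp (- r * (Q t - Q x))) \<le> integral {x..x + K * w x} (\<lambda>t. 1)"
      using r Q_mono by (intro integral_le integrable_continuous_interval continuous_intros Q_continuous) auto
    also have "\<dots> = K * w x" using le by simp
    finally have i: "integral {x..x + K * w x} (\<lambda>t. exp (- r * (Q t - Q x))) \<le> K * w x" .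
    have "J r x = integral {x..x + K * w x} (\<lambda>t. exp (- r * (Q t - Q x)))
        + exp (- r * (Q (x + K * w x) - Q x)) * J r (x + K * w x)"
      by (rule J_split[OF r le])
    also have "\<dots> \<le> K * w x + (1 / 3) * J r (x + K * w x)"
      by (intro add_mono i mult_right_mono e J_nonneg)
    finally show "J r x \<le> K * w x + (1 / 3) * J r (x + K * w x)" .
  qed
  define C where "C = exp (r * c) / (r * rate)"
  have C: "J r x \<le> C" for x unfolding C_def by (rule J_bound[OF r])
  have Cpos: "C > 0" using r rate_pos by (simp add: C_def)
  \<comment> \<open>The window estimates say nothing for \<open>\<bar>x\<bar> < X\<close>; there
    \<open>w\<close> has a positive minimum, and the constant bound \<open>C\<close>
    suffices.\<close>
  define X' where "X' = max X 0"
  obtain m where m: "m \<in> {-X'..X'}" "\<And>x. x \<in> {-X'..X'} \<Longrightarrow> w m \<le> w x"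
    using continuous_attains_inf[of "{-X'..X'}" w] w_continuous by (auto simp: X'_def)
  have wm: "w m > 0" by (rule w_pos)
  \<comment> \<open>\<open>2 * K\<close> is the fixed point of
    \<open>A = K + (1 / 3) * (3 / 2) * A\<close>; the second term makes \<open>A * w\<close> at
    least \<open>C\<close> on the bounded range.\<close>
  define A where "A = max (2 * K) (C / w m)"
  have A: "A > 0" "2 * K \<le> A" "C / w m \<le> A" using Cpos wm by (auto simp: A_def less_max_iff_disj)
  have iter: "\<forall>x. J r x \<le> A * w x + C / 2 ^ n" for n
  proof (induction n)
    case 0
    have "J r x \<le> A * w x + C" for x
      using C[of x] mult_pos_pos[OF A(1) w_pos[of x]] by linarith
    then show ?case by simp
  next
    case (Suc n)
    show ?case
    proof
      fix x
      have wx: "w x > 0" by (rule w_pos)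
      show "J r x \<le> A * w x + C / 2 ^ Suc n"
      proof (cases "\<bar>x\<bar> \<ge> X")
        case True
        have "J r x \<le> K * w x + (1 / 3) * J r (x + K * w x)" by (rule step[OF True])
        also have "\<dots> \<le> K * w x + (1 / 3) * (A * w (x + K * w x) + C / 2 ^ n)"
          using Suc by (intro add_left_mono mult_left_mono) auto
        also have "\<dots> \<le> K * w x + (1 / 3) * (A * ((3 / 2) * w x) + C / 2 ^ n)"
          using A(1) by (intro add_left_mono mult_left_mono add_right_mono w1[OF True]) auto
        also have "\<dots> = (2 * K) * w x / 2 + A * w x / 2 + (1 / 3) * (C / 2 ^ n)" by (simp add: algebra_simps)
        also have "\<dots> \<le> A * w x / 2 + A * w x / 2 + (1 / 2) * (C / 2 ^ n)"
          using A(2) wx Cpos by (intro add_mono divide_right_mono mult_right_mono) auto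
        also have "\<dots> = A * w x + C / 2 ^ Suc n" by simp
        finally show ?thesis .
      next
        case False
        then have "w m \<le> w x" by (intro m(2)) (auto simp: X'_def)
        have "J r x \<le> C" by (rule C)
        also have "\<dots> = (C / w m) * w m" using wm by simp
        also have "\<dots> \<le> A * w x" using \<open>w m \<le> w x\<close> A wm by (intro mult_mono) auto
        also have "\<dots> \<le> A * w x + C / 2 ^ Suc n" using Cpos by simp
        finally show ?thesis .
      qed
    qed
  qed
  have "J r x \<le> A * w x" for x
  proof (rule LIMSEQ_le_const)
    have half: "(\<lambda>n. (1 / 2 :: real) ^ n) \<longlonglongrightarrow> 0" by (rule LIMSEQ_realpow_zero) simp_all
    have "(\<lambda>n. A * w x + C * (1 / 2) ^ n) \<longlonglongrightarrow> A * w x + C * 0"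
      by (intro tendsto_add tendsto_mult tendsto_const half)
    then show "(\<lambda>n. A * w x + C / 2 ^ n) \<longlonglongrightarrow> A * w x" by (simp add: power_one_over)
    show "\<exists>N. \<forall>n\<ge>N. J r x \<le> A * w x + C / 2 ^ n" using iter by blast
  qed
  then show thesis using A(1) that by blast
qed

text \<open>With \<open>\<tau> = (t - x) / w x\<close>, the kernel power on the window is
  \<open>exp (- r * \<tau>)\<close> up to factors between \<open>exp (- r * \<delta>)\<close> and
  \<open>exp (r * \<delta>)\<close>, and the model integral is
  \<open>w x * (1 - exp (- r * K)) / r\<close>. Beyond the window the bound \<open>A * w\<close> is
  damped by \<open>exp (- r * (K - \<delta>))\<close>.\<close>

lemma J_window_bounds:
  assumes r: "r > 0" and A: "\<forall>x. J r x \<le> A * w x" "A > 0" and K: "K > 0" and \<delta>: "\<delta> > 0"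
  shows "\<forall>\<^sub>F x in at_infinity. exp (- r * \<delta>) * ((1 - exp (- r * K)) / r) \<le> J r x / w x \<and>
    J r x / w x \<le> exp (r * \<delta>) * ((1 - exp (- r * K)) / r) + exp (- r * (K - \<delta>)) * (A * (1 + \<delta>))"
  using eventually_window[OF less_imp_le[OF K] \<delta>]
proof eventually_elim
  case (elim x)
  define T where "T = x + K * w x"
  have wx: "w x > 0" by (rule w_pos)
  have xT: "x \<le> T" using K wx by (simp add: T_def)
  have "\<bar>w T / w x - 1\<bar> \<le> \<delta> \<and> \<bar>Q T - Q x - K\<bar> \<le> \<delta>"
    using elim[THEN bspec, of K] K by (simp add: T_def)
  then have wT: "w T / w x \<le> 1 + \<delta>" and QT: "K - \<delta> \<le> Q T - Q x" by linarith+
  define E where "E t = exp (- r * ((t - x) / w x))" for t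
  have Eint: "(E has_integral ((w x / r) * (1 - exp (- r * K)))) {x..T}"
  proof -
    have "(E has_integral ((- (w x / r) * exp (- r * ((T - x) / w x))) - (- (w x / r) * exp (- r * ((x - x) / w x))))) {x..T}"
    proof (rule fundamental_theorem_of_calculus[OF xT])
      fix t assume "t \<in> {x..T}"
      have "((\<lambda>t. - (w x / r) * exp (- r * ((t - x) / w x))) has_real_derivative E t) (at t within {x..T})"
        unfolding E_def using wx r by (auto intro!: derivative_eq_intros)
      then show "((\<lambda>t. - (w x / r) * exp (- r * ((t - x) / w x))) has_vector_derivative E t) (at t within {x..T})"
        by (simp add: has_real_derivative_iff_has_vector_derivative)
    qed
    moreover have "(T - x) / w x = K" using wx by (simp add: T_def)
    ultimately show ?thesis by (simp add: algebra_simps)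
  qed
  have Ei: "E integrable_on {x..T}" "integral {x..T} E = (w x / r) * (1 - exp (- r * K))"
    using Eint by (auto simp: integral_unique)
  define I where "I = integral {x..T} (\<lambda>t. exp (- r * (Q t - Q x)))"
  have win: "\<bar>(Q t - Q x) - (t - x) / w x\<bar> \<le> \<delta>" if t: "t \<in> {x..T}" for t
  proof -
    define \<tau> where "\<tau> = (t - x) / w x"
    have "\<tau> \<in> {0..K}" using t wx by (simp add: \<tau>_def T_def pos_divide_le_eq)
    moreover have "x + \<tau> * w x = t" using wx by (simp add: \<tau>_def)
    ultimately show ?thesis using elim[THEN bspec, of \<tau>] by (simp add: \<tau>_def)
  qed
  have ci: "(\<lambda>t. exp (- r * (Q t - Q x))) integrable_on {x..T}"
    by (intro integrable_continuous_interval continuous_intros Q_continuous)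
  have "I \<le> integral {x..T} (\<lambda>t. exp (r * \<delta>) * E t)"
    unfolding I_def
  proof (rule integral_le[OF ci integrable_on_mult_right[OF Ei(1)]])
    fix t assume t: "t \<in> {x..T}"
    define z where "z = (t - x) / w x"
    have "r * (z - \<delta>) \<le> r * (Q t - Q x)" using win[OF t, folded z_def] r by (intro mult_left_mono) auto
    then show "exp (- r * (Q t - Q x)) \<le> exp (r * \<delta>) * E t"
      unfolding E_def z_def[symmetric] exp_add[symmetric] by (simp add: algebra_simps)
  qed
  also have "\<dots> = exp (r * \<delta>) * integral {x..T} E" by simp
  finally have up: "I \<le> exp (r * \<delta>) * ((w x / r) * (1 - exp (- r * K)))" using Ei(2) by simp
  have "integral {x..T} (\<lambda>t. exp (- r * \<delta>) * E t) \<le> I"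
    unfolding I_def
  proof (rule integral_le[OF integrable_on_mult_right[OF Ei(1)] ci])
    fix t assume t: "t \<in> {x..T}"
    define z where "z = (t - x) / w x"
    have "r * (Q t - Q x) \<le> r * (z + \<delta>)" using win[OF t, folded z_def] r by (intro mult_left_mono) auto
    then show "exp (- r * \<delta>) * E t \<le> exp (- r * (Q t - Q x))"
      unfolding E_def z_def[symmetric] exp_add[symmetric] by (simp add: algebra_simps)
  qed
  moreover have "integral {x..T} (\<lambda>t. exp (- r * \<delta>) * E t) = exp (- r * \<delta>) * integral {x..T} E" by simp
  ultimately have low: "exp (- r * \<delta>) * ((w x / r) * (1 - exp (- r * K))) \<le> I" using Ei(2) by simp
  have Jx: "J r x = I + exp (- r * (Q T - Q x)) * J r T" unfolding I_def by (rule J_split[OF r xT])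
  have "exp (- r * (Q T - Q x)) * J r T \<le> exp (- r * (K - \<delta>)) * (A * w T)"
    using r QT A(1) J_nonneg by (intro mult_mono) auto
  then have "J r x / w x \<le> (exp (r * \<delta>) * ((w x / r) * (1 - exp (- r * K))) + exp (- r * (K - \<delta>)) * (A * w T)) / w x"
    unfolding Jx using up wx by (intro divide_right_mono) auto
  also have "\<dots> = exp (r * \<delta>) * ((1 - exp (- r * K)) / r) + exp (- r * (K - \<delta>)) * (A * (w T / w x))"
    using wx by (simp add: add_divide_distrib)
  also have "\<dots> \<le> exp (r * \<delta>) * ((1 - exp (- r * K)) / r) + exp (- r * (K - \<delta>)) * (A * (1 + \<delta>))"
    using wT A(2) by (intro add_left_mono mult_left_mono) auto
  finally have U: "J r x / w x \<le> exp (r * \<delta>) * ((1 - exp (- r * K)) / r) + exp (- r * (K - \<delta>)) * (A * (1 + \<delta>))" .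
  have "exp (- r * \<delta>) * ((1 - exp (- r * K)) / r) = (exp (- r * \<delta>) * ((w x / r) * (1 - exp (- r * K)))) / w x"
    using wx by simp
  also have "\<dots> \<le> J r x / w x"
    unfolding Jx using low wx J_nonneg[of r T] by (intro divide_right_mono) (auto intro: add_increasing2)
  finally show ?case using U by blast
qed

lemma J_asymptotic:
  assumes r: "r > 0"
  shows "((\<lambda>x. J r x / w x) \<longlongrightarrow> 1 / r) at_infinity"
proof (rule tendstoI)
  fix \<epsilon> :: real assume \<epsilon>: "\<epsilon> > 0"
  obtain A where A: "A > 0" "\<forall>x. J r x \<le> A * w x" by (rule J_le_w[OF r])
  \<comment> \<open>Tying the tolerance to the window by \<open>\<delta> = 1 / K\<close> leaves one
    parameter. Both bounds tend to \<open>1 / r\<close> as \<open>K\<close> grows, so some fixed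
    \<open>K\<close> brings them within \<open>\<epsilon>\<close> before \<open>x\<close> tends to
    infinity.\<close>
  have "((\<lambda>K. exp (- r * (1 / K)) * ((1 - exp (- r * K)) / r)) \<longlongrightarrow> 1 / r) at_top"
    using r by (real_asymp simp: field_simps)
  then have L: "\<forall>\<^sub>F K in at_top. dist (exp (- r * (1 / K)) * ((1 - exp (- r * K)) / r)) (1 / r) < \<epsilon>"
    by (rule tendstoD[OF _ \<epsilon>])
  have "((\<lambda>K. exp (r * (1 / K)) * ((1 - exp (- r * K)) / r) + exp (- r * (K - 1 / K)) * (A * (1 + 1 / K))) \<longlongrightarrow> 1 / r) at_top"
    using r A(1) by (real_asymp simp: field_simps)
  then have U: "\<forall>\<^sub>F K in at_top. dist (exp (r * (1 / K)) * ((1 - exp (- r * K)) / r) + exp (- r * (K - 1 / K)) * (A * (1 + 1 / K))) (1 / r) < \<epsilon>"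
    by (rule tendstoD[OF _ \<epsilon>])
  from L U eventually_gt_at_top[of "0::real"] have "\<forall>\<^sub>F K in at_top.
     dist (exp (- r * (1 / K)) * ((1 - exp (- r * K)) / r)) (1 / r) < \<epsilon> \<and>
     dist (exp (r * (1 / K)) * ((1 - exp (- r * K)) / r) + exp (- r * (K - 1 / K)) * (A * (1 + 1 / K))) (1 / r) < \<epsilon> \<and> K > 0"
    by eventually_elim blast
  then obtain K where K: "dist (exp (- r * (1 / K)) * ((1 - exp (- r * K)) / r)) (1 / r) < \<epsilon>"
     "dist (exp (r * (1 / K)) * ((1 - exp (- r * K)) / r) + exp (- r * (K - 1 / K)) * (A * (1 + 1 / K))) (1 / r) < \<epsilon>" "K > 0"
    using eventually_happens'[OF trivial_limit_at_top_linorder] by blast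
  have "1 / K > 0" using K(3) by simp
  from J_window_bounds[OF r A(2,1) K(3) this]
  show "\<forall>\<^sub>F x in at_infinity. dist (J r x / w x) (1 / r) < \<epsilon>"
    by eventually_elim (use K(1,2) in \<open>simp only: dist_real_def, linarith\<close>)
qed

section \<open>The majorants for all exponents\<close>

lemma kappa_p_regular: "continuous_on UNIV (kappa_p p q1)" "0 < kappa_p p q1 x" if p: "1 \<le> p"
proof -
  consider "p = 1" | "p = \<infinity>" | "p \<noteq> 1" "p \<noteq> \<infinity>" by blast
  then show "continuous_on UNIV (kappa_p p q1)"
  proof cases
    case 3
    then obtain p' where "p = ereal p'" "1 < p'" using p by (cases p) (auto simp: one_ereal_def)
    then show ?thesis unfolding kappa_p_def[abs_def] Let_def using q1_pos
      by (auto intro!: continuous_intros q1_continuous simp: less_imp_neq[symmetric])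
  qed (use q1_pos in \<open>auto simp: kappa_p_def[abs_def] less_imp_neq[symmetric] intro!: continuous_intros q1_continuous\<close>)
  show "0 < kappa_p p q1 x"
  proof (cases "p = 1 \<or> p = \<infinity>")
    case False
    then obtain p' where p': "p = ereal p'" "1 < p'" using p by (cases p) (auto simp: one_ereal_def)
    define r where "r = p' / (p' - 1)"
    have "r > 0" using p' by (simp add: r_def)
    moreover have "kappa_p p q1 x = 1 / (r powr (1 / r)) * (1 / (q1 x powr (1 / r)))"
      using p' by (simp add: kappa_p_def r_def one_ereal_def Let_def)
    ultimately show ?thesis using q1_pos[of x] by simp
  qed (use q1_pos[of x] in \<open>auto simp: kappa_p_def\<close>)
qed

text \<open>The suprema are known exactly at every \<open>x\<close>: divided by
  \<open>kappa_p\<close> they are 1 for \<open>p = 1\<close>, \<open>J 1 x / w x\<close> for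
  \<open>p = \<infinity>\<close>, and \<open>(r * (J r x / w x)) powr (1 / r)\<close> otherwise, so
  the asymptotics of \<open>J\<close> decides.\<close>

lemma asymptotic_majorant_kappa_p:
  assumes p: "1 \<le> p"
  shows "asymptotic_majorant p q (kappa_p p q1)"
proof -
  consider "p = 1" | "p = \<infinity>" | p' where "p = ereal p'" "1 < p'"
    using p by (cases p) (auto simp: one_ereal_def order.order_iff_strict)
  then have "(\<forall>x. bdd_above ((\<lambda>y. \<bar>y x\<bar>) ` D p q)) \<and>
     ((\<lambda>x. (SUP y\<in>D p q. \<bar>y x\<bar>) / kappa_p p q1 x) \<longlongrightarrow> 1) at_infinity"
  proof cases
    case 1
    then show ?thesis by (simp add: D_one_sup kappa_p_def)
  next
    case 2
    have "((\<lambda>x. J 1 x / w x) \<longlongrightarrow> 1) at_infinity" using J_asymptotic[of 1] by simp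
    then show ?thesis using 2 by (simp add: D_infty_sup kappa_p_def w_def)
  next
    case 3
    define r where "r = p' / (p' - 1)"
    have r: "r > 1" using 3 by (simp add: r_def field_simps)
    have "((\<lambda>x. (r * (J r x / w x)) powr (1 / r)) \<longlongrightarrow> (r * (1 / r)) powr (1 / r)) at_infinity"
      using r by (intro tendsto_intros J_asymptotic) auto
    moreover have "(SUP y\<in>D p q. \<bar>y x\<bar>) / kappa_p p q1 x = (r * (J r x / w x)) powr (1 / r)" for x
    proof -
      have "kappa_p p q1 x = 1 / (r powr (1 / r)) * (1 / (q1 x powr (1 / r)))"
        using 3 by (simp add: kappa_p_def r_def one_ereal_def Let_def)
      moreover have "(SUP y\<in>D p q. \<bar>y x\<bar>) = J r x powr (1 / r)"
        using D_p_sup[OF 3(2) r_def] 3(1) by simp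
      ultimately show ?thesis
        using r J_nonneg[of r x] q1_pos[of x] by (simp add: w_def powr_mult mult_ac)
    qed
    ultimately have "((\<lambda>x. (SUP y\<in>D p q. \<bar>y x\<bar>) / kappa_p p q1 x) \<longlongrightarrow> 1) at_infinity" using r by simp
    moreover have "bdd_above ((\<lambda>y. \<bar>y x\<bar>) ` D p q)" for x
      using D_p_upper[OF 3(2) r_def] 3(1) by (intro D_bdd) auto
    ultimately show ?thesis by blast
  qed
  then show ?thesis using kappa_p_regular[OF p] by (simp add: asymptotic_majorant_def)
qed

end

theorem theorem1p4:
  fixes q q1 q2 s :: "real \<Rightarrow> real"
  assumes q_nonneg: "\<forall>x. q x \<ge> 0"
    and q_loc: "loc_integrable q"
    and q_inf: "\<exists>a>0. \<exists>c>0. \<forall>x. (LBINT t:{x-a..x+a}. q t) \<ge> c"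
    and q_split: "\<forall>x. q x = q1 x + q2 x"
    and q1_pos: "\<forall>x. q1 x > 0"
    and q1_ac: "abs_cont q1"
    and q2_loc: "loc_integrable q2"
    and s_cont: "continuous_on UNIV s"
    and s_pos: "\<forall>x. s x > 0"
    and cond_a: "filterlim s at_top at_infinity"
    and cond_b: "\<forall>\<^sub>F x in at_infinity. \<forall>d. (q1 has_real_derivative d) (at x)
                    \<longrightarrow> 1 / s x \<ge> \<bar>d\<bar> / (q1 x)\<^sup>2"
    and cond_c: "((\<lambda>x. s x / (x * q1 x)) \<longlongrightarrow> 0) at_infinity"
    and cond_d: "\<exists>\<nu>\<ge>1. \<forall>\<^sub>F x in at_infinity. \<forall>t\<in>Delta s q1 x.
                    1 / \<nu> \<le> s t / s x \<and> s t / s x \<le> \<nu>"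
    and cond_e: "(kappa_tilde s q1 q2 \<longlongrightarrow> 0) at_infinity"
  shows "\<forall>p::ereal. 1 \<le> p \<longrightarrow> asymptotic_majorant p q (kappa_p p q1)"
proof -
  obtain a c where ac: "a > 0" "c > 0" "\<And>x. c \<le> (LBINT t:{x-a..x+a}. q t)" using q_inf by blast
  \<comment> \<open>On bounded intervals the Lebesgue integral of the hypothesis agrees with the
    gauge integral that defines \<open>Q\<close>.\<close>
  have "c \<le> integral {x - a..x + a} q" for x
    using ac(3)[of x] set_borel_integral_eq_integral(2)[of "{x - a..x + a}" q] q_loc by (simp add: loc_integrable_def)
  then interpret slowly_varying_split q a c q1 q2 s
    by unfold_locales (use assms ac in auto)
  show ?thesis using asymptotic_majorant_kappa_p by blast
qed

end
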